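(* Let $G$ be a planar graph that contains no $3$-cycle and no two normally adjacent $4$-cycles (two $4$-cycles are normally adjacent if they share exactly one edge). Then $G$ is $(7m,2m)$-DP-colorable for every positive integer $m$.
   Context: All graphs are finite and simple. A cover of a graph $G$ is a pair $(L,H)$ where $H$ is a graph and $L$ assigns to each $u\in V(G)$ a set $L(u)\subseteq V(H)$ such that: the sets $L(u)$, $u\in V(G)$, partition $V(H)$; if $L(v)\cap N_H(L(u))\neq\emptyset$ then $v\in N_G[u]$; each $H[L(u)]$ is complete; and if $uv\in E(G)$ then the edges of $H$ between $L(u)$ and $L(v)$ form a matching (possibly empty, not necessarily perfect). Edges of $H$ joining distinct parts $L(u)\ne L(v)$ are cross-edges; a set $S\subseteq V(H)$ is quasi-independent if $H[S]$ has no cross-edges. For $f\in\mathbb{N}^{V(G)}$, an $f$-cover is a cover with $|L(v)|=f(v)$ for all $v$. For a cover $\mathcal{H}=(L,H)$ and $g\in\mathbb{N}^{V(G)}$, an $(\mathcal{H},g)$-coloring is a quasi-independent set $S\subseteq V(H)$ with $|S\cap L(v)|=g(v)$ for every $v$. $G$ is $(f,g)$-DP-colorable if it has an $(\mathcal{H},g)$-coloring for every $f$-cover $\mathcal{H}$; $G$ is $(a,b)$-DP-colorable if this holds for the constant functions $f\equiv a$, $g\equiv b$. *)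

theory Defs
  imports "HOL-Analysis.Analysis"
begin

section \<open>Finite simple graphs\<close>

record 'a sgraph =
  verts :: "'a set"
  edges :: "'a set set"

definition simple_graph :: "'a sgraph \<Rightarrow> bool" where
  "simple_graph G \<longleftrightarrow>
     finite (verts G) \<and> (\<forall>e\<in>edges G. e \<subseteq> verts G \<and> card e = 2)"

definition induced_subgraph :: "'a sgraph \<Rightarrow> 'a set \<Rightarrow> 'a sgraph" where
  "induced_subgraph G S = \<lparr>verts = S, edges = {e \<in> edges G. e \<subseteq> S}\<rparr>"

definition complete_graph :: "'a sgraph \<Rightarrow> bool" where
  "complete_graph G \<longleftrightarrow> (\<forall>x\<in>verts G. \<forall>y\<in>verts G. x \<noteq> y \<longrightarrow> {x, y} \<in> edges G)"

definition nbhd :: "'a sgraph \<Rightarrow> 'a set \<Rightarrow> 'a set" where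
  "nbhd G S = {y \<in> verts G. \<exists>x\<in>S. {x, y} \<in> edges G}"

definition closed_nbhd :: "'a sgraph \<Rightarrow> 'a \<Rightarrow> 'a set" where
  "closed_nbhd G u = insert u (nbhd G {u})"

definition edges_between :: "'a sgraph \<Rightarrow> 'a set \<Rightarrow> 'a set \<Rightarrow> 'a set set" where
  "edges_between G A B = {e \<in> edges G. \<exists>x\<in>A. \<exists>y\<in>B. e = {x, y}}"

definition matching :: "'a set set \<Rightarrow> bool" where
  "matching M \<longleftrightarrow> (\<forall>e\<in>M. \<forall>e'\<in>M. e \<noteq> e' \<longrightarrow> e \<inter> e' = {})"

section \<open>Cycles\<close>

definition cycle_edges :: "'a list \<Rightarrow> 'a set set" where
  "cycle_edges xs = {{xs ! i, xs ! (Suc i mod length xs)} | i. i < length xs}"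

text \<open>A cycle of \<open>G\<close>, as a subgraph, is determined by its edge set, so the set of
  \<open>k\<close>-cycles is represented by the set of their edge sets.\<close>

definition cycles :: "'a sgraph \<Rightarrow> nat \<Rightarrow> 'a set set set" where
  "cycles G k = {cycle_edges xs | xs. k \<ge> 3 \<and> length xs = k \<and> distinct xs \<and>
                   set xs \<subseteq> verts G \<and> cycle_edges xs \<subseteq> edges G}"

definition normally_adjacent :: "'a set set \<Rightarrow> 'a set set \<Rightarrow> bool" where
  "normally_adjacent C C' \<longleftrightarrow> card (C \<inter> C') = 1"

section \<open>Planarity\<close>

text \<open>The plane is \<open>complex\<close>.  Vertices are drawn as distinct points and edges as arcs
  (injective paths) joining their ends; an arc meets the points of the drawing only in
  its own ends, and two arcs meet only in points of common end vertices.\<close>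

definition plane_drawing ::
    "'a sgraph \<Rightarrow> ('a \<Rightarrow> complex) \<Rightarrow> ('a set \<Rightarrow> real \<Rightarrow> complex) \<Rightarrow> bool" where
  "plane_drawing G p \<gamma> \<longleftrightarrow>
     inj_on p (verts G) \<and>
     (\<forall>e\<in>edges G. arc (\<gamma> e) \<and>
        {pathstart (\<gamma> e), pathfinish (\<gamma> e)} = p ` e \<and>
        path_image (\<gamma> e) \<inter> p ` verts G = p ` e) \<and>
     (\<forall>e\<in>edges G. \<forall>e'\<in>edges G. e \<noteq> e' \<longrightarrow>
        path_image (\<gamma> e) \<inter> path_image (\<gamma> e') \<subseteq> p ` (e \<inter> e'))"

definition planar :: "'a sgraph \<Rightarrow> bool" where
  "planar G \<longleftrightarrow> (\<exists>p \<gamma>. plane_drawing G p \<gamma>)"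

section \<open>Covers and DP-coloring\<close>

text \<open>Parts \<open>L u\<close> may be empty, as \<open>f\<close>-covers with \<open>f u = 0\<close> are allowed.  Values of
  \<open>L\<close> outside \<open>verts G\<close> are irrelevant.\<close>

definition cover :: "'a sgraph \<Rightarrow> ('a \<Rightarrow> 'b set) \<Rightarrow> 'b sgraph \<Rightarrow> bool" where
  "cover G L H \<longleftrightarrow>
     simple_graph H \<and>
     (\<Union>u\<in>verts G. L u) = verts H \<and>
     disjoint_family_on L (verts G) \<and>
     (\<forall>u\<in>verts G. \<forall>v\<in>verts G. L v \<inter> nbhd H (L u) \<noteq> {} \<longrightarrow> v \<in> closed_nbhd G u) \<and>
     (\<forall>u\<in>verts G. complete_graph (induced_subgraph H (L u))) \<and>
     (\<forall>u\<in>verts G. \<forall>v\<in>verts G. {u, v} \<in> edges G \<longrightarrow>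
        matching (edges_between H (L u) (L v)))"

definition cross_edges :: "'a sgraph \<Rightarrow> ('a \<Rightarrow> 'b set) \<Rightarrow> 'b sgraph \<Rightarrow> 'b set set" where
  "cross_edges G L H =
     (\<Union>u\<in>verts G. \<Union>v\<in>verts G - {u}. edges_between H (L u) (L v))"

definition quasi_independent ::
    "'a sgraph \<Rightarrow> ('a \<Rightarrow> 'b set) \<Rightarrow> 'b sgraph \<Rightarrow> 'b set \<Rightarrow> bool" where
  "quasi_independent G L H S \<longleftrightarrow>
     S \<subseteq> verts H \<and> edges (induced_subgraph H S) \<inter> cross_edges G L H = {}"

definition f_cover ::
    "'a sgraph \<Rightarrow> ('a \<Rightarrow> nat) \<Rightarrow> ('a \<Rightarrow> 'b set) \<Rightarrow> 'b sgraph \<Rightarrow> bool" where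
  "f_cover G f L H \<longleftrightarrow> cover G L H \<and> (\<forall>v\<in>verts G. card (L v) = f v)"

definition cover_coloring ::
    "'a sgraph \<Rightarrow> ('a \<Rightarrow> 'b set) \<Rightarrow> 'b sgraph \<Rightarrow> ('a \<Rightarrow> nat) \<Rightarrow> 'b set \<Rightarrow> bool" where
  "cover_coloring G L H g S \<longleftrightarrow>
     quasi_independent G L H S \<and> (\<forall>v\<in>verts G. card (S \<inter> L v) = g v)"

text \<open>A HOL definition cannot quantify over types, so the type \<open>'b\<close> of the vertices of
  the covers is a parameter, to be left free (universally quantified) in theorems.
  Instances at finite types \<open>'b\<close> only see the covers that fit into \<open>'b\<close>.\<close>

definition fg_dp_colorable ::
    "'b itself \<Rightarrow> 'a sgraph \<Rightarrow> ('a \<Rightarrow> nat) \<Rightarrow> ('a \<Rightarrow> nat) \<Rightarrow> bool" where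
  "fg_dp_colorable _ G f g \<longleftrightarrow>
     (\<forall>(L :: 'a \<Rightarrow> 'b set) H. f_cover G f L H \<longrightarrow> (\<exists>S. cover_coloring G L H g S))"

definition dp_colorable :: "'b itself \<Rightarrow> 'a sgraph \<Rightarrow> nat \<Rightarrow> nat \<Rightarrow> bool" where
  "dp_colorable T G a b \<longleftrightarrow> fg_dp_colorable T G (\<lambda>_. a) (\<lambda>_. b)"

end

theory Submission
  imports Defs
begin

text \<open>
  Fix a cover with lists of size \<open>7m\<close> and take a minimal set \<open>W\<close> of vertices that has no colouring;
  \<open>W\<close> induces a plane graph in which no extension argument applies.

  Topology gives sparsity. The complement of a drawing gains a component exactly when the new edge joins
  two vertices that were already connected (Jordan curve theorem and Janiszewski's theorem); hence Euler's
  inequality, and each edge lies on at most two faces. Two distinct faces bounded by 4-cycles share no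
  edge, since otherwise the union of the two faces and their common edges would fill a neighbourhood
  of a common vertex and leave no room for its third edge. So at most \<open>e/4\<close> faces have length 4, which yields
  \<open>11 e \<le> 20 n - 40\<close>.

  Colouring gives density. In \<open>W\<close> all degrees are at least 3, a vertex of degree 3, 4, 5 has at most
  1, 2, 4 neighbours of degree 3, respectively. Call a vertex of degree 4 with two neighbours of degree 3 a link.
  Consider the structure whose nodes are single vertices and adjacent pairs of vertices of degree 3 and whose
  edges are the links. A substructure in which each single node has at least two links and each pair at
  least one is reducible: every link has \<open>3m\<close> free colours, so it can serve one demand of \<open>m\<close> colours from
  each of its two ends. Hence there are at most as many links as single nodes, and discharging gives
  \<open>11 e \<ge> 20 n\<close>.
\<close>

section \<open>Plane drawings\<close>

text \<open>With lists of size \<open>7m\<close>, three coloured neighbours may block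
  \<open>6m\<close> colours and leave a vertex of degree 3 exactly \<open>m\<close> colours short.
  Every reduction therefore gains \<open>m\<close> colours at such vertices. A single vertex with
  two links gains them from redundancy: its neighbours offer at least \<open>8m\<close> colours, but
  only \<open>7m\<close> colours of its own list can be hit. A pair has room to spare in its first
  vertex, which has only two neighbours outside the pair, so the cooperation of one link suffices.
  The obstacle is that two ends share a link and neither may spoil what the other has gained. A
  witness of redundancy survives when colour sets grow, whereas a pair depends on the whole final
  set of a link. Hence single vertices reserve at most \<open>m\<close> colours per link first, and
  pairs state their demand when the link receives its final set. On the plane side a face need not
  be bounded by a cycle. Its boundary is replaced by the set of edges whose open arcs meet its
  closure; minimum degree 3 makes this set contain a cycle, which is enough for counting.\<close>

lemma arc_image_empty_interior:
  fixes g :: "real \<Rightarrow> complex"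
  assumes "arc g"
  shows "interior (path_image g) = {}"
proof (rule ccontr)
  assume ne: "interior (path_image g) \<noteq> {}"
  obtain h where h: "homeomorphism {0..1} (path_image g) g h"
    using assms homeomorphism_arc by blast
  let ?O = "interior (path_image g)"
  have "continuous_on (path_image g) h"
    using h by (simp add: homeomorphism_def)
  then have c: "continuous_on ?O h"
    by (rule continuous_on_subset[OF _ interior_subset])
  have i: "inj_on h ?O"
  proof (rule inj_on_inverseI)
    fix x assume "x \<in> ?O"
    then have "x \<in> path_image g" using interior_subset by blast
    then show "g (h x) = x" using h by (simp add: homeomorphism_def)
  qed
  \<comment> \<open>The inverse of the arc would embed a nonempty open subset of the plane into the
    line.\<close>
  have "DIM(complex) \<le> DIM(real)"
    by (rule invariance_of_dimension[OF c open_interior i ne])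
  then show False by simp
qed

text \<open>A component properly containing \<open>F\<close> would be connected and would have to
  meet the frontier of \<open>F\<close>, which lies in \<open>K\<close>. This is how sets assembled
  from pieces are recognised as faces.\<close>

lemma open_connected_in_components:
  fixes F :: "complex set"
  assumes "open F" "connected F" "F \<noteq> {}" "F \<inter> K = {}" "frontier F \<subseteq> K"
  shows "F \<in> components (- K)"
proof -
  obtain C where C: "C \<in> components (- K)" "F \<subseteq> C"
    using exists_component_superset[of F "- K"] assms by auto
  have "C \<subseteq> F"
  proof (rule ccontr)
    assume "\<not> C \<subseteq> F"
    then have "C \<inter> frontier F \<noteq> {}"
      using connected_Int_frontier[of C F] C in_components_connected assms(3) by blast
    then show False
      using C(1) assms(5) in_components_subset by blast
  qed
  then show ?thesis using C by auto
qed

lemma same_component_iff: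
  assumes "x \<in> S"
  shows "connected_component S x y \<longleftrightarrow> (\<exists>C\<in>components S. x \<in> C \<and> y \<in> C)"
proof
  assume "connected_component S x y"
  then show "\<exists>C\<in>components S. x \<in> C \<and> y \<in> C"
    using assms by (intro bexI[OF _ componentsI[OF assms]]) simp
next
  assume "\<exists>C\<in>components S. x \<in> C \<and> y \<in> C"
  then obtain C where C: "C \<in> components S" "x \<in> C" "y \<in> C" by blast
  show "connected_component S x y"
    unfolding connected_component_def
    using C in_components_connected[OF C(1)] in_components_subset[OF C(1)] by blast
qed

locale plane_graph =
  fixes G :: "'a sgraph" and p :: "'a \<Rightarrow> complex" and \<gamma> :: "'a set \<Rightarrow> real \<Rightarrow> complex"
  assumes simple: "simple_graph G" and drawing: "plane_drawing G p \<gamma>"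
begin

abbreviation V where "V \<equiv> verts G"
abbreviation E where "E \<equiv> edges G"

text \<open>All vertices belong to the drawn set, whatever \<open>A\<close> is. Inserting an edge
  thus adds only its open arc \<open>oe e\<close>, and faces can be followed one edge at a
  time.\<close>

definition \<Delta> :: "'a set set \<Rightarrow> complex set" where
  "\<Delta> A = p ` V \<union> (\<Union>e\<in>A. path_image (\<gamma> e))"

definition oe :: "'a set \<Rightarrow> complex set" where
  "oe e = path_image (\<gamma> e) - p ` e"

lemma finV: "finite V" and edge_sub: "e \<in> E \<Longrightarrow> e \<subseteq> V" and edge_card: "e \<in> E \<Longrightarrow> card e = 2"
  using simple by (auto simp: simple_graph_def)

lemma finE: "finite E"
proof (rule finite_subset)
  show "E \<subseteq> Pow V" using edge_sub by blast
  show "finite (Pow V)" using finV by simp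
qed

lemma edgeE:
  assumes "e \<in> E" obtains u v where "e = {u, v}" "u \<noteq> v" "u \<in> V" "v \<in> V"
proof -
  obtain u v where "e = {u, v}" "u \<noteq> v" using edge_card[OF assms] by (auto simp: card_2_iff)
  then show ?thesis using that edge_sub[OF assms] by blast
qed

lemma injp: "inj_on p V"
  and arc_edge: "e \<in> E \<Longrightarrow> arc (\<gamma> e)"
  and ends: "e \<in> E \<Longrightarrow> {pathstart (\<gamma> e), pathfinish (\<gamma> e)} = p ` e"
  and edge_verts: "e \<in> E \<Longrightarrow> path_image (\<gamma> e) \<inter> p ` V = p ` e"
  and edge_edge: "e \<in> E \<Longrightarrow> e' \<in> E \<Longrightarrow> e \<noteq> e' \<Longrightarrow>
        path_image (\<gamma> e) \<inter> path_image (\<gamma> e') \<subseteq> p ` (e \<inter> e')"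
  using drawing by (auto simp: plane_drawing_def)

lemma ends_sub: "e \<in> E \<Longrightarrow> p ` e \<subseteq> path_image (\<gamma> e)"
  using edge_verts by blast

lemma edge_\<Delta>:
  assumes "e \<in> E" "A \<subseteq> E" "e \<notin> A"
  shows "path_image (\<gamma> e) \<inter> \<Delta> A = p ` e"
proof
  show "path_image (\<gamma> e) \<inter> \<Delta> A \<subseteq> p ` e"
  proof
    fix z assume z: "z \<in> path_image (\<gamma> e) \<inter> \<Delta> A"
    show "z \<in> p ` e"
    proof (cases "z \<in> p ` V")
      case True then show ?thesis using z edge_verts[OF assms(1)] by blast
    next
      case False
      then obtain e' where e': "e' \<in> A" "z \<in> path_image (\<gamma> e')"
        using z by (auto simp: \<Delta>_def)
      then have "z \<in> p ` (e \<inter> e')"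
        using z edge_edge[of e e'] assms by blast
      then show ?thesis by blast
    qed
  qed
  show "p ` e \<subseteq> path_image (\<gamma> e) \<inter> \<Delta> A"
    using ends_sub[OF assms(1)] edge_sub[OF assms(1)] by (auto simp: \<Delta>_def)
qed

lemma oe_\<Delta>: "e \<in> E \<Longrightarrow> A \<subseteq> E \<Longrightarrow> e \<notin> A \<Longrightarrow> oe e \<inter> \<Delta> A = {}"
  using edge_\<Delta> by (auto simp: oe_def)

lemma oe_oe: "e \<in> E \<Longrightarrow> e' \<in> E \<Longrightarrow> e \<noteq> e' \<Longrightarrow> oe e \<inter> oe e' = {}"
  using edge_edge[of e e'] by (auto simp: oe_def)

lemma oe_pV: "e \<in> E \<Longrightarrow> oe e \<inter> p ` V = {}"
  using edge_verts[of e] by (auto simp: oe_def)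

lemma \<Delta>_mono: "A \<subseteq> B \<Longrightarrow> \<Delta> A \<subseteq> \<Delta> B"
  by (auto simp: \<Delta>_def)

lemma \<Delta>_insert: "e \<in> E \<Longrightarrow> \<Delta> (insert e A) = \<Delta> A \<union> path_image (\<gamma> e)"
  by (auto simp: \<Delta>_def)

lemma \<Delta>_insert_oe: "e \<in> E \<Longrightarrow> \<Delta> (insert e A) = \<Delta> A \<union> oe e"
  using edge_sub[of e] by (auto simp: \<Delta>_def oe_def)

lemma \<Delta>_oe: "A \<subseteq> E \<Longrightarrow> \<Delta> A = p ` V \<union> (\<Union>e\<in>A. oe e)"
proof -
  assume A: "A \<subseteq> E"
  have "path_image (\<gamma> e) \<subseteq> p ` V \<union> (\<Union>e\<in>A. oe e)" if e: "e \<in> A" for e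
  proof
    fix x assume "x \<in> path_image (\<gamma> e)"
    then consider "x \<in> oe e" | "x \<in> p ` e" by (auto simp: oe_def)
    then show "x \<in> p ` V \<union> (\<Union>e\<in>A. oe e)"
      using e edge_sub[of e] A by cases auto
  qed
  then show ?thesis by (auto simp: \<Delta>_def oe_def)
qed

lemma compact_\<Delta>:
  assumes "A \<subseteq> E" shows "compact (\<Delta> A)"
  unfolding \<Delta>_def
proof (intro compact_Un compact_UN)
  show "compact (p ` V)" using finV by (simp add: finite_imp_compact)
  show "finite A" using assms finE finite_subset by blast
  show "compact (path_image (\<gamma> e))" if "e \<in> A" for e
    using that assms arc_edge by (intro compact_arc_image) blast
qed

lemma closed_\<Delta>: "A \<subseteq> E \<Longrightarrow> closed (\<Delta> A)"
  by (simp add: compact_\<Delta> compact_imp_closed)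

lemma oe_image:
  assumes "e \<in> E" shows "oe e = \<gamma> e ` {0<..<1}"
proof -
  have inj: "inj_on (\<gamma> e) {0..1}" using arc_edge[OF assms] by (simp add: arc_def)
  have "p ` e = {\<gamma> e 0, \<gamma> e 1}" using ends[OF assms] by (simp add: pathstart_def pathfinish_def)
  moreover have "{0..1::real} = insert 0 (insert 1 {0<..<1})" by auto
  ultimately show ?thesis
    using inj unfolding oe_def path_image_def by (auto simp: inj_on_def)
qed

lemma oe_connected: "e \<in> E \<Longrightarrow> connected (oe e)"
  and oe_nonempty: "e \<in> E \<Longrightarrow> oe e \<noteq> {}"
proof -
  assume e: "e \<in> E"
  have "continuous_on {0<..<1} (\<gamma> e)"
    using arc_edge[OF e] by (auto simp: arc_def path_def intro: continuous_on_subset)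
  then show "connected (oe e)" by (simp add: e oe_image connected_continuous_image)
  show "oe e \<noteq> {}" by (simp add: e oe_image)
qed

lemma path_image_sub_closure_oe:
  assumes "e \<in> E" shows "path_image (\<gamma> e) \<subseteq> closure (oe e)"
proof -
  have c: "continuous_on (closure {0<..<1}) (\<gamma> e)"
    using arc_edge[OF assms] by (auto simp: arc_def path_def)
  have "\<gamma> e ` closure {0<..<1} \<subseteq> closure (\<gamma> e ` {0<..<1})"
    by (rule image_closure_subset[OF c]) (auto intro: closure_subset[THEN subsetD])
  then show ?thesis by (simp add: oe_image[OF assms] path_image_def)
qed

lemma oe_insert_connected:
  assumes "e \<in> E" "b \<in> e" shows "connected (insert (p b) (oe e))"
  by (rule connected_intermediate_closure[OF oe_connected[OF assms(1)]])
     (use path_image_sub_closure_oe[OF assms(1)] ends_sub[OF assms(1)] assms(2) closure_subset in auto)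

subsection \<open>Reachability\<close>

definition reach :: "'a set set \<Rightarrow> 'a \<Rightarrow> 'a \<Rightarrow> bool" where
  "reach A = (\<lambda>x y. {x, y} \<in> A)\<^sup>*\<^sup>*"

lemma reach_refl [simp]: "reach A x x" by (simp add: reach_def)

lemma reach_sym: "reach A x y \<Longrightarrow> reach A y x"
  unfolding reach_def
proof (induction rule: rtranclp_induct)
  case (step y z)
  then have "{z, y} \<in> A" by (simp add: insert_commute)
  then show ?case using step.IH by (rule converse_rtranclp_into_rtranclp)
qed simp

lemma reach_trans: "reach A x y \<Longrightarrow> reach A y z \<Longrightarrow> reach A x z"
  unfolding reach_def by simp

lemma reach_edge: "{x, y} \<in> A \<Longrightarrow> reach A x y"
  unfolding reach_def by (rule r_into_rtranclp)

lemma reach_mono: "A \<subseteq> B \<Longrightarrow> reach A x y \<Longrightarrow> reach B x y"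
  unfolding reach_def by (rule rtranclp_mono[THEN predicate2D]) auto

lemma reach_path_component:
  assumes "A \<subseteq> E" "reach A x y" "x \<in> V"
  shows "path_component (\<Delta> A) (p x) (p y)"
  using assms(2) unfolding reach_def
proof (induction rule: rtranclp_induct)
  case base
  show ?case using assms by (auto simp: path_component_refl \<Delta>_def)
next
  case (step y z)
  have e: "{y, z} \<in> E" using step assms by auto
  have "path_connected (path_image (\<gamma> {y, z}))"
    using arc_edge[OF e] by (simp add: arc_imp_path path_connected_path_image)
  moreover have "p y \<in> path_image (\<gamma> {y, z})" "p z \<in> path_image (\<gamma> {y, z})"
    using ends_sub[OF e] by auto
  ultimately have "path_component (path_image (\<gamma> {y, z})) (p y) (p z)"
    by (simp add: path_connected_component)
  moreover have "path_image (\<gamma> {y, z}) \<subseteq> \<Delta> A" using step by (auto simp: \<Delta>_def)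
  ultimately have "path_component (\<Delta> A) (p y) (p z)" using path_component_of_subset by blast
  then show ?case using step path_component_trans by blast
qed

end

section \<open>Faces of a drawing and the insertion of one edge\<close>

context plane_graph begin

definition faces :: "'a set set \<Rightarrow> complex set set" where
  "faces A = components (- \<Delta> A)"

lemma
  assumes "A \<subseteq> E" "F \<in> faces A"
  shows face_open: "open F" and face_connected: "connected F" and face_nonempty: "F \<noteq> {}"
    and face_disjoint: "F \<inter> \<Delta> A = {}" and face_frontier: "frontier F \<subseteq> \<Delta> A"
proof -
  have c: "closed (\<Delta> A)" by (rule closed_\<Delta>[OF assms(1)])
  then show "open F" using assms(2) unfolding faces_def by (meson open_Compl open_components)
  show "connected F" "F \<noteq> {}"
    using assms(2) in_components_connected in_components_nonempty unfolding faces_def by blast+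
  show "F \<inter> \<Delta> A = {}" using assms(2) in_components_subset unfolding faces_def by blast
  show "frontier F \<subseteq> \<Delta> A"
    using assms(2) c frontier_of_components_closed_complement unfolding faces_def by blast
qed

lemma faceI:
  assumes "open F" "connected F" "F \<noteq> {}" "F \<inter> \<Delta> A = {}" "frontier F \<subseteq> \<Delta> A"
  shows "F \<in> faces A"
  unfolding faces_def by (rule open_connected_in_components[OF assms])

lemma face_cover: "x \<notin> \<Delta> A \<Longrightarrow> \<exists>F\<in>faces A. x \<in> F"
  unfolding faces_def using Union_components[of "- \<Delta> A"] by blast

lemma face_eq: "F \<in> faces A \<Longrightarrow> F' \<in> faces A \<Longrightarrow> F \<inter> F' \<noteq> {} \<Longrightarrow> F = F'"
  unfolding faces_def using components_nonoverlap by blast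

lemma face_absorb:
  "F \<in> faces A \<Longrightarrow> connected T \<Longrightarrow> T \<inter> \<Delta> A = {} \<Longrightarrow> T \<inter> F \<noteq> {} \<Longrightarrow> T \<subseteq> F"
  unfolding faces_def using components_maximal[of F "- \<Delta> A" T] by blast

lemma edge_face:
  assumes "e \<in> E" "A \<subseteq> E" "e \<notin> A"
  obtains U where "U \<in> faces A" "oe e \<subseteq> U"
proof -
  obtain z where z: "z \<in> oe e" using oe_nonempty[OF assms(1)] by blast
  then have "z \<notin> \<Delta> A" using oe_\<Delta>[OF assms] by blast
  then obtain U where U: "U \<in> faces A" "z \<in> U" using face_cover by blast
  have "oe e \<subseteq> U"
    using face_absorb[OF U(1) oe_connected[OF assms(1)] oe_\<Delta>[OF assms]] z U by blast
  then show ?thesis using U that by blast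
qed

text \<open>The open arc of \<open>e\<close> lies in the single face \<open>U\<close>, so every
  other face stays untouched and whatever is new lies inside \<open>U\<close>.\<close>

lemma faces_insert_cases:
  assumes "e \<in> E" "A \<subseteq> E" "e \<notin> A" "U \<in> faces A" "oe e \<subseteq> U" "F \<in> faces (insert e A)"
  shows "F \<subseteq> U \<or> F \<in> faces A - {U}"
proof -
  have A': "insert e A \<subseteq> E" using assms by simp
  note F = face_open[OF A' assms(6)] face_connected[OF A' assms(6)] face_nonempty[OF A' assms(6)]
    face_disjoint[OF A' assms(6)]
  obtain x where x: "x \<in> F" using F by blast
  then have "x \<notin> \<Delta> A" using F \<Delta>_mono[of A "insert e A"] by blast
  then obtain C where C: "C \<in> faces A" "x \<in> C" using face_cover by blast
  have FC: "F \<subseteq> C"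
    using face_absorb[OF C(1) F(2)] F(4) \<Delta>_mono[of A "insert e A"] x C by blast
  show ?thesis
  proof (cases "C = U")
    case True then show ?thesis using FC by simp
  next
    case False
    then have "C \<inter> oe e = {}" using face_eq[OF C(1) assms(4)] assms(5) by blast
    then have "C \<inter> \<Delta> (insert e A) = {}"
      using face_disjoint[OF assms(2) C(1)] \<Delta>_insert_oe[OF assms(1)] by auto
    then have "C \<subseteq> F"
      using face_absorb[OF assms(6) face_connected[OF assms(2) C(1)]] x C by blast
    then show ?thesis using FC C False by auto
  qed
qed

lemma faces_insert:
  assumes "e \<in> E" "A \<subseteq> E" "e \<notin> A" "U \<in> faces A" "oe e \<subseteq> U"
  shows "faces (insert e A) = (faces A - {U}) \<union> {F \<in> faces (insert e A). F \<subseteq> U}"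
proof -
  have "C \<in> faces (insert e A)" if C: "C \<in> faces A" "C \<noteq> U" for C
  proof (rule faceI)
    have "C \<inter> oe e = {}" using face_eq[OF C(1) assms(4)] assms(5) C by blast
    then show "C \<inter> \<Delta> (insert e A) = {}"
      using face_disjoint[OF assms(2) C(1)] \<Delta>_insert_oe[OF assms(1)] by auto
    show "frontier C \<subseteq> \<Delta> (insert e A)"
      using face_frontier[OF assms(2) C(1)] \<Delta>_mono[of A "insert e A"] by blast
  qed (use face_open[OF assms(2) C(1)] face_connected[OF assms(2) C(1)] face_nonempty[OF assms(2) C(1)] in auto)
  then show ?thesis using faces_insert_cases[OF assms] by blast
qed

lemma region_split:
  assumes "e \<in> E" "A \<subseteq> E" "e \<notin> A" "U \<in> faces A" "oe e \<subseteq> U" "x \<in> U" "x \<notin> oe e"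
  obtains F where "F \<in> faces (insert e A)" "F \<subseteq> U" "x \<in> F"
proof -
  have "x \<notin> \<Delta> (insert e A)"
    using face_disjoint[OF assms(2,4)] assms(6,7) \<Delta>_insert_oe[OF assms(1)] by auto
  then obtain F where F: "F \<in> faces (insert e A)" "x \<in> F" using face_cover by blast
  then have "F \<subseteq> U"
    using faces_insert_cases[OF assms(1-5) F(1)] face_eq[OF _ assms(4)] assms(6) by blast
  then show ?thesis using F that by blast
qed

text \<open>An arc has empty interior and cannot exhaust the open set \<open>U\<close>.\<close>

lemma face_nonempty_split:
  assumes "e \<in> E" "A \<subseteq> E" "e \<notin> A" "U \<in> faces A" "oe e \<subseteq> U"
  shows "{F \<in> faces (insert e A). F \<subseteq> U} \<noteq> {}"
proof -
  have "\<not> U \<subseteq> path_image (\<gamma> e)"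
    using arc_image_empty_interior[OF arc_edge[OF assms(1)]] interior_maximal[of U]
      face_open[OF assms(2,4)] face_nonempty[OF assms(2,4)] by blast
  then obtain x where "x \<in> U" "x \<notin> oe e" by (auto simp: oe_def)
  then show ?thesis using region_split[OF assms] by blast
qed

lemma face_connected_component:
  assumes "F \<in> faces A" "x \<in> F" "y \<in> F" shows "connected_component (- \<Delta> A) x y"
  using assms unfolding faces_def
  by (meson componentsE connected_component_in in_components_subset same_component_iff subsetD)

lemma face_connected_component_eq:
  assumes "connected_component (- \<Delta> A) x y" "F \<in> faces A" "F' \<in> faces A" "x \<in> F" "y \<in> F'"
  shows "F = F'"
proof -
  have "x \<in> - \<Delta> A" using assms unfolding faces_def using in_components_subset by blast
  then obtain C where "C \<in> faces A" "x \<in> C" "y \<in> C"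
    using assms(1) same_component_iff unfolding faces_def by blast
  then show ?thesis using face_eq assms by blast
qed

lemma edge_Int_closed:
  assumes "e \<in> E" "A \<subseteq> E" "e \<notin> A" "S \<subseteq> \<Delta> A" "p ` e \<subseteq> S"
  shows "S \<inter> path_image (\<gamma> e) = p ` e"
  using edge_\<Delta>[OF assms(1-3)] assms(4,5) by blast

text \<open>The arc of \<open>e\<close> and an arc \<open>q\<close> in \<open>\<Delta> A\<close>
  joining its ends form a Jordan curve \<open>J\<close>; \<open>I\<close> and \<open>X\<close> are
  its inside and outside. Both accumulate at \<open>e\<close>, since \<open>J\<close> is the
  frontier of each. Within one side, the insertion of \<open>e\<close> separates nothing that was
  connected before.\<close>

lemma connected_edge_separation:
  assumes e: "e \<in> E" "A \<subseteq> E" "e \<notin> A" "e = {u, v}" "u \<noteq> v" and r: "reach A u v"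
  obtains I X where "open I" "open X" "I \<inter> X = {}" "I \<union> X \<union> \<Delta> A \<union> oe e = UNIV"
    "I \<inter> oe e = {}" "X \<inter> oe e = {}" "oe e \<subseteq> closure I" "oe e \<subseteq> closure X"
    "\<And>x y. x \<in> I \<Longrightarrow> y \<in> I \<Longrightarrow> connected_component (- \<Delta> A) x y \<Longrightarrow> connected_component (- \<Delta> (insert e A)) x y"
    "\<And>x y. x \<in> X \<Longrightarrow> y \<in> X \<Longrightarrow> connected_component (- \<Delta> A) x y \<Longrightarrow> connected_component (- \<Delta> (insert e A)) x y"
proof -
  have uv: "u \<in> V" "v \<in> V" using edge_sub[OF e(1)] e(4) by auto
  then have ne: "p u \<noteq> p v" using injp e(5) by (auto simp: inj_on_def)
  \<comment> \<open>A drawing fixes only the set of ends of an arc, so the arc is reversed if it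
    starts at \<open>p v\<close>.\<close>
  define g where "g = (if pathstart (\<gamma> e) = p u then \<gamma> e else reversepath (\<gamma> e))"
  have "{pathstart (\<gamma> e), pathfinish (\<gamma> e)} = {p u, p v}" using ends[OF e(1)] e(4) by simp
  then have g: "arc g" "pathstart g = p u" "pathfinish g = p v" "path_image g = path_image (\<gamma> e)"
    using arc_edge[OF e(1)] ne by (auto simp: g_def arc_reversepath doubleton_eq_iff)
  obtain h where h: "path h" "path_image h \<subseteq> \<Delta> A" "pathstart h = p v" "pathfinish h = p u"
    using reach_path_component[OF e(2) reach_sym[OF r] uv(2)] unfolding path_component_def by blast
  obtain q where q: "arc q" "path_image q \<subseteq> path_image h" "pathstart q = p v" "pathfinish q = p u"
    using path_contains_arc[OF h(1,3,4)] ne by metis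
  have qD: "path_image q \<subseteq> \<Delta> A" using q h by blast
  have pe: "p ` e = {p u, p v}" using e(4) by simp
  have qe: "path_image q \<inter> path_image (\<gamma> e) = p ` e"
  proof (rule edge_Int_closed[OF e(1-3) qD])
    show "p ` e \<subseteq> path_image q"
      using pathstart_in_path_image[of q] pathfinish_in_path_image[of q] q pe by auto
  qed
  define c where "c = g +++ q"
  have c: "simple_path c" "pathfinish c = pathstart c"
    unfolding c_def using g q qe pe by (auto intro!: simple_path_join_loop)
  define J where "J = path_image c"
  have J: "J = path_image (\<gamma> e) \<union> path_image q"
    unfolding J_def c_def using g q by (simp add: path_image_join)
  note jo = Jordan_inside_outside[OF c, folded J_def]
  have DJ: "\<Delta> A \<union> J = \<Delta> (insert e A)" using J qD \<Delta>_insert[OF e(1)] by auto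
  have DJi: "\<Delta> A \<inter> J = path_image q"
    using J qD edge_\<Delta>[OF e(1-3)] qe by blast
  \<comment> \<open>This is the hypothesis of Janiszewski's theorem: two points separated neither by
    \<open>\<Delta> A\<close> nor by \<open>J\<close> are then not separated by the union.\<close>
  have cj: "connected (\<Delta> A \<inter> J)" using q DJi by (simp add: connected_arc_image)
  have side: "connected_component (- \<Delta> (insert e A)) x y"
    if "connected T" "T \<inter> J = {}" "x \<in> T" "y \<in> T" "connected_component (- \<Delta> A) x y" for T x y
  proof -
    have "connected_component (- J) x y"
      using that unfolding connected_component_def by blast
    moreover have "closed J" unfolding J_def using c(1) closed_simple_path_image by blast
    ultimately show ?thesis
      using Janiszewski[OF compact_\<Delta>[OF e(2)] _ cj that(5)] DJ by auto
  qed
  have oeJ: "oe e \<subseteq> J" using J by (auto simp: oe_def)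
  show ?thesis
  proof (rule that[of "inside J" "outside J"])
    show "inside J \<union> outside J \<union> \<Delta> A \<union> oe e = UNIV"
    proof -
      have "J \<subseteq> \<Delta> A \<union> oe e" using J qD edge_\<Delta>[OF e(1-3)] by (auto simp: oe_def)
      then show ?thesis using jo by blast
    qed
    show "oe e \<subseteq> closure (inside J)" "oe e \<subseteq> closure (outside J)"
      using jo oeJ by (auto simp: frontier_def)
    show "inside J \<inter> oe e = {}" "outside J \<inter> oe e = {}" using jo oeJ by blast+
    show "connected_component (- \<Delta> (insert e A)) x y"
      if "x \<in> inside J" "y \<in> inside J" "connected_component (- \<Delta> A) x y" for x y
      using that jo by (intro side[of "inside J"]) auto
    show "connected_component (- \<Delta> (insert e A)) x y"
      if "x \<in> outside J" "y \<in> outside J" "connected_component (- \<Delta> A) x y" for x y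
      using that jo by (intro side[of "outside J"]) auto
  qed (use jo in auto)
qed

end

section \<open>Counting faces\<close>

context plane_graph begin

text \<open>Both sides of the Jordan curve accumulate at \<open>e\<close> and hence meet the open
  set \<open>U\<close>. A face cannot lie on both sides, and all points of \<open>U\<close> that are
  on one side and off the drawing end up in the same face.\<close>

lemma faces_insert_reach:
  assumes e: "e \<in> E" "A \<subseteq> E" "e \<notin> A" "e = {u, v}" "u \<noteq> v" and r: "reach A u v"
    and U: "U \<in> faces A" "oe e \<subseteq> U"
  shows "card {F \<in> faces (insert e A). F \<subseteq> U} = 2"
proof -
  have eA: "insert e A \<subseteq> E" using e by auto
  obtain I X where IX: "open I" "open X" "I \<inter> X = {}" "I \<union> X \<union> \<Delta> A \<union> oe e = UNIV"
    "I \<inter> oe e = {}" "X \<inter> oe e = {}" "oe e \<subseteq> closure I" "oe e \<subseteq> closure X"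
    and cI: "\<And>x y. x \<in> I \<Longrightarrow> y \<in> I \<Longrightarrow> connected_component (- \<Delta> A) x y \<Longrightarrow> connected_component (- \<Delta> (insert e A)) x y"
    and cX: "\<And>x y. x \<in> X \<Longrightarrow> y \<in> X \<Longrightarrow> connected_component (- \<Delta> A) x y \<Longrightarrow> connected_component (- \<Delta> (insert e A)) x y"
    using connected_edge_separation[OF e r] by blast
  have oU: "open U" by (rule face_open[OF e(2) U(1)])
  obtain z where z: "z \<in> oe e" using oe_nonempty[OF e(1)] by blast
  have "z \<in> U \<inter> closure I" "z \<in> U \<inter> closure X" using z U(2) IX(7,8) by auto
  then have "U \<inter> I \<noteq> {}" "U \<inter> X \<noteq> {}"
    using open_Int_closure_eq_empty[OF oU, of I] open_Int_closure_eq_empty[OF oU, of X] by auto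
  then obtain a b where ab: "a \<in> U" "a \<in> I" "b \<in> U" "b \<in> X" by blast
  obtain Fa where Fa: "Fa \<in> faces (insert e A)" "Fa \<subseteq> U" "a \<in> Fa"
    using region_split[OF e(1-3) U, of a] ab IX by blast
  obtain Fb where Fb: "Fb \<in> faces (insert e A)" "Fb \<subseteq> U" "b \<in> Fb"
    using region_split[OF e(1-3) U, of b] ab IX by blast
  have cov: "F \<subseteq> I \<union> X" if "F \<in> faces (insert e A)" for F
    using face_disjoint[OF eA that] IX(4) \<Delta>_insert_oe[OF e(1)] by auto
  have "Fa \<noteq> Fb"
  proof
    assume "Fa = Fb"
    then have "I \<inter> Fa = {} \<or> X \<inter> Fa = {}"
      using connectedD[OF face_connected[OF eA Fa(1)] IX(1,2)] IX(3) cov[OF Fa(1)] by blast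
    then show False using ab Fa Fb \<open>Fa = Fb\<close> by blast
  qed
  moreover have "{F \<in> faces (insert e A). F \<subseteq> U} = {Fa, Fb}"
  proof (intro equalityI subsetI)
    fix F assume "F \<in> {F \<in> faces (insert e A). F \<subseteq> U}"
    then have F: "F \<in> faces (insert e A)" "F \<subseteq> U" by auto
    obtain z where z: "z \<in> F" using face_nonempty[OF eA F(1)] by blast
    then consider "z \<in> I" | "z \<in> X" using cov[OF F(1)] by blast
    then show "F \<in> {Fa, Fb}"
    proof cases
      case 1
      have "connected_component (- \<Delta> A) z a"
        using face_connected_component[OF U(1)] z F ab by blast
      from face_connected_component_eq[OF cI[OF 1 ab(2) this] F(1) Fa(1) z Fa(3)] show ?thesis by simp
    next
      case 2
      have "connected_component (- \<Delta> A) z b"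
        using face_connected_component[OF U(1)] z F ab by blast
      from face_connected_component_eq[OF cX[OF 2 ab(4) this] F(1) Fb(1) z Fb(3)] show ?thesis by simp
    qed
  qed (use Fa Fb in auto)
  ultimately show ?thesis by simp
qed

text \<open>Let \<open>R\<close> be the class of \<open>u\<close>. The drawing falls into two
  disjoint compact pieces, \<open>K R\<close> and \<open>K (V - R)\<close>, and \<open>e\<close>
  meets each of them in one point. Janiszewski's theorem applies to \<open>K R\<close> and the arc,
  and then to their union and \<open>K (V - R)\<close>; both intersections are single points, and an
  arc alone does not separate the plane. So \<open>U\<close> is not split.\<close>

lemma faces_insert_unreach:
  assumes e: "e \<in> E" "A \<subseteq> E" "e \<notin> A" "e = {u, v}" "u \<noteq> v" and r: "\<not> reach A u v"
    and U: "U \<in> faces A" "oe e \<subseteq> U"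
  shows "card {F \<in> faces (insert e A). F \<subseteq> U} = 1"
proof -
  have eA: "insert e A \<subseteq> E" using e by auto
  have uv: "u \<in> V" "v \<in> V" using edge_sub[OF e(1)] e(4) by auto
  define R where "R = {w \<in> V. reach A u w}"
  define K where "K S = p ` S \<union> (\<Union>a\<in>{a\<in>A. a \<subseteq> S}. path_image (\<gamma> a))" for S
  have cK: "compact (K S)" if "S \<subseteq> V" for S
    unfolding K_def
  proof (intro compact_Un compact_UN)
    show "compact (p ` S)" using finV that by (simp add: finite_imp_compact finite_subset)
    show "finite {a \<in> A. a \<subseteq> S}" using e(2) finE by (auto intro: finite_subset)
    show "compact (path_image (\<gamma> a))" if "a \<in> {a \<in> A. a \<subseteq> S}" for a
      using that e(2) arc_edge by (intro compact_arc_image) blast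
  qed
  have edge_side: "a \<subseteq> R \<or> a \<subseteq> V - R" if "a \<in> A" for a
  proof -
    have aE: "a \<in> E" using that e(2) by blast
    obtain x y where a: "a = {x, y}" "x \<in> V" "y \<in> V" by (metis edgeE[OF aE])
    have "reach A x y" "reach A y x" using that a by (auto intro: reach_edge reach_sym)
    then have "reach A u x \<longleftrightarrow> reach A u y" using reach_trans by blast
    then show ?thesis using a by (auto simp: R_def)
  qed
  have RV: "R \<subseteq> V" by (auto simp: R_def)
  have KU: "K R \<union> K (V - R) = \<Delta> A"
  proof -
    have "A = {a \<in> A. a \<subseteq> R} \<union> {a \<in> A. a \<subseteq> V - R}" using edge_side by blast
    then have "(\<Union>a\<in>A. path_image (\<gamma> a)) =
        (\<Union>a\<in>{a \<in> A. a \<subseteq> R}. path_image (\<gamma> a)) \<union> (\<Union>a\<in>{a \<in> A. a \<subseteq> V - R}. path_image (\<gamma> a))"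
      by (metis UN_Un)
    moreover have "p ` V = p ` R \<union> p ` (V - R)" using RV by blast
    ultimately show ?thesis unfolding K_def \<Delta>_def by auto
  qed
  have KI: "K R \<inter> K (V - R) = {}"
  proof -
    have 1: "p ` R \<inter> p ` (V - R) = {}" using injp RV by (auto simp: inj_on_def)
    have 2: "p ` S \<inter> path_image (\<gamma> a) = {}" if "a \<in> A" "a \<subseteq> V - S" "S \<subseteq> V" for a S
    proof -
      have "p ` S \<inter> path_image (\<gamma> a) \<subseteq> p ` a" using edge_verts[of a] that e(2) by blast
      moreover have "p ` S \<inter> p ` a = {}" using injp that by (auto simp: inj_on_def)
      ultimately show ?thesis by blast
    qed
    have 3: "path_image (\<gamma> a) \<inter> path_image (\<gamma> b) = {}"
      if "a \<in> A" "b \<in> A" "a \<subseteq> R" "b \<subseteq> V - R" for a b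
    proof -
      have "a \<noteq> {}" using that e(2) edge_card[of a] by auto
      then have ab: "a \<noteq> b" "a \<inter> b = {}" using that by blast+
      then show ?thesis using edge_edge[of a b] that e(2) by auto
    qed
    have "V - (V - R) = R" using RV by blast
    then have 4: "p ` (V - R) \<inter> path_image (\<gamma> a) = {}" if "a \<in> A" "a \<subseteq> R" for a
      using 2[of a "V - R"] that by simp
    show ?thesis
    proof (rule equals0I)
      fix z assume z: "z \<in> K R \<inter> K (V - R)"
      then consider "z \<in> p ` R" | a where "a \<in> A" "a \<subseteq> R" "z \<in> path_image (\<gamma> a)"
        unfolding K_def by auto
      then show False
      proof cases
        case 1
        then show ?thesis using z \<open>p ` R \<inter> p ` (V - R) = {}\<close> 2[OF _ _ RV] unfolding K_def by blast
      next
        case a: 2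
        then show ?thesis using z 4[OF a(1,2)] 3[OF a(1) _ a(2)] unfolding K_def by blast
      qed
    qed
  qed
  have ug: "u \<in> R" "v \<in> V - R" using r uv by (auto simp: R_def)
  define T where "T = path_image (\<gamma> e)"
  have cT: "compact T" unfolding T_def using arc_edge[OF e(1)] by (rule compact_arc_image)
  have TD: "T \<inter> \<Delta> A = {p u, p v}" using edge_\<Delta>[OF e(1-3)] e(4) by (simp add: T_def)
  have pu: "p u \<in> K R" "p v \<in> K (V - R)" using ug by (auto simp: K_def)
  have "K R \<inter> T = K R \<inter> (T \<inter> \<Delta> A)" "K (V - R) \<inter> T = K (V - R) \<inter> (T \<inter> \<Delta> A)"
    using KU by blast+
  then have "K R \<inter> T = K R \<inter> {p u, p v}" "K (V - R) \<inter> T = K (V - R) \<inter> {p u, p v}"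
    unfolding TD by simp_all
  moreover have "p v \<notin> K R" "p u \<notin> K (V - R)" using KI pu by blast+
  ultimately have i1: "K R \<inter> T = {p u}" and "K (V - R) \<inter> T = {p v}" using pu by auto
  then have i2: "(K R \<union> T) \<inter> K (V - R) = {p v}" using KI by auto
  have same: "F = F'" if F: "F \<in> faces (insert e A)" "F \<subseteq> U" "F' \<in> faces (insert e A)" "F' \<subseteq> U" for F F'
  proof -
    obtain z z' where z: "z \<in> F" "z' \<in> F'"
      using face_nonempty[OF eA F(1)] face_nonempty[OF eA F(3)] by blast
    have c: "connected_component (- \<Delta> A) z z'"
      using face_connected_component[OF U(1)] z F by blast
    have "connected_component (- K R) z z'" "connected_component (- K (V - R)) z z'"
      using connected_component_of_subset[OF c] KU by blast+
    moreover have "connected_component (- T) z z'"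
    proof -
      have "connected (- T)" unfolding T_def
        using connected_arc_complement[OF arc_edge[OF e(1)]] by simp
      moreover have "z \<notin> T" "z' \<notin> T"
        using z face_disjoint[OF eA F(1)] face_disjoint[OF eA F(3)] \<Delta>_insert[OF e(1)]
        by (auto simp: T_def)
      ultimately show ?thesis unfolding connected_component_def by blast
    qed
    ultimately have "connected_component (- (K R \<union> T)) z z'"
      using Janiszewski[OF cK[OF RV] compact_imp_closed[OF cT]] i1 by auto
    then have "connected_component (- ((K R \<union> T) \<union> K (V - R))) z z'"
      using Janiszewski[of "K R \<union> T" "K (V - R)"] i2 \<open>connected_component (- K (V - R)) z z'\<close>
        cK[OF RV] cK[of "V - R"] cT by (auto simp: compact_imp_closed compact_Un)
    moreover have "(K R \<union> T) \<union> K (V - R) = \<Delta> (insert e A)"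
      using KU \<Delta>_insert[OF e(1)] by (auto simp: T_def)
    ultimately show ?thesis using face_connected_component_eq[OF _ F(1,3) z] by simp
  qed
  obtain F where F: "F \<in> faces (insert e A)" "F \<subseteq> U"
    using face_nonempty_split[OF e(1-3) U] by blast
  have "{F \<in> faces (insert e A). F \<subseteq> U} = {F}" using same F by blast
  then show ?thesis by simp
qed

lemma card_faces_insert:
  assumes e: "e \<in> E" "A \<subseteq> E" "e \<notin> A" "e = {u, v}" "u \<noteq> v" and fin: "finite (faces A)"
  shows "finite (faces (insert e A))"
    and "card (faces (insert e A)) = card (faces A) + (if reach A u v then 1 else 0)"
proof -
  obtain U where U: "U \<in> faces A" "oe e \<subseteq> U" using edge_face[OF e(1-3)] by blast
  let ?Q = "{F \<in> faces (insert e A). F \<subseteq> U}"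
  have Q: "card ?Q = (if reach A u v then 2 else 1)"
    using faces_insert_reach[OF e(1-5) _ U] faces_insert_unreach[OF e(1-5) _ U] by auto
  then have fQ: "finite ?Q" by (intro card_ge_0_finite) simp
  have eq: "faces (insert e A) = (faces A - {U}) \<union> ?Q" by (rule faces_insert[OF e(1-3) U])
  show "finite (faces (insert e A))" by (subst eq) (simp add: fin fQ)
  have "(faces A - {U}) \<inter> ?Q = {}"
  proof -
    have "F = U" if "F \<in> faces A" "F \<subseteq> U" for F
      using that face_eq[OF that(1) U(1)] face_nonempty[OF e(2) that(1)] by blast
    then show ?thesis by blast
  qed
  then have "card (faces (insert e A)) = card (faces A - {U}) + card ?Q"
    by (subst eq) (use fin fQ in \<open>simp add: card_Un_disjoint\<close>)
  moreover have "card (faces A) > 0" using U fin card_gt_0_iff by blast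
  ultimately show "card (faces (insert e A)) = card (faces A) + (if reach A u v then 1 else 0)"
    using Q U fin by (auto simp: card_Diff_singleton)
qed

lemma faces_empty: "faces {} = {- p ` V}"
proof -
  have "connected (UNIV - p ` V :: complex set)"
    by (rule connected_open_delete_finite) (use finV in auto)
  then have c: "connected (- p ` V :: complex set)" by (simp add: Compl_eq_Diff_UNIV)
  have "- p ` V \<noteq> {}"
    using finV infinite_UNIV_char_0[where 'a = complex] by (metis Compl_empty_eq double_complement finite_imageI)
  then show ?thesis using c by (simp add: faces_def \<Delta>_def components_eq_sing_iff)
qed

lemma finite_faces: "A \<subseteq> E \<Longrightarrow> finite (faces A)"
proof -
  assume "A \<subseteq> E"
  with finite_subset[OF this finE] show ?thesis
  proof (induction A rule: finite_induct)
    case empty then show ?case by (simp add: faces_empty)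
  next
    case (insert e A)
    then obtain u v where "e = {u, v}" "u \<noteq> v" by (metis edgeE insert_subset)
    then show ?case using insert card_faces_insert(1)[of e A u v] by auto
  qed
qed

section \<open>Reachability classes and Euler's inequality\<close>

definition cls :: "'a set set \<Rightarrow> 'a \<Rightarrow> 'a set" where "cls A x = {y \<in> V. reach A x y}"

lemma cls_insert:
  assumes "x \<in> V"
  shows "cls (insert e A) x = {y \<in> V. \<exists>z\<in>cls A x. reach (insert e A) z y}"
proof (intro equalityI subsetI)
  fix y assume "y \<in> cls (insert e A) x"
  moreover have "x \<in> cls A x" using assms by (simp add: cls_def)
  ultimately show "y \<in> {y \<in> V. \<exists>z\<in>cls A x. reach (insert e A) z y}" by (auto simp: cls_def)
next
  fix y assume "y \<in> {y \<in> V. \<exists>z\<in>cls A x. reach (insert e A) z y}"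
  then obtain z where z: "y \<in> V" "reach A x z" "reach (insert e A) z y" by (auto simp: cls_def)
  have "reach (insert e A) x z" using reach_mono[OF _ z(2)] by blast
  from reach_trans[OF this z(3)] show "y \<in> cls (insert e A) x" using z(1) by (simp add: cls_def)
qed

lemma cls_insert_image:
  "cls (insert e A) ` V = (\<lambda>C. {y \<in> V. \<exists>x\<in>C. reach (insert e A) x y}) ` cls A ` V"
  unfolding image_image by (rule image_cong[OF refl cls_insert])

lemma cls_eq: "reach A x y \<Longrightarrow> cls A x = cls A y"
  unfolding cls_def by (auto intro: reach_trans dest: reach_sym)

text \<open>The classes after the insertion are the images of the old classes under one map, so
  their number cannot grow. If \<open>e\<close> joins two classes, these have the same image and the
  map is not injective.\<close>

lemma card_cls_insert:
  assumes e: "e \<in> E" "A \<subseteq> E" "e \<notin> A" "e = {u, v}" "u \<noteq> v"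
  shows "card (cls (insert e A) ` V) + (if reach A u v then 0 else 1) \<le> card (cls A ` V)"
proof -
  let ?f = "\<lambda>C. {y \<in> V. \<exists>x\<in>C. reach (insert e A) x y}"
  have fin: "finite (cls A ` V)" using finV by simp
  have le: "card (cls (insert e A) ` V) \<le> card (cls A ` V)"
    unfolding cls_insert_image by (rule card_image_le[OF fin])
  show ?thesis
  proof (cases "reach A u v")
    case False
    have uv: "u \<in> V" "v \<in> V" using edge_sub[OF e(1)] e(4) by auto
    have "card (cls (insert e A) ` V) \<noteq> card (cls A ` V)"
    proof
      assume "card (cls (insert e A) ` V) = card (cls A ` V)"
      then have "inj_on ?f (cls A ` V)"
        unfolding cls_insert_image using eq_card_imp_inj_on[OF fin] by auto
      moreover have "?f (cls A u) = ?f (cls A v)"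
      proof -
        have "reach (insert e A) u v" by (rule reach_edge) (use e in simp)
        then show ?thesis using cls_eq cls_insert[OF uv(1)] cls_insert[OF uv(2)] by metis
      qed
      ultimately have "cls A u = cls A v"
        by (rule inj_onD[OF _ _ imageI[OF uv(1)] imageI[OF uv(2)]])
      moreover have "v \<in> cls A v" using uv by (simp add: cls_def)
      ultimately have "v \<in> cls A u" by simp
      then show False using False by (simp add: cls_def)
    qed
    then show ?thesis using le False by simp
  qed (use le in simp)
qed

text \<open>Each inserted edge either creates a face or lowers the number of classes, which
  preserves the inequality. The second summand on the left counts connected components, isolated
  vertices included.\<close>

lemma euler_ineq:
  assumes "A \<subseteq> E"
  shows "card A + card (cls A ` V) + 1 \<le> card (faces A) + card V"
proof -
  have "finite A" using assms finE finite_subset by blast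
  then show ?thesis using assms
  proof (induction A rule: finite_induct)
    case empty
    have "card (cls {} ` V) \<le> card V" by (rule card_image_le[OF finV])
    then show ?case by (simp add: faces_empty)
  next
    case (insert e A)
    have e: "e \<in> E" "A \<subseteq> E" "e \<notin> A" using insert by auto
    obtain u v where uv: "e = {u, v}" "u \<noteq> v" by (metis edgeE[OF e(1)])
    show ?case
      using insert.IH[OF e(2)] card_cls_insert[OF e uv] card_faces_insert(2)[OF e uv finite_faces[OF e(2)]]
        insert.hyps by (auto split: if_splits)
  qed
qed

lemma card_cls_pos: "V \<noteq> {} \<Longrightarrow> card (cls A ` V) > 0"
  using finV by (simp add: card_gt_0_iff)

end

section \<open>Faces and cycles\<close>

lemma cycle_edges_image:
  "cycle_edges xs = (\<lambda>i. {xs ! i, xs ! (Suc i mod length xs)}) ` {..<length xs}"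
  unfolding cycle_edges_def by auto

lemma cycle_edges_4: "cycle_edges [a, b, c, d] = {{a, b}, {b, c}, {c, d}, {d, a}}"
proof -
  have *: "{..<Suc (Suc (Suc (Suc 0)))} = {0, 1, 2, 3}" by auto
  show ?thesis by (simp add: cycle_edges_image * insert_commute)
qed

lemma cycle_edges_3: "cycle_edges [a, b, c] = {{a, b}, {b, c}, {c, a}}"
proof -
  have *: "{..<Suc (Suc (Suc 0))} = {0, 1, 2}" by auto
  show ?thesis by (simp add: cycle_edges_image * insert_commute)
qed

lemma card_cycle_edges:
  assumes "distinct xs" "length xs \<ge> 3"
  shows "card (cycle_edges xs) = length xs"
proof -
  let ?n = "length xs"
  let ?f = "\<lambda>i. {xs ! i, xs ! (Suc i mod ?n)}"
  have sm: "Suc i mod ?n = (if Suc i = ?n then 0 else Suc i)" if "i < ?n" for i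
    using that by auto
  have "inj_on ?f {..<?n}"
  proof (rule inj_onI)
    fix i j assume ij: "i \<in> {..<?n}" "j \<in> {..<?n}" "?f i = ?f j"
    have "Suc i mod ?n < ?n" "Suc j mod ?n < ?n" using ij by (auto intro: mod_less_divisor)
    then have "i = j \<or> (i = Suc j mod ?n \<and> j = Suc i mod ?n)"
      using ij assms(1) by (auto simp: doubleton_eq_iff nth_eq_iff_index_eq)
    then show "i = j" using sm[of i] sm[of j] ij assms(2) by (auto split: if_splits)
  qed
  then show ?thesis unfolding cycle_edges_image by (simp add: card_image)
qed

lemma cycle_subset: "C \<in> cycles G k \<Longrightarrow> C \<subseteq> edges G"
  and card_cycle: "C \<in> cycles G k \<Longrightarrow> card C = k"
  and cycle_ge3: "C \<in> cycles G k \<Longrightarrow> k \<ge> 3"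
  by (auto simp: cycles_def card_cycle_edges)

text \<open>A rotation or reflection of the list brings the given edge to the front; these are the
  eight cases.\<close>

lemma cycle_4E:
  assumes "C \<in> cycles G 4" "{a, b} \<in> C"
  obtains c d where "distinct [a, b, c, d]" "C = {{a, b}, {b, c}, {c, d}, {d, a}}"
proof -
  obtain xs where xs: "C = cycle_edges xs" "length xs = 4" "distinct xs"
    using assms(1) by (auto simp: cycles_def)
  obtain x y z w where l: "xs = [x, y, z, w]"
  proof -
    have "length xs = Suc (Suc (Suc (Suc 0)))" using xs(2) by simp
    then show ?thesis using that by (auto simp only: length_Suc_conv length_0_conv)
  qed
  have C: "C = {{x, y}, {y, z}, {z, w}, {w, x}}" by (simp only: xs(1) l cycle_edges_4)
  have d: "distinct [x, y, z, w]" using xs l by simp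
  have C': "C = {{y, x}, {x, w}, {w, z}, {z, y}}" unfolding C by (auto simp: insert_commute)
  have rot: "{{x, y}, {y, z}, {z, w}, {w, x}} = {{y, z}, {z, w}, {w, x}, {x, y}}" for x y z w :: 'a
    by auto
  have "(a = x \<and> b = y) \<or> (a = y \<and> b = z) \<or> (a = z \<and> b = w) \<or> (a = w \<and> b = x) \<or>
        (a = y \<and> b = x) \<or> (a = x \<and> b = w) \<or> (a = w \<and> b = z) \<or> (a = z \<and> b = y)"
    using assms(2) unfolding C by (auto simp: doubleton_eq_iff)
  then show ?thesis
  proof (elim disjE conjE)
    assume "a = x" "b = y" then show ?thesis using that[of z w] C d by auto
  next
    assume "a = y" "b = z" then show ?thesis using that[of w x] C rot[of x y z w] d by auto
  next
    assume "a = z" "b = w"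
    then show ?thesis using that[of x y] C rot[of x y z w] rot[of y z w x] d by auto
  next
    assume "a = w" "b = x"
    then show ?thesis using that[of y z] C rot[of w x y z] d by auto
  next
    assume "a = y" "b = x" then show ?thesis using that[of w z] C' d by auto
  next
    assume "a = x" "b = w" then show ?thesis using that[of z y] C' rot[of y x w z] d by auto
  next
    assume "a = w" "b = z"
    then show ?thesis using that[of y x] C' rot[of y x w z] rot[of x w z y] d by auto
  next
    assume "a = z" "b = y"
    then show ?thesis using that[of x w] C' rot[of z y x w] d by auto
  qed
qed

lemma triangle_in_cycles:
  assumes "simple_graph G" "{x, y} \<in> edges G" "{y, z} \<in> edges G" "{z, x} \<in> edges G"
  shows "cycles G 3 \<noteq> {}"
proof -
  have "x \<noteq> y \<and> x \<in> verts G \<and> y \<in> verts G" if "{x, y} \<in> edges G" for x y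
    using that assms(1) by (auto simp: simple_graph_def)
  from this[OF assms(2)] this[OF assms(3)] this[OF assms(4)]
  have "distinct [x, y, z]" "set [x, y, z] \<subseteq> verts G" by auto
  moreover have "cycle_edges [x, y, z] \<subseteq> edges G"
    using assms by (simp add: cycle_edges_3)
  ultimately have "cycle_edges [x, y, z] \<in> cycles G 3"
    unfolding cycles_def by (intro CollectI exI[of _ "[x, y, z]"]) simp
  then show ?thesis by blast
qed

text \<open>Besides a common edge \<open>{a, b}\<close> there is a second one. Some second common
  edge meets \<open>{a, b}\<close>, since the only other coincidence, an opposite edge traversed in
  crossed order, would close a triangle. At the vertex where two common edges meet, both cycles use
  the same two edges. The cycles may coincide, which covers two faces with the same
  boundary.\<close>

lemma shared_vertex_4_cycles:
  assumes "simple_graph G" "cycles G 3 = {}" "C \<in> cycles G 4" "C' \<in> cycles G 4"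
    "\<not> normally_adjacent C C'" "C \<inter> C' \<noteq> {}"
  obtains b where "\<exists>e\<in>C \<inter> C'. b \<in> e" "\<forall>e\<in>C \<union> C'. b \<in> e \<longrightarrow> e \<in> C \<inter> C'"
    "card {e\<in>C \<union> C'. b \<in> e} \<le> 2"
proof -
  obtain e0 where e0: "e0 \<in> C" "e0 \<in> C'" using assms(6) by blast
  have CE: "C \<subseteq> edges G" "C' \<subseteq> edges G" using assms cycle_subset by blast+
  obtain a b where ab: "e0 = {a, b}"
    using e0 CE assms(1) unfolding simple_graph_def by (metis card_2_iff subsetD)
  obtain c d where cd: "distinct [a, b, c, d]" "C = {{a, b}, {b, c}, {c, d}, {d, a}}"
    using cycle_4E[OF assms(3), of a b] e0 ab by blast
  obtain c' d' where cd': "distinct [a, b, c', d']" "C' = {{a, b}, {b, c'}, {c', d'}, {d', a}}"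
    using cycle_4E[OF assms(4), of a b] e0 ab by blast
  have "C \<inter> C' \<noteq> {{a, b}}" using assms(5) by (auto simp: normally_adjacent_def)
  moreover have "{a, b} \<in> C \<inter> C'" using e0 ab by simp
  ultimately obtain e1 where e1: "e1 \<in> C" "e1 \<in> C'" "e1 \<noteq> {a, b}" by blast
  have "c = c' \<or> d = d' \<or> (c = d' \<and> d = c')"
  proof -
    have "e1 = {b, c} \<or> e1 = {c, d} \<or> e1 = {d, a}"
      using e1(1,3) unfolding cd(2) by simp
    moreover have "e1 = {b, c'} \<or> e1 = {c', d'} \<or> e1 = {d', a}"
      using e1(2,3) unfolding cd'(2) by simp
    ultimately
    show ?thesis
      using cd(1) cd'(1) by (elim disjE) (simp_all add: doubleton_eq_iff, metis+)
  qed
  moreover have "\<not> (c = d' \<and> d = c')"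
  proof
    assume "c = d' \<and> d = c'"
    then have "{b, c} \<in> edges G" "{c, d} \<in> edges G" "{d, b} \<in> edges G"
      using CE cd(2) cd'(2) by (auto simp: insert_commute)
    then show False using triangle_in_cycles[OF assms(1)] assms(2) by blast
  qed
  ultimately consider "c = c'" | "d = d'" by blast
  then show ?thesis
  proof cases
    case 1
    have e: "{a, b} \<in> C \<inter> C'" "{b, c} \<in> C \<inter> C'"
      unfolding cd(2) cd'(2) using 1 by simp_all
    have s: "e = {a, b} \<or> e = {b, c}" if "e \<in> C \<union> C'" "b \<in> e" for e
      using that cd(1) cd'(1) 1 unfolding cd(2) cd'(2) by auto
    show ?thesis
    proof (rule that)
      show "\<exists>e\<in>C \<inter> C'. b \<in> e" using e(1) by blast
      show "\<forall>e\<in>C \<union> C'. b \<in> e \<longrightarrow> e \<in> C \<inter> C'" using s e by blast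
      have "{e\<in>C \<union> C'. b \<in> e} \<subseteq> {{a, b}, {b, c}}" using s by blast
      from card_mono[OF _ this] show "card {e\<in>C \<union> C'. b \<in> e} \<le> 2"
        by (rule order_trans) (auto simp: card_insert_if)
    qed
  next
    case 2
    have e: "{a, b} \<in> C \<inter> C'" "{d, a} \<in> C \<inter> C'"
      unfolding cd(2) cd'(2) using 2 by simp_all
    have s: "e = {a, b} \<or> e = {d, a}" if "e \<in> C \<union> C'" "a \<in> e" for e
      using that cd(1) cd'(1) 2 unfolding cd(2) cd'(2) by auto
    show ?thesis
    proof (rule that)
      show "\<exists>e\<in>C \<inter> C'. a \<in> e" using e(1) by blast
      show "\<forall>e\<in>C \<union> C'. a \<in> e \<longrightarrow> e \<in> C \<inter> C'" using s e by blast
      have "{e\<in>C \<union> C'. a \<in> e} \<subseteq> {{a, b}, {d, a}}" using s by blast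
      from card_mono[OF _ this] show "card {e\<in>C \<union> C'. a \<in> e} \<le> 2"
        by (rule order_trans) (auto simp: card_insert_if)
    qed
  qed
qed

section \<open>Acyclic edge sets and boundaries of faces\<close>

context plane_graph begin

lemma reach_distinct_path:
  assumes "reach A u v"
  shows "\<exists>xs. xs \<noteq> [] \<and> hd xs = u \<and> last xs = v \<and> distinct xs \<and> successively (\<lambda>x y. {x, y} \<in> A) xs"
  using assms unfolding reach_def
proof (induction rule: rtranclp_induct)
  case base
  show ?case by (rule exI[of _ "[u]"]) simp
next
  case (step y z)
  then obtain xs where xs: "xs \<noteq> []" "hd xs = u" "last xs = y" "distinct xs"
    "successively (\<lambda>x y. {x, y} \<in> A) xs" by blast
  show ?case
  proof (cases "z \<in> set xs")
    case True
    then obtain ys zs where l: "xs = ys @ z # zs" by (meson split_list)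
    show ?thesis
      using xs l by (intro exI[of _ "ys @ [z]"]) (auto simp: successively_append_iff hd_append)
  next
    case False
    show ?thesis
      using xs False step.hyps by (intro exI[of _ "xs @ [z]"]) (auto simp: successively_append_iff)
  qed
qed

lemma reach_cycle:
  assumes "reach A u v" "u \<noteq> v" "{u, v} \<notin> A" "{u, v} \<in> E" "A \<subseteq> E"
  shows "\<exists>k. \<exists>C\<in>cycles G k. C \<subseteq> insert {u, v} A"
proof -
  obtain xs where xs: "xs \<noteq> []" "hd xs = u" "last xs = v" "distinct xs"
    "successively (\<lambda>x y. {x, y} \<in> A) xs" using reach_distinct_path[OF assms(1)] by blast
  have l3: "length xs \<ge> 3"
  proof (rule ccontr)
    assume "\<not> ?thesis"
    moreover have "length xs > 0" using xs(1) by simp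
    ultimately have "length xs = 1 \<or> length xs = 2" by arith
    then show False
      using xs assms(2,3) by (auto simp: length_Suc_conv numeral_eq_Suc)
  qed
  have sub: "cycle_edges xs \<subseteq> insert {u, v} A"
  proof
    fix e assume "e \<in> cycle_edges xs"
    then obtain i where i: "i < length xs" "e = {xs ! i, xs ! (Suc i mod length xs)}"
      by (auto simp: cycle_edges_def)
    show "e \<in> insert {u, v} A"
    proof (cases "Suc i < length xs")
      case True then show ?thesis using xs(5) i by (auto simp: successively_conv_nth)
    next
      case False
      then have l: "Suc i = length xs" using i by simp
      then have "xs ! i = last xs" using xs(1) by (metis diff_Suc_1 last_conv_nth)
      then have "e = {last xs, hd xs}" using i(2) l xs(1) by (simp add: hd_conv_nth)
      then show ?thesis using xs by auto
    qed
  qed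
  have "set xs \<subseteq> V"
  proof
    fix x assume "x \<in> set xs"
    then obtain i where i: "i < length xs" "x = xs ! i" by (auto simp: in_set_conv_nth)
    then have "{xs ! i, xs ! (Suc i mod length xs)} \<in> cycle_edges xs"
      by (auto simp: cycle_edges_def)
    moreover have "insert {u, v} A \<subseteq> E" using assms(4,5) by simp
    ultimately have "{xs ! i, xs ! (Suc i mod length xs)} \<in> E"
      using sub by (meson subset_trans subsetD)
    then show "x \<in> V" using edge_sub i by blast
  qed
  then have "cycle_edges xs \<in> cycles G (length xs)"
    using l3 xs(4) sub assms(4,5) by (auto simp: cycles_def)
  then show ?thesis using sub by blast
qed

text \<open>Without cycles every inserted edge joins two different classes, so the number of faces
  never grows.\<close>

lemma acyclic_one_face:
  assumes "A \<subseteq> E" "\<And>k C. C \<in> cycles G k \<Longrightarrow> \<not> C \<subseteq> A"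
  shows "card (faces A) = 1"
proof -
  have "finite A" using assms finE finite_subset by blast
  then show ?thesis using assms
  proof (induction A rule: finite_induct)
    case empty then show ?case by (simp add: faces_empty)
  next
    case (insert e A)
    have e: "e \<in> E" "A \<subseteq> E" "e \<notin> A" using insert by auto
    obtain u v where uv: "e = {u, v}" "u \<noteq> v" by (metis edgeE[OF e(1)])
    have "\<not> reach A u v"
      using reach_cycle[of A u v] insert.prems(2) e uv by blast
    moreover have "card (faces A) = 1" using insert.IH[OF e(2)] insert.prems(2) by blast
    ultimately show ?case
      using card_faces_insert(2)[OF e uv finite_faces[OF e(2)]] by simp
  qed
qed

text \<open>The boundary edges of a face. Since the closure has to meet the open arc, an edge
  touching the face only in an end is excluded. As this is a set, an edge with the face on both
  sides is counted once.\<close>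

definition FE :: "complex set \<Rightarrow> 'a set set" where
  "FE F = {e \<in> E. closure F \<inter> oe e \<noteq> {}}"

lemma FE_sub: "FE F \<subseteq> E" by (auto simp: FE_def)

text \<open>The frontier of \<open>F\<close> consists of vertices and of points on edges in
  \<open>FE F\<close>, so erasing all other edges does not enlarge \<open>F\<close>.\<close>

lemma face_FE:
  assumes "F \<in> faces E" shows "F \<in> faces (FE F)"
proof (rule faceI)
  show "F \<inter> \<Delta> (FE F) = {}" using face_disjoint[OF order_refl assms] \<Delta>_mono[OF FE_sub] by blast
  show "frontier F \<subseteq> \<Delta> (FE F)"
  proof
    fix x assume x: "x \<in> frontier F"
    then have "x \<in> \<Delta> E" "x \<in> closure F"
      using face_frontier[OF order_refl assms] by (auto simp: frontier_def)
    then consider "x \<in> p ` V" | e where "e \<in> E" "x \<in> oe e" unfolding \<Delta>_oe[OF order_refl] by blast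
    then show "x \<in> \<Delta> (FE F)"
    proof cases
      case 2
      then have "e \<in> FE F" using \<open>x \<in> closure F\<close> by (auto simp: FE_def)
      then show ?thesis using 2 unfolding \<Delta>_oe[OF FE_sub] by blast
    qed (simp add: \<Delta>_def)
  qed
qed (use face_open[OF order_refl assms] face_connected[OF order_refl assms]
       face_nonempty[OF order_refl assms] in auto)

text \<open>\<open>F\<close> accumulates at a point of the open set \<open>U\<close>, so it meets
  \<open>U\<close>; being connected and disjoint from the drawing, it lies in
  \<open>U\<close>.\<close>

lemma FE_region:
  assumes "F \<in> faces E" "e \<in> FE F" "U \<in> faces (E - {e})" "oe e \<subseteq> U"
  shows "F \<subseteq> U"
proof -
  have "closure F \<inter> U \<noteq> {}" using assms(2,4) by (auto simp: FE_def)
  then have "F \<inter> U \<noteq> {}"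
    using open_Int_closure_eq_empty[OF face_open[OF _ assms(3)], of F] by auto
  moreover have "F \<inter> \<Delta> (E - {e}) = {}"
    using face_disjoint[OF order_refl assms(1)] \<Delta>_mono[of "E - {e}" E] by blast
  ultimately show ?thesis
    using face_absorb[OF assms(3) face_connected[OF order_refl assms(1)]] by blast
qed

lemma faces_in_region:
  assumes "e \<in> E" "U \<in> faces (E - {e})" "oe e \<subseteq> U"
  shows "card {F \<in> faces E. F \<subseteq> U} \<le> 2"
proof -
  obtain u v where uv: "e = {u, v}" "u \<noteq> v" by (metis edgeE[OF assms(1)])
  have "insert e (E - {e}) = E" using assms(1) by auto
  then show ?thesis
    using faces_insert_reach[OF assms(1) _ _ uv _ assms(2,3)]
      faces_insert_unreach[OF assms(1) _ _ uv _ assms(2,3)]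
    by (cases "reach (E - {e}) u v") auto
qed

lemma FE_two:
  assumes "e \<in> E" shows "card {F \<in> faces E. e \<in> FE F} \<le> 2"
proof -
  obtain U where U: "U \<in> faces (E - {e})" "oe e \<subseteq> U"
    using edge_face[OF assms Diff_subset, of "{e}"] by auto
  have "card {F \<in> faces E. e \<in> FE F} \<le> card {F \<in> faces E. F \<subseteq> U}"
    using FE_region[OF _ _ U] finite_faces[OF order_refl] by (intro card_mono) auto
  then show ?thesis using faces_in_region[OF assms U] by simp
qed

text \<open>Both faces lie in the region \<open>U\<close> that arises when \<open>e\<close> is
  erased, and at most two faces do. So \<open>U\<close> consists of \<open>F\<close>,
  \<open>F'\<close> and the open arc.\<close>

lemma FE_union:
  assumes "F \<in> faces E" "F' \<in> faces E" "F \<noteq> F'" "e \<in> FE F" "e \<in> FE F'"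
  shows "F \<union> F' \<union> oe e \<in> faces (E - {e})"
proof -
  have e: "e \<in> E" using assms FE_sub by blast
  obtain U where U: "U \<in> faces (E - {e})" "oe e \<subseteq> U"
    using edge_face[OF e Diff_subset, of "{e}"] by auto
  have FU: "F \<subseteq> U" "F' \<subseteq> U" using FE_region U assms by blast+
  let ?Q = "{F \<in> faces E. F \<subseteq> U}"
  have "finite ?Q" using finite_faces[OF order_refl] by simp
  moreover have "{F, F'} \<subseteq> ?Q" using FU assms by simp
  ultimately have Q: "?Q = {F, F'}"
    using card_subset_eq[of ?Q "{F, F'}"] card_mono[of ?Q "{F, F'}"] faces_in_region[OF e U] assms(3)
    by auto
  have ins: "insert e (E - {e}) = E" using e by auto
  have "U \<subseteq> F \<union> F' \<union> oe e"
  proof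
    fix x assume x: "x \<in> U"
    show "x \<in> F \<union> F' \<union> oe e"
    proof (cases "x \<in> oe e")
      case False
      then obtain F'' where "F'' \<in> faces E" "F'' \<subseteq> U" "x \<in> F''"
        using region_split[OF e _ _ U x] ins by auto
      then show ?thesis using Q by blast
    qed simp
  qed
  then have "F \<union> F' \<union> oe e = U" using FU U by blast
  then show ?thesis using U by simp
qed

text \<open>The faces \<open>F\<close> and \<open>F'\<close> and the open edges that they share form a component \<open>W\<close> of the complement
  of the remaining edges; it fills a neighbourhood of \<open>b\<close> up to vertices, so it swallows the edge \<open>g\<close>.\<close>

lemma adjacent_4_faces:
  assumes F: "F \<in> faces E" "F' \<in> faces E" "F \<noteq> F'"
    and b: "e1 \<in> FE F" "e1 \<in> FE F'" "b \<in> e1"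
      "\<forall>e\<in>FE F \<union> FE F'. b \<in> e \<longrightarrow> e \<in> FE F \<inter> FE F'"
    and g: "g \<in> E" "b \<in> g" "g \<notin> FE F \<union> FE F'"
  shows False
proof -
  define C where "C = FE F"
  define C' where "C' = FE F'"
  define S where "S = C \<inter> C'"
  define B where "B = (C \<union> C') - S"
  have CE: "C \<subseteq> E" "C' \<subseteq> E" "B \<subseteq> E" "S \<subseteq> E" 
    using FE_sub[of F] FE_sub[of F'] unfolding C_def C'_def B_def S_def by blast+
  define W where "W = F \<union> F' \<union> (\<Union>e\<in>S. oe e)"
  have e1S: "e1 \<in> S" using b(1,2) by (simp add: S_def C_def C'_def)
  \<comment> \<open>Each member of this union is a face of the drawing without one edge, hence open
    and connected, and all members contain \<open>F\<close>.\<close>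
  have W: "W = (\<Union>e\<in>S. F \<union> F' \<union> oe e)" using e1S by (auto simp: W_def)
  have Ue: "F \<union> F' \<union> oe e \<in> faces (E - {e})" if "e \<in> S" for e
    using FE_union[OF F] that by (auto simp: S_def C_def C'_def)
  have oU: "open (F \<union> F' \<union> oe e)" "connected (F \<union> F' \<union> oe e)" if "e \<in> S" for e
    using face_open[OF _ Ue[OF that]] face_connected[OF _ Ue[OF that]] by auto
  obtain z where z: "z \<in> F" using face_nonempty[OF order_refl F(1)] by blast
  have openW: "open W" unfolding W using oU by blast
  have connW: "connected W" unfolding W
    by (rule connected_Union) (use oU z in auto)
  have disj: "F \<inter> \<Delta> E = {}" "F' \<inter> \<Delta> E = {}"
    using face_disjoint[OF order_refl] F by auto
  have WB: "W \<inter> \<Delta> B = {}"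
  proof -
    have "oe e \<inter> \<Delta> B = {}" if "e \<in> S" for e
      using oe_\<Delta>[of e B] that CE by (auto simp: B_def)
    moreover have "\<Delta> B \<subseteq> \<Delta> E" using CE \<Delta>_mono by blast
    ultimately show ?thesis unfolding W_def using disj by blast
  qed
  have finS: "finite S" using CE finE finite_subset by blast
  have frW: "frontier W \<subseteq> \<Delta> B"
  proof
    fix x assume "x \<in> frontier W"
    then have x: "x \<in> closure W" "x \<notin> W" using openW by (auto simp: frontier_def interior_open)
    have "closure W \<subseteq> closure F \<union> closure F' \<union> (\<Union>e\<in>S. closure (oe e))"
      unfolding W_def using finS
      by (intro closure_minimal closed_Un closed_UN) (auto intro: closure_subset[THEN subsetD])
    then consider "x \<in> closure F" | "x \<in> closure F'" | e where "e \<in> S" "x \<in> closure (oe e)"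
      using x by blast
    then have "x \<in> \<Delta> C \<union> \<Delta> C'"
    proof cases
      case 1
      then have "x \<in> frontier F" using x(2) face_open[OF order_refl F(1)]
        by (auto simp: frontier_def interior_open W_def)
      then show ?thesis using face_frontier[OF FE_sub face_FE[OF F(1)]] by (auto simp: C_def)
    next
      case 2
      then have "x \<in> frontier F'" using x(2) face_open[OF order_refl F(2)]
        by (auto simp: frontier_def interior_open W_def)
      then show ?thesis using face_frontier[OF FE_sub face_FE[OF F(2)]] by (auto simp: C'_def)
    next
      case 3
      have eE: "e \<in> E" using 3 CE by blast
      have "closed (path_image (\<gamma> e))" using arc_edge[OF eE] by (simp add: closed_arc_image)
      then have "closure (oe e) \<subseteq> path_image (\<gamma> e)" by (intro closure_minimal) (auto simp: oe_def)
      then show ?thesis using 3 by (auto simp: \<Delta>_def S_def)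
    qed
    moreover have "\<Delta> C \<union> \<Delta> C' \<subseteq> \<Delta> B \<union> (\<Union>e\<in>S. oe e)"
      unfolding \<Delta>_oe[OF CE(1)] \<Delta>_oe[OF CE(2)] \<Delta>_oe[OF CE(3)] by (auto simp: B_def)
    ultimately show "x \<in> \<Delta> B" using x(2) by (auto simp: W_def)
  qed
  have WfB: "W \<in> faces B"
    using openW connW WB frW z by (intro faceI) (auto simp: W_def)
  define K where "K = (\<Union>e\<in>B. path_image (\<gamma> e))"
  have bV: "b \<in> V" using g edge_sub by blast
  have bB: "b \<notin> e" if "e \<in> B" for e
    using b(4) that unfolding B_def S_def C_def C'_def by blast
  have closedK: "closed K"
    unfolding K_def
    using CE(3) finE arc_edge by (intro closed_UN) (auto intro: finite_subset closed_arc_image)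
  have edgeK: "insert (p b) (oe e) \<inter> K = {}" if e: "e \<in> E" "e \<notin> B" for e
  proof -
    have "K \<subseteq> \<Delta> B" by (auto simp: K_def \<Delta>_def)
    then have 1: "oe e \<inter> K = {}" using oe_\<Delta>[OF e(1) CE(3) e(2)] by blast
    have "p b \<notin> path_image (\<gamma> e')" if e': "e' \<in> B" for e'
    proof
      assume "p b \<in> path_image (\<gamma> e')"
      then have "p b \<in> p ` e'" using edge_verts[of e'] e' CE(3) bV by blast
      then obtain b' where "b' \<in> e'" "p b = p b'" by blast
      moreover have "b' \<in> V" using \<open>b' \<in> e'\<close> edge_sub[of e'] e' CE(3) by blast
      ultimately have "b \<in> e'" using inj_onD[OF injp _ bV] by blast
      then show False using bB[OF e'] by simp
    qed
    then show ?thesis using 1 by (auto simp: K_def)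
  qed
  \<comment> \<open>\<open>K\<close> is closed and avoids \<open>p b\<close>. Deleting finitely many
    points keeps the open connected set \<open>Z\<close> connected, so the part of \<open>Z\<close>
    on \<open>e1\<close>, which lies in \<open>W\<close>, pulls all of it into the face
    \<open>W\<close>.\<close>
  define Z where "Z = connected_component_set (- K) (p b)"
  have ZK: "Z \<subseteq> - K" unfolding Z_def by (rule connected_component_subset)
  have "connected (Z - p ` V)"
    unfolding Z_def
    by (rule connected_open_delete_finite) (use closedK finV in \<open>auto intro: open_connected_component\<close>)
  moreover have "(Z - p ` V) \<inter> \<Delta> B = {}" using ZK by (auto simp: \<Delta>_def K_def)
  moreover have in_Z: "oe e \<subseteq> Z - p ` V" if "e \<in> E" "e \<notin> B" "b \<in> e" for e
  proof -
    have "insert (p b) (oe e) \<subseteq> Z"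
      unfolding Z_def
      using edgeK[OF that(1,2)] oe_insert_connected[OF that(1,3)]
      by (intro connected_component_maximal) auto
    then show ?thesis using oe_pV[OF that(1)] by blast
  qed
  moreover have "oe e1 \<subseteq> W" "e1 \<in> E" "e1 \<notin> B"
    using e1S CE by (auto simp: W_def B_def)
  ultimately have "Z - p ` V \<subseteq> W"
    using face_absorb[OF WfB, of "Z - p ` V"] oe_nonempty[of e1] b(3) by blast
  moreover have gn: "g \<notin> B" "g \<notin> S" using g(3) by (auto simp: B_def S_def C_def C'_def)
  ultimately have "oe g \<subseteq> W" using in_Z[OF g(1) gn(1) g(2)] by blast
  moreover have "oe g \<inter> W = {}"
  proof -
    have "oe g \<subseteq> \<Delta> E" using g(1) by (auto simp: \<Delta>_def oe_def)
    moreover have "oe g \<inter> oe e = {}" if "e \<in> S" for e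
      using oe_oe[OF g(1), of e] that gn CE by blast
    ultimately show ?thesis unfolding W_def using disj by blast
  qed
  ultimately show False using oe_nonempty[OF g(1)] by blast
qed

end

lemma restrict_drawing:
  assumes "plane_drawing G p \<gamma>" "S \<subseteq> verts G"
  shows "plane_drawing (induced_subgraph G S) p \<gamma>"
  unfolding plane_drawing_def
proof (intro conjI ballI impI)
  let ?I = "induced_subgraph G S"
  show "inj_on p (verts ?I)"
    using assms by (auto simp: plane_drawing_def induced_subgraph_def intro: inj_on_subset)
  fix e assume "e \<in> edges ?I"
  then have e: "e \<in> edges G" "e \<subseteq> S" by (auto simp: induced_subgraph_def)
  show "arc (\<gamma> e)" "{pathstart (\<gamma> e), pathfinish (\<gamma> e)} = p ` e"
    using assms(1) e by (auto simp: plane_drawing_def)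
  have "path_image (\<gamma> e) \<inter> p ` verts G = p ` e"
    using assms(1) e by (auto simp: plane_drawing_def)
  note eq = this
  have "path_image (\<gamma> e) \<inter> p ` S \<subseteq> path_image (\<gamma> e) \<inter> p ` verts G"
    using assms(2) by (intro Int_mono image_mono order_refl)
  moreover have "p ` e \<subseteq> path_image (\<gamma> e)" using eq by (metis Int_lower1)
  moreover have "p ` e \<subseteq> p ` S" using e by (intro image_mono)
  ultimately have "path_image (\<gamma> e) \<inter> p ` S = p ` e" unfolding eq by (simp add: subset_antisym)
  then show "path_image (\<gamma> e) \<inter> p ` verts ?I = p ` e" by (simp add: induced_subgraph_def)
  fix e' assume "e' \<in> edges ?I" "e \<noteq> e'"
  then show "path_image (\<gamma> e) \<inter> path_image (\<gamma> e') \<subseteq> p ` (e \<inter> e')"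
    using assms(1) e by (simp add: plane_drawing_def induced_subgraph_def)
qed

lemma induced_simple: "simple_graph G \<Longrightarrow> S \<subseteq> verts G \<Longrightarrow> simple_graph (induced_subgraph G S)"
  by (auto simp: simple_graph_def induced_subgraph_def finite_subset)

lemma induced_cycles: "S \<subseteq> verts G \<Longrightarrow> cycles (induced_subgraph G S) k \<subseteq> cycles G k"
  by (auto simp: cycles_def induced_subgraph_def)

section \<open>The edge bound for plane graphs of minimum degree 3\<close>

context plane_graph begin

lemma handshake: "(\<Sum>v\<in>V. card {e\<in>E. v \<in> e}) = 2 * card E"
proof -
  have "(\<Sum>v\<in>V. card {e\<in>E. v \<in> e}) = (\<Sum>e\<in>E. card {v\<in>V. v \<in> e})"
    using sum_multicount_gen[OF finV finE, of "\<lambda>v e. v \<in> e" "\<lambda>e. card {v\<in>V. v \<in> e}"] by simp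
  also have "\<dots> = (\<Sum>e\<in>E. 2)"
  proof (rule sum.cong[OF refl])
    fix e assume e: "e \<in> E"
    then have "{v\<in>V. v \<in> e} = e" using edge_sub by blast
    then show "card {v\<in>V. v \<in> e} = 2" using edge_card[OF e] by simp
  qed
  finally show ?thesis by simp
qed

text \<open>If \<open>FE F\<close> were acyclic, \<open>F\<close> would be the only face of its
  drawing. An edge outside \<open>FE F\<close> would run through \<open>F\<close>, so
  \<open>FE F\<close> is all of \<open>E\<close>. Then the graph is a forest with fewer edges than
  vertices, contrary to minimum degree 3.\<close>

lemma face_contains_cycle:
  assumes "\<And>v. v \<in> V \<Longrightarrow> card {e\<in>E. v \<in> e} \<ge> 3" "V \<noteq> {}" "F \<in> faces E"
  obtains k C where "C \<in> cycles G k" "C \<subseteq> FE F"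
proof (rule ccontr)
  assume "\<not> thesis"
  then have nc: "\<And>k C. C \<in> cycles G k \<Longrightarrow> \<not> C \<subseteq> FE F" using that by blast
  have c1: "card (faces (FE F)) = 1" by (rule acyclic_one_face[OF FE_sub nc])
  then obtain F0 where "faces (FE F) = {F0}" using card_1_singletonE by blast
  then have one: "faces (FE F) = {F}" using face_FE[OF assms(3)] by simp
  have "FE F = E"
  proof (rule ccontr)
    assume "FE F \<noteq> E"
    then obtain e where e: "e \<in> E" "e \<notin> FE F" using FE_sub by blast
    then obtain U where U: "U \<in> faces (FE F)" "oe e \<subseteq> U" using edge_face[OF e(1) FE_sub] by blast
    then have "oe e \<subseteq> F" using one by simp
    moreover have "oe e \<subseteq> \<Delta> E" using e by (auto simp: \<Delta>_def oe_def)
    ultimately show False using face_disjoint[OF order_refl assms(3)] oe_nonempty[OF e(1)] by blast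
  qed
  then have "card E + card (cls E ` V) + 1 \<le> 1 + card V"
    using euler_ineq[OF order_refl] c1 by simp
  moreover have "card (cls E ` V) > 0" by (rule card_cls_pos[OF assms(2)])
  moreover have "(\<Sum>v\<in>V. 3) \<le> (\<Sum>v\<in>V. card {e\<in>E. v \<in> e})"
    using assms(1) by (intro sum_mono) auto
  then have "3 * card V \<le> 2 * card E" using handshake by simp
  ultimately show False by linarith
qed

lemma card_E_bound:
  assumes deg: "\<And>v. v \<in> V \<Longrightarrow> card {e\<in>E. v \<in> e} \<ge> 3" and V: "V \<noteq> {}"
    and c3: "cycles G 3 = {}"
    and c4: "\<And>C C'. C \<in> cycles G 4 \<Longrightarrow> C' \<in> cycles G 4 \<Longrightarrow> \<not> normally_adjacent C C'"
  shows "11 * card E + 40 \<le> 20 * card V"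
proof -
  let ?S = "faces E"
  define S4 where "S4 = {F \<in> ?S. card (FE F) = 4}"
  have fin: "finite ?S" by (rule finite_faces[OF order_refl])
  have finFE: "finite (FE F)" for F using FE_sub finE finite_subset by blast
  \<comment> \<open>The boundary contains a cycle, whose length is at least 4; four boundary edges
    are therefore exactly the edges of a 4-cycle.\<close>
  have cyc: "card (FE F) \<ge> 5 \<or> (card (FE F) = 4 \<and> FE F \<in> cycles G 4)" if F: "F \<in> ?S" for F
  proof -
    obtain k C where C: "C \<in> cycles G k" "C \<subseteq> FE F"
      by (rule face_contains_cycle[OF deg V F])
    have le: "k \<le> card (FE F)" using card_mono[OF finFE C(2)] card_cycle[OF C(1)] by simp
    have "k \<noteq> 3" using C c3 by auto
    then have "k \<ge> 4" using cycle_ge3[OF C(1)] by simp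
    show ?thesis
    proof (cases "card (FE F) = 4")
      case True
      then have "C = FE F" using card_subset_eq[OF finFE C(2)] card_cycle[OF C(1)] le \<open>k \<ge> 4\<close> by simp
      then show ?thesis using True C le \<open>k \<ge> 4\<close> by auto
    qed (use le \<open>k \<ge> 4\<close> in simp)
  qed
  have disj: "FE F \<inter> FE F' = {}" if F: "F \<in> S4" "F' \<in> S4" "F \<noteq> F'" for F F'
  proof (rule ccontr)
    assume ne: "FE F \<inter> FE F' \<noteq> {}"
    have FF: "F \<in> ?S" "F' \<in> ?S" using F by (auto simp: S4_def)
    have C: "FE F \<in> cycles G 4" "FE F' \<in> cycles G 4" using cyc[OF FF(1)] cyc[OF FF(2)] F by (auto simp: S4_def)
    obtain b where b: "\<exists>e\<in>FE F \<inter> FE F'. b \<in> e" "\<forall>e\<in>FE F \<union> FE F'. b \<in> e \<longrightarrow> e \<in> FE F \<inter> FE F'"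
      "card {e\<in>FE F \<union> FE F'. b \<in> e} \<le> 2"
      by (rule shared_vertex_4_cycles[OF simple c3 C c4[OF C] ne])
    obtain e1 where e1: "e1 \<in> FE F" "e1 \<in> FE F'" "b \<in> e1" using b(1) by blast
    have "b \<in> V" using e1 FE_sub edge_sub by blast
    \<comment> \<open>The two cycles account for at most two edges at \<open>b\<close>; the degree
      supplies a third.\<close>
    from deg[OF this] have "\<not> {e\<in>E. b \<in> e} \<subseteq> {e\<in>FE F \<union> FE F'. b \<in> e}"
      using card_mono[of "{e\<in>FE F \<union> FE F'. b \<in> e}" "{e\<in>E. b \<in> e}"] finFE b(3) by auto
    then obtain g where "g \<in> E" "b \<in> g" "g \<notin> FE F \<union> FE F'" by blast
    then show False using adjacent_4_faces[OF FF F(3) e1 b(2)] by blast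
  qed
  have sum2: "(\<Sum>F\<in>?S. card (FE F)) \<le> 2 * card E"
  proof -
    have "(\<Sum>F\<in>?S. card (FE F)) = (\<Sum>F\<in>?S. card {e\<in>E. e \<in> FE F})"
      using FE_sub by (intro sum.cong refl arg_cong[of _ _ card]) blast
    also have "\<dots> = (\<Sum>e\<in>E. card {F\<in>?S. e \<in> FE F})"
      using sum_multicount_gen[OF fin finE, of "\<lambda>F e. e \<in> FE F" "\<lambda>e. card {F\<in>?S. e \<in> FE F}"] by simp
    also have "\<dots> \<le> (\<Sum>e\<in>E. 2)" by (intro sum_mono FE_two)
    finally show ?thesis by simp
  qed
  have S4: "4 * card S4 \<le> card E"
  proof -
    have "card (\<Union>F\<in>S4. FE F) = (\<Sum>F\<in>S4. card (FE F))"
      using disj finFE fin by (intro card_UN_disjoint) (auto simp: S4_def)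
    also have "\<dots> = 4 * card S4" by (simp add: S4_def)
    finally show ?thesis using card_mono[OF finE, of "\<Union>F\<in>S4. FE F"] FE_sub by (simp add: UN_least)
  qed
  have "5 * card ?S \<le> (\<Sum>F\<in>?S. card (FE F) + (if F \<in> S4 then 1 else 0))"
  proof -
    have "(\<Sum>F\<in>?S. 5) \<le> (\<Sum>F\<in>?S. card (FE F) + (if F \<in> S4 then 1 else 0))"
      using cyc by (intro sum_mono) (fastforce simp: S4_def)
    then show ?thesis by simp
  qed
  also have "\<dots> = (\<Sum>F\<in>?S. card (FE F)) + card S4"
  proof -
    have "(\<Sum>F\<in>?S. if F \<in> S4 then 1 else 0) = card (?S \<inter> S4)"
      using fin by (simp add: sum.If_cases Int_def)
    moreover have "?S \<inter> S4 = S4" by (auto simp: S4_def)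
    ultimately show ?thesis by (simp add: sum.distrib)
  qed
  \<comment> \<open>Writing \<open>f\<close> and \<open>f4\<close> for the numbers of all faces and
    of faces in \<open>S4\<close>: \<open>5 f \<le> 2 e + f4\<close> and \<open>4 f4 \<le> e\<close>
    give \<open>20 f \<le> 9 e\<close>, and \<open>e + 2 \<le> f + n\<close> turns this into the
    bound.\<close>
  finally have "20 * card ?S \<le> 9 * card E" using sum2 S4 by linarith
  moreover have "card E + 2 \<le> card ?S + card V"
    using euler_ineq[OF order_refl] card_cls_pos[OF V, of E] by linarith
  ultimately show ?thesis by linarith
qed

end

section \<open>Selecting few elements from each of several sets\<close>

lemma fill_set:
  assumes "finite U" "T \<subseteq> U" "C \<subseteq> U" "m \<le> card C"
  obtains T' where "T \<subseteq> T'" "T' \<subseteq> U" "m \<le> card (T' \<inter> C)" "card T' \<le> card T + (m - card (T \<inter> C))"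
proof -
  have fC: "finite C" "finite T" using assms finite_subset by blast+
  have "m - card (T \<inter> C) \<le> card (C - T)"
    using card_Diff_subset_Int[of C T] fC assms(4) by (simp add: Int_commute)
  then obtain D where D: "D \<subseteq> C - T" "card D = m - card (T \<inter> C)" by (meson obtain_subset_with_card_n)
  have fD: "finite D" using D fC finite_subset by blast
  have "card ((T \<inter> C) \<union> D) = card (T \<inter> C) + card D"
    using D fD fC by (intro card_Un_disjoint) auto
  moreover have "(T \<union> D) \<inter> C = (T \<inter> C) \<union> D" using D by blast
  ultimately have "m \<le> card ((T \<union> D) \<inter> C)" using D by simp
  moreover have "card (T \<union> D) \<le> card T + (m - card (T \<inter> C))"
    using card_Un_le[of T D] D by simp
  moreover have "T \<union> D \<subseteq> U" using D assms by blast
  ultimately show ?thesis using that by blast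
qed

text \<open>By the fact named \<open>*\<close>, a set \<open>T\<close> can be completed if its size
  plus its three deficits is at most \<open>2m\<close>. If \<open>C1\<close> and \<open>C2\<close>
  share \<open>m\<close> elements, these serve both. Otherwise all of \<open>C1 \<inter> C2\<close>
  is taken together with elements of \<open>C3\<close> lying in exactly one of \<open>C1\<close>,
  \<open>C2\<close>, so every chosen element serves at least two sets.\<close>

lemma three_sets_hit:
  assumes U: "finite U" "card U = 5 * m"
    and C: "C1 \<subseteq> U" "C2 \<subseteq> U" "C3 \<subseteq> U" "card C1 = 2 * m" "card C2 = 2 * m" "card C3 = 2 * m"
  obtains S where "S \<subseteq> U" "card S \<le> 2 * m" "m \<le> card (S \<inter> C1)" "m \<le> card (S \<inter> C2)" "m \<le> card (S \<inter> C3)"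
proof -
  have fin: "finite C1" "finite C2" "finite C3" using U C finite_subset by blast+
  let ?a = "card (C1 \<inter> C2)"
  note result = that
  have *: thesis if T: "T \<subseteq> U"
    and le: "card T + (m - card (T \<inter> C1)) + (m - card (T \<inter> C2)) + (m - card (T \<inter> C3)) \<le> 2 * m" for T
  proof -
    obtain T1 where T1: "T \<subseteq> T1" "T1 \<subseteq> U" "m \<le> card (T1 \<inter> C1)" "card T1 \<le> card T + (m - card (T \<inter> C1))"
      using fill_set[OF U(1) T C(1), of m] C by auto
    obtain T2 where T2: "T1 \<subseteq> T2" "T2 \<subseteq> U" "m \<le> card (T2 \<inter> C2)" "card T2 \<le> card T1 + (m - card (T1 \<inter> C2))"
      using fill_set[OF U(1) T1(2) C(2), of m] C by auto
    obtain T3 where T3: "T2 \<subseteq> T3" "T3 \<subseteq> U" "m \<le> card (T3 \<inter> C3)" "card T3 \<le> card T2 + (m - card (T2 \<inter> C3))"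
      using fill_set[OF U(1) T2(2) C(3), of m] C by auto
    have "card (T \<inter> C2) \<le> card (T1 \<inter> C2)" "card (T \<inter> C3) \<le> card (T2 \<inter> C3)"
      "card (T1 \<inter> C1) \<le> card (T3 \<inter> C1)" "card (T2 \<inter> C2) \<le> card (T3 \<inter> C2)"
      using T1(1) T2(1) T3(1) fin by (auto intro!: card_mono)
    then show ?thesis
      by (intro result[OF T3(2)]) (use T1(3,4) T2(3,4) T3(3,4) le in linarith)+
  qed
  show ?thesis
  proof (cases "?a \<ge> m")
    case True
    then obtain T where T: "T \<subseteq> C1 \<inter> C2" "card T = m" by (meson obtain_subset_with_card_n)
    then have "T \<inter> C1 = T" "T \<inter> C2 = T" by auto
    then show ?thesis using *[of T] T C by auto
  next
    case False
    let ?t = "card (C1 \<inter> C2 \<inter> C3)"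
    let ?Y = "C3 \<inter> (C1 \<union> C2)"
    have "card (C1 \<union> C2) + ?a = 4 * m" using card_Un_Int[of C1 C2] fin C by simp
    moreover have "card C3 + card (C1 \<union> C2) = card (C3 \<union> (C1 \<union> C2)) + card ?Y"
      by (rule card_Un_Int) (use fin in auto)
    moreover have "card (C3 \<union> (C1 \<union> C2)) \<le> 5 * m"
      using card_mono[OF U(1), of "C3 \<union> (C1 \<union> C2)"] U C by simp
    \<comment> \<open>\<open>C1\<close> and \<open>C2\<close> leave only \<open>m + ?a\<close> of
      the \<open>5m\<close> elements uncovered, so \<open>C3\<close> has at least
      \<open>m - ?a\<close> elements inside their union.\<close>
    ultimately have Y: "m \<le> card ?Y + ?a" using C by linarith
    have "card (?Y - C1 \<inter> C2) = card ?Y - card (?Y \<inter> (C1 \<inter> C2))"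
      by (rule card_Diff_subset_Int) (use fin in auto)
    moreover have "?Y \<inter> (C1 \<inter> C2) = C1 \<inter> C2 \<inter> C3" by blast
    ultimately have "m - ?a - ?t \<le> card (?Y - C1 \<inter> C2)" using Y by simp
    then obtain B where B: "B \<subseteq> ?Y - C1 \<inter> C2" "card B = m - ?a - ?t" by (meson obtain_subset_with_card_n)
    have fB: "finite B" using B fin finite_subset by blast
    let ?T = "(C1 \<inter> C2) \<union> B"
    have "card ?T = ?a + card B" using B fB fin by (intro card_Un_disjoint) auto
    moreover have "card (?T \<inter> C1) = ?a + card (B \<inter> C1)"
    proof -
      have "?T \<inter> C1 = (C1 \<inter> C2) \<union> (B \<inter> C1)" by blast
      then show ?thesis using B fB fin by (auto intro!: card_Un_disjoint)
    qed
    moreover have "card (?T \<inter> C2) = ?a + card (B \<inter> C2)"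
    proof -
      have "?T \<inter> C2 = (C1 \<inter> C2) \<union> (B \<inter> C2)" by blast
      then show ?thesis using B fB fin by (auto intro!: card_Un_disjoint)
    qed
    moreover have "card (?T \<inter> C3) = ?t + card B"
    proof -
      have eq: "?T \<inter> C3 = (C1 \<inter> C2 \<inter> C3) \<union> B" using B by blast
      have "(C1 \<inter> C2 \<inter> C3) \<inter> B = {}" using B by blast
      then show ?thesis unfolding eq using fB fin by (intro card_Un_disjoint) auto
    qed
    moreover have "card B = card (B \<inter> C1) + card (B \<inter> C2)"
    proof -
      have "B = (B \<inter> C1) \<union> (B \<inter> C2)" "(B \<inter> C1) \<inter> (B \<inter> C2) = {}" using B by blast+
      then show ?thesis using fB by (metis card_Un_disjoint finite_Int)
    qed
    moreover have "?T \<subseteq> U" using B C by blast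
    \<comment> \<open>Without truncation, size plus deficits equal
      \<open>3m - ?a - ?t - card B\<close>, which is \<open>2m\<close> by the choice of
      \<open>B\<close>. If \<open>?a + ?t\<close> exceeds \<open>m\<close>, then \<open>B\<close> is
      empty and the truncated third deficit is at most \<open>?a\<close>, which also gives
      \<open>2m\<close>.\<close>
    ultimately show ?thesis using *[of ?T] B(2) False by linarith
  qed
qed

lemma superset_of_card:
  assumes "finite U" "card (M \<inter> U) \<le> n" "n \<le> card U"
  obtains M' where "M \<inter> U \<subseteq> M'" "M' \<subseteq> U" "card M' = n"
  using exists_subset_between[of "M \<inter> U" n U] assms by blast

text \<open>Inside \<open>5m\<close> elements each \<open>M\<close> misses at least
  \<open>2m\<close>. A \<open>2m\<close>-set with \<open>m\<close> elements among those missed by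
  \<open>M\<close> has at most \<open>m\<close> elements in \<open>M\<close>.\<close>

lemma select_three:
  assumes U: "finite U" "5 * m \<le> card U"
    and M: "card (M1 \<inter> U) \<le> 3 * m" "card (M2 \<inter> U) \<le> 3 * m" "card (M3 \<inter> U) \<le> 3 * m"
  obtains S where "S \<subseteq> U" "card S = 2 * m"
    "card (S \<inter> M1) \<le> m" "card (S \<inter> M2) \<le> m" "card (S \<inter> M3) \<le> m"
proof -
  obtain U' where U': "U' \<subseteq> U" "card U' = 5 * m" using U(2) by (meson obtain_subset_with_card_n)
  have fU': "finite U'" using U U' finite_subset by blast
  have c: "\<exists>C\<subseteq>U'. card C = 2 * m \<and> C \<inter> M = {}" if "card (M \<inter> U) \<le> 3 * m" for M
  proof -
    have "card (M \<inter> U') \<le> card (M \<inter> U)" using U U' by (intro card_mono) auto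
    then have "2 * m \<le> card (U' - M)"
      using card_Diff_subset_Int[of U' M] fU' U' that by (simp add: Int_commute)
    then obtain C where "C \<subseteq> U' - M" "card C = 2 * m" by (meson obtain_subset_with_card_n)
    then show ?thesis by blast
  qed
  obtain C1 where C1: "C1 \<subseteq> U'" "card C1 = 2 * m" "C1 \<inter> M1 = {}" using c[OF M(1)] by blast
  obtain C2 where C2: "C2 \<subseteq> U'" "card C2 = 2 * m" "C2 \<inter> M2 = {}" using c[OF M(2)] by blast
  obtain C3 where C3: "C3 \<subseteq> U'" "card C3 = 2 * m" "C3 \<inter> M3 = {}" using c[OF M(3)] by blast
  obtain T where T: "T \<subseteq> U'" "card T \<le> 2 * m" "m \<le> card (T \<inter> C1)" "m \<le> card (T \<inter> C2)" "m \<le> card (T \<inter> C3)"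
    using three_sets_hit[OF fU' U'(2) C1(1) C2(1) C3(1) C1(2) C2(2) C3(2)] by blast
  obtain S where S: "T \<subseteq> S" "S \<subseteq> U'" "card S = 2 * m"
    using exists_subset_between[OF T(2) _ T(1) fU'] U' by auto
  have fS: "finite S" using S fU' finite_subset by blast
  have "card (S \<inter> M) \<le> m" if "C \<inter> M = {}" "m \<le> card (T \<inter> C)" for C M
  proof -
    have "card (S \<inter> M) + card (T \<inter> C) = card ((S \<inter> M) \<union> (T \<inter> C))"
      using that fS S(1) finite_subset[OF S(1) fS] by (intro card_Un_disjoint[symmetric]) auto
    also have "\<dots> \<le> card S" using fS S(1) by (intro card_mono) auto
    finally show ?thesis using that S by linarith
  qed
  then show ?thesis using that[of S] S U' T C1 C2 C3 by blast
qed

section \<open>Selection among \<open>7m\<close> elements against five sets of size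
  \<open>3m\<close>\<close>

context
  fixes U :: "'b set" and I :: "'i set" and M :: "'i \<Rightarrow> 'b set" and m :: nat
  assumes finU: "finite U" and cU: "card U = 7 * m" and cI: "card I = 5"
    and MU: "\<And>i. i \<in> I \<Longrightarrow> M i \<subseteq> U" and cM: "\<And>i. i \<in> I \<Longrightarrow> card (M i) = 3 * m"
begin

private definition T :: "'b \<Rightarrow> 'i set" where "T u = {i \<in> I. u \<in> M i}"

private lemma finI: "finite I" using cI by (intro card_ge_0_finite) simp

private lemma finT: "finite (T u)" using finI by (simp add: T_def)

private lemma sum_T: "S \<subseteq> U \<Longrightarrow> (\<Sum>u\<in>S. card (T u)) = (\<Sum>i\<in>I. card (S \<inter> M i))"
proof -
  assume "S \<subseteq> U"
  then have "finite S" using finU finite_subset by blast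
  then have "(\<Sum>u\<in>S. card (T u)) = (\<Sum>i\<in>I. card {u\<in>S. u \<in> M i})"
    unfolding T_def using sum_multicount_gen[OF _ finI, of S "\<lambda>u i. u \<in> M i" "\<lambda>i. card {u\<in>S. u \<in> M i}"] by simp
  then show ?thesis by (simp add: Int_def)
qed

private lemma sum_T_U: "(\<Sum>u\<in>U. card (T u)) = 15 * m"
proof -
  have "(\<Sum>i\<in>I. card (U \<inter> M i)) = (\<Sum>i\<in>I. 3 * m)"
    using MU cM by (intro sum.cong refl) (simp add: Int_absorb1)
  then show ?thesis using sum_T[OF order_refl] cI by simp
qed

text \<open>An element in no set would meet no other index set, and an element only in
  \<open>M k\<close> would force all of \<open>R\<close> into \<open>M k\<close>, which has just
  \<open>3m\<close> elements.\<close>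

private lemma pairwise_intersecting_card:
  assumes R: "R \<subseteq> U" "5 * m + 2 \<le> card R"
    and int: "\<And>a b. a \<in> R \<Longrightarrow> b \<in> R \<Longrightarrow> a \<noteq> b \<Longrightarrow> T a \<inter> T b \<noteq> {}" and a: "a \<in> R"
  shows "2 \<le> card (T a)"
proof (rule ccontr)
  assume "\<not> ?thesis"
  then have "card (T a) = 0 \<or> card (T a) = 1" by linarith
  then show False
  proof
    assume "card (T a) = 0"
    then have "T a = {}" using finT by simp
    then have "R \<subseteq> {a}" using int[OF a] by blast
    then have "card R \<le> 1" using card_mono[of "{a}" R] by simp
    then show False using R by simp
  next
    assume "card (T a) = 1"
    then obtain k where k: "T a = {k}" using card_1_singletonE by blast
    have "R \<subseteq> M k"
    proof
      fix b assume "b \<in> R"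
      then show "b \<in> M k" using int[OF a, of b] k by (cases "b = a") (auto simp: T_def)
    qed
    moreover have "k \<in> I" using k by (auto simp: T_def)
    ultimately have "card R \<le> 3 * m" using card_mono[of "M k" R] cM MU finU finite_subset by metis
    then show False using R by simp
  qed
qed

text \<open>The set \<open>S\<close> is built from pairs that lie in no common \<open>M i\<close>. Preferring pairs contained in at least
  three of the sets in total keeps the sets \<open>M i\<close> small outside \<open>S\<close>; once no such pair is left, all elements
  outside \<open>S\<close> that lie in two of the sets lie in a common one, which leaves enough disjoint pairs.\<close>

private definition good :: "nat \<Rightarrow> 'b set \<Rightarrow> bool" where
  "good j S \<longleftrightarrow> S \<subseteq> U \<and> card S = 2 * j \<and> (\<forall>i\<in>I. card (S \<inter> M i) \<le> j) \<and>
     (3 * j \<le> (\<Sum>u\<in>S. card (T u)) \<or> (\<exists>i\<in>I. \<forall>u\<in>U - S. 2 \<le> card (T u) \<longrightarrow> u \<in> M i))"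

text \<open>No \<open>M i\<close> contains both new elements, so every intersection grows by at most
  one.\<close>

private lemma extend_pair:
  assumes "S \<subseteq> U" "card S = 2 * j" "\<forall>i\<in>I. card (S \<inter> M i) \<le> j"
    "a \<in> U - S" "b \<in> U - S" "a \<noteq> b" "T a \<inter> T b = {}"
  shows "insert a (insert b S) \<subseteq> U" "card (insert a (insert b S)) = 2 * Suc j"
    "\<forall>i\<in>I. card (insert a (insert b S) \<inter> M i) \<le> Suc j"
    "(\<Sum>u\<in>insert a (insert b S). card (T u)) = card (T a) + card (T b) + (\<Sum>u\<in>S. card (T u))"
proof -
  have fS: "finite S" using assms(1) finU finite_subset by blast
  show "insert a (insert b S) \<subseteq> U" "card (insert a (insert b S)) = 2 * Suc j"
    "(\<Sum>u\<in>insert a (insert b S). card (T u)) = card (T a) + card (T b) + (\<Sum>u\<in>S. card (T u))"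
    using assms fS by auto
  show "\<forall>i\<in>I. card (insert a (insert b S) \<inter> M i) \<le> Suc j"
  proof
    fix i assume i: "i \<in> I"
    have "a \<notin> M i \<or> b \<notin> M i" using assms(7) i by (auto simp: T_def)
    then have "insert a (insert b S) \<inter> M i \<subseteq> insert a (S \<inter> M i) \<or> insert a (insert b S) \<inter> M i \<subseteq> insert b (S \<inter> M i)"
      by blast
    then obtain c where "insert a (insert b S) \<inter> M i \<subseteq> insert c (S \<inter> M i)" by blast
    then have "card (insert a (insert b S) \<inter> M i) \<le> card (insert c (S \<inter> M i))"
      using fS by (intro card_mono) auto
    also have "\<dots> \<le> Suc (card (S \<inter> M i))" using fS by (simp add: card_insert_if)
    also have "\<dots> \<le> Suc j" using assms(3) i by simp
    finally show "card (insert a (insert b S) \<inter> M i) \<le> Suc j" .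
  qed
qed

text \<open>All index sets outside \<open>S\<close> have at least two elements. If those of size two
  share an index \<open>k\<close>, elements outside \<open>M k\<close> lie in three sets; this gives
  at least \<open>3 (7m - 2j) - 3m\<close> incidences outside \<open>S\<close>, but only
  \<open>15m - 3j\<close> are left. Otherwise three index sets form a triangle
  \<open>{x, y}\<close>, \<open>{y, z}\<close>, \<open>{x, z}\<close>, and each index set contains
  two of \<open>x\<close>, \<open>y\<close>, \<open>z\<close>; three sets of size \<open>3m\<close>
  cannot cover more than \<open>5m\<close> elements twice.\<close>

private lemma no_disjoint_pair:
  assumes S: "S \<subseteq> U" "card S = 2 * j" "j < m" "3 * j \<le> (\<Sum>u\<in>S. card (T u))"
    and int: "\<And>a b. a \<in> U - S \<Longrightarrow> b \<in> U - S \<Longrightarrow> a \<noteq> b \<Longrightarrow> T a \<inter> T b \<noteq> {}"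
  shows False
proof -
  let ?R = "U - S"
  have fS: "finite S" using S finU finite_subset by blast
  have cR: "card ?R = 7 * m - 2 * j" using card_Diff_subset[OF fS S(1)] S cU by simp
  have c2: "2 \<le> card (T a)" if "a \<in> ?R" for a
    using pairwise_intersecting_card[OF _ _ int that] cR S(3) by auto
  have "\<exists>k\<in>I. \<forall>u\<in>?R. card (T u) = 2 \<longrightarrow> u \<in> M k"
  proof (rule ccontr)
    assume "\<not> ?thesis"
    then have ex: "\<exists>u\<in>?R. card (T u) = 2 \<and> k \<notin> T u" if "k \<in> I" for k
      using that by (auto simp: T_def)
    obtain k0 where "k0 \<in> I" using cI by fastforce
    then obtain a where a: "a \<in> ?R" "card (T a) = 2" using ex by blast
    then obtain x y where xy: "T a = {x, y}" "x \<noteq> y" by (auto simp: card_2_iff)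
    have xyI: "x \<in> I" "y \<in> I" using xy by (auto simp: T_def)
    obtain b where b: "b \<in> ?R" "card (T b) = 2" "x \<notin> T b" using ex[OF xyI(1)] by blast
    obtain d where d: "d \<in> ?R" "card (T d) = 2" "y \<notin> T d" using ex[OF xyI(2)] by blast
    have "a \<noteq> b" "a \<noteq> d" using b d xy by auto
    then have yb: "y \<in> T b" and xd: "x \<in> T d"
      using int[OF a(1) b(1)] int[OF a(1) d(1)] b d xy by auto
    obtain p q where "T b = {p, q}" "p \<noteq> q" using b(2) by (auto simp: card_2_iff)
    then obtain z where z: "T b = {y, z}" "z \<noteq> y" using yb by (cases "y = p") auto
    have "b \<noteq> d" using yb d by auto
    then have zd: "z \<in> T d" using int[OF b(1) d(1)] z d by auto
    have "x \<noteq> z" using z b by auto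
    then have Td: "T d = {x, z}"
      using card_subset_eq[OF finT, of "{x, z}" d] xd zd d(2) by auto
    have zI: "z \<in> I" using z by (auto simp: T_def)
    have two: "2 \<le> card (T u \<inter> {x, y, z})" if u: "u \<in> ?R" for u
    proof -
      have "T u \<inter> T w \<noteq> {}" if w: "w \<in> {a, b, d}" for w
      proof (cases "u = w")
        case True
        then show ?thesis using w xy(1) z(1) Td by auto
      next
        case False
        then show ?thesis using int[of u w] u w a(1) b(1) d(1) by blast
      qed
      from this[of a] this[of b] this[of d]
      have "x \<in> T u \<or> y \<in> T u" "y \<in> T u \<or> z \<in> T u" "x \<in> T u \<or> z \<in> T u"
        unfolding xy(1) z(1) Td by auto
      then have "{x, y} \<subseteq> T u \<inter> {x, y, z} \<or> {y, z} \<subseteq> T u \<inter> {x, y, z} \<or> {x, z} \<subseteq> T u \<inter> {x, y, z}"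
        by simp blast
      then obtain p q where "p \<noteq> q" "{p, q} \<subseteq> T u \<inter> {x, y, z}"
        using \<open>x \<noteq> z\<close> xy(2) z(2) by metis
      then show ?thesis using card_mono[of "T u \<inter> {x, y, z}" "{p, q}"] by simp
    qed
    have "(\<Sum>u\<in>?R. 2) \<le> (\<Sum>u\<in>?R. card (T u \<inter> {x, y, z}))" using two by (intro sum_mono) auto
    also have "\<dots> = (\<Sum>i\<in>{x, y, z}. card {u\<in>?R. u \<in> M i})"
    proof -
      have "T u \<inter> {x, y, z} = {i \<in> {x, y, z}. u \<in> M i}" for u using xyI zI by (auto simp: T_def)
      then show ?thesis
        using sum_multicount_gen[of ?R "{x, y, z}" "\<lambda>u i. u \<in> M i" "\<lambda>i. card {u\<in>?R. u \<in> M i}"] finU by simp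
    qed
    also have "\<dots> \<le> (\<Sum>i\<in>{x, y, z}. 3 * m)"
    proof (rule sum_mono)
      fix i assume "i \<in> {x, y, z}"
      then have i: "i \<in> I" using xyI zI by auto
      have "card {u\<in>?R. u \<in> M i} \<le> card (M i)"
        using MU[OF i] finU by (intro card_mono) (auto intro: finite_subset)
      then show "card {u\<in>?R. u \<in> M i} \<le> 3 * m" using cM[OF i] by simp
    qed
    also have "\<dots> \<le> 9 * m" by (simp add: card_insert_if)
    finally show False using cR S(3) by simp
  qed
  then obtain k where k: "k \<in> I" "\<And>u. u \<in> ?R \<Longrightarrow> card (T u) = 2 \<Longrightarrow> u \<in> M k" by blast
  have "(\<Sum>u\<in>?R. 2 + (if u \<in> M k then 0 else 1)) \<le> (\<Sum>u\<in>?R. card (T u))"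
  proof (rule sum_mono)
    fix u assume u: "u \<in> ?R"
    show "2 + (if u \<in> M k then 0 else 1) \<le> card (T u)" using c2[OF u] k(2)[OF u] by fastforce
  qed
  moreover have "(\<Sum>u\<in>?R. 2 + (if u \<in> M k then 0 else 1)) = 2 * card ?R + card (?R - M k)"
  proof -
    have "(\<Sum>u\<in>?R. if u \<in> M k then 0 else 1) = card (?R - M k)"
      using finU by (simp add: sum.If_cases Diff_eq)
    then show ?thesis by (simp only: sum.distrib) simp
  qed
  moreover have "card ?R - 3 * m \<le> card (?R - M k)"
    using diff_card_le_card_Diff[of "M k" ?R] MU[OF k(1)] cM[OF k(1)] finU finite_subset by metis
  moreover have "(\<Sum>u\<in>?R. card (T u)) + (\<Sum>u\<in>S. card (T u)) = 15 * m"
    using sum.subset_diff[OF S(1) finU, of "\<lambda>u. card (T u)"] sum_T_U by simp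
  ultimately show False using S(3,4) cR by linarith
qed

text \<open>If one \<open>M i\<close> contains all elements outside \<open>S\<close> that lie in two
  sets, this persists, and a disjoint pair exists because not everything outside \<open>S\<close>
  fits into \<open>M i\<close>. Otherwise a disjoint pair with three incidences is preferred. If
  there is none, some element lies in three sets; so no element lies in no set, and both elements of
  any disjoint pair lie in exactly one set. The set containing \<open>a\<close> then contains all
  elements that lie in two sets.\<close>

private lemma good_step:
  assumes "good j S" "j < m" shows "\<exists>S'. good (Suc j) S'"
proof -
  let ?R = "U - S"
  have S: "S \<subseteq> U" "card S = 2 * j" "\<forall>i\<in>I. card (S \<inter> M i) \<le> j" using assms(1) by (auto simp: good_def)
  have fS: "finite S" using S finU finite_subset by blast
  have cR: "card ?R = 7 * m - 2 * j" using card_Diff_subset[OF fS S(1)] S cU by simp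
  have ext: ?thesis if ab: "a \<in> ?R" "b \<in> ?R" "a \<noteq> b" "T a \<inter> T b = {}"
    and inv: "(3 \<le> card (T a) + card (T b) \<and> 3 * j \<le> (\<Sum>u\<in>S. card (T u))) \<or>
              (\<exists>i\<in>I. \<forall>u\<in>?R. 2 \<le> card (T u) \<longrightarrow> u \<in> M i)" for a b
  proof -
    note e = extend_pair[OF S ab]
    have "good (Suc j) (insert a (insert b S))"
      unfolding good_def using e inv by auto
    then show ?thesis by blast
  qed
  show ?thesis
  proof (cases "\<exists>i\<in>I. \<forall>u\<in>?R. 2 \<le> card (T u) \<longrightarrow> u \<in> M i")
    case True
    then obtain i where i: "i \<in> I" "\<And>u. u \<in> ?R \<Longrightarrow> 2 \<le> card (T u) \<Longrightarrow> u \<in> M i" by blast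
    have "\<exists>a\<in>?R. \<exists>b\<in>?R. a \<noteq> b \<and> T a \<inter> T b = {}"
    proof (rule ccontr)
      assume "\<not> ?thesis"
      then have "T a \<inter> T b \<noteq> {}" if "a \<in> ?R" "b \<in> ?R" "a \<noteq> b" for a b
        using that by blast
      note int = this
      have "5 * m + 2 \<le> card ?R" using cR assms(2) by simp
      then have "2 \<le> card (T a)" if "a \<in> ?R" for a
        by (rule pairwise_intersecting_card[OF Diff_subset _ int that])
      then have "?R \<subseteq> M i" using i by blast
      then have "card ?R \<le> 3 * m" using card_mono[of "M i" ?R] cM[OF i(1)] MU[OF i(1)] finU finite_subset by metis
      then show False using cR assms(2) by simp
    qed
    then show ?thesis using ext True by blast
  next
    case False
    then have inv: "3 * j \<le> (\<Sum>u\<in>S. card (T u))" using assms(1) by (auto simp: good_def)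
    show ?thesis
    proof (cases "\<exists>a\<in>?R. \<exists>b\<in>?R. a \<noteq> b \<and> T a \<inter> T b = {} \<and> 3 \<le> card (T a) + card (T b)")
      case True then show ?thesis using ext inv by blast
    next
      case no3: False
      obtain a b where ab: "a \<in> ?R" "b \<in> ?R" "a \<noteq> b" "T a \<inter> T b = {}"
        using no_disjoint_pair[OF S(1,2) assms(2) inv] by blast
      \<comment> \<open>At least \<open>15m - 5j\<close> incidences lie outside \<open>S\<close>,
        more than twice its \<open>7m - 2j\<close> elements because \<open>j < m\<close>.\<close>
      have "\<exists>u\<in>?R. 3 \<le> card (T u)"
      proof (rule ccontr)
        assume "\<not> ?thesis"
        then have "(\<Sum>u\<in>?R. card (T u)) \<le> (\<Sum>u\<in>?R. 2)" by (intro sum_mono) force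
        moreover have "(\<Sum>u\<in>?R. card (T u)) + (\<Sum>u\<in>S. card (T u)) = 15 * m"
          using sum.subset_diff[OF S(1) finU, of "\<lambda>u. card (T u)"] sum_T_U by simp
        moreover have "(\<Sum>u\<in>S. card (T u)) \<le> (\<Sum>i\<in>I. j)"
          unfolding sum_T[OF S(1)] using S(3) by (intro sum_mono) auto
        ultimately show False using cR cI assms(2) by simp
      qed
      then obtain u where u: "u \<in> ?R" "3 \<le> card (T u)" by blast
      have pos: "card (T z) \<noteq> 0" if "z \<in> ?R" for z
      proof
        assume "card (T z) = 0"
        then have "T z = {}" "z \<noteq> u" using finT u by auto
        then have "T z \<inter> T u = {}" "3 \<le> card (T z) + card (T u)" using u by simp_all
        then show False using no3 that u(1) \<open>z \<noteq> u\<close> by blast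
      qed
      have "card (T a) + card (T b) \<le> 2" using no3 ab by force
      then have "card (T a) = 1" using pos[OF ab(1)] pos[OF ab(2)] by linarith
      then obtain i where i: "T a = {i}" using card_1_singletonE by blast
      have "u \<in> M i" if "u \<in> ?R" "2 \<le> card (T u)" for u
      proof (rule ccontr)
        assume "u \<notin> M i"
        then have "T a \<inter> T u = {}" using i by (auto simp: T_def)
        moreover have "a \<noteq> u" using that \<open>card (T a) = 1\<close> by auto
        ultimately show False using no3 that ab(1) \<open>card (T a) = 1\<close> by force
      qed
      moreover have "i \<in> I" using i by (auto simp: T_def)
      ultimately show ?thesis using ext[OF ab] by blast
    qed
  qed
qed

lemma select_five_exact: "\<exists>S\<subseteq>U. card S = 2 * m \<and> (\<forall>i\<in>I. card (S \<inter> M i) \<le> m)"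
proof -
  have "j \<le> m \<Longrightarrow> \<exists>S. good j S" for j
  proof (induction j)
    case 0
    have "good 0 {}" by (simp add: good_def)
    then show ?case by blast
  next
    case (Suc j)
    then show ?case using good_step[of j] by auto
  qed
  then obtain S where "good m S" by blast
  then show ?thesis by (auto simp: good_def)
qed

end

lemma select_five:
  assumes U: "finite U" "7 * m \<le> card U" and I: "card I = 5"
    and M: "\<And>i. i \<in> I \<Longrightarrow> card (M i \<inter> U) \<le> 3 * m"
  obtains S where "S \<subseteq> U" "card S = 2 * m" "\<And>i. i \<in> I \<Longrightarrow> card (S \<inter> M i) \<le> m"
proof -
  obtain U' where U': "U' \<subseteq> U" "card U' = 7 * m" using U(2) by (meson obtain_subset_with_card_n)
  have fU': "finite U'" using U U' finite_subset by blast
  have "\<exists>M'. M i \<inter> U' \<subseteq> M' \<and> M' \<subseteq> U' \<and> card M' = 3 * m" if "i \<in> I" for i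
  proof -
    have "card (M i \<inter> U') \<le> card (M i \<inter> U)" using U U' by (intro card_mono) auto
    then have le: "card (M i \<inter> U') \<le> 3 * m" "3 * m \<le> card U'" using M[OF that] U' by simp_all
    obtain M' where "M i \<inter> U' \<subseteq> M'" "M' \<subseteq> U'" "card M' = 3 * m"
      by (rule superset_of_card[OF fU' le])
    then show ?thesis by blast
  qed
  then obtain M' where M': "\<And>i. i \<in> I \<Longrightarrow> M i \<inter> U' \<subseteq> M' i \<and> M' i \<subseteq> U' \<and> card (M' i) = 3 * m" by metis
  obtain S where S: "S \<subseteq> U'" "card S = 2 * m" "\<forall>i\<in>I. card (S \<inter> M' i) \<le> m"
    using select_five_exact[OF fU' U'(2) I, of M'] M' by auto
  have fS: "finite S" using S fU' finite_subset by blast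
  have "card (S \<inter> M i) \<le> m" if i: "i \<in> I" for i
  proof -
    have "S \<inter> M i \<subseteq> S \<inter> M' i" using M'[OF i] S(1) by blast
    then have "card (S \<inter> M i) \<le> card (S \<inter> M' i)" using fS by (intro card_mono) auto
    then show ?thesis using S(3) i by fastforce
  qed
  then show ?thesis using that[of S] S U' by blast
qed

text \<open>In the application, \<open>I\<close> consists of colours offered by the neighbours of a
  vertex with list \<open>Y\<close>, the \<open>P u\<close> are the lists of the neighbours, and
  \<open>r\<close> is adjacency. Take a representative \<open>f a\<close> for every \<open>a\<close>
  that is hit, \<open>m\<close> further elements \<open>D\<close>, and add to \<open>D\<close> the
  representatives of what \<open>D\<close> hits. An added \<open>f a\<close> in \<open>P u\<close>
  is charged to an element \<open>s a\<close> of \<open>D\<close> with the same neighbour, which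
  must lie outside \<open>P u\<close>. So \<open>P u\<close> receives at most
  \<open>card D = m\<close> elements.\<close>

lemma redundant_subset:
  assumes fin: "finite I" "finite Y"
    and fn: "\<And>a a' b. a \<in> Y \<Longrightarrow> a' \<in> Y \<Longrightarrow> b \<in> I \<Longrightarrow> r a b \<Longrightarrow> r a' b \<Longrightarrow> a = a'"
    and inj: "\<And>u a b b'. u \<in> K \<Longrightarrow> a \<in> Y \<Longrightarrow> b \<in> I \<inter> P u \<Longrightarrow> b' \<in> I \<inter> P u \<Longrightarrow> r a b \<Longrightarrow> r a b' \<Longrightarrow> b = b'"
    and le: "card {a\<in>Y. \<exists>b\<in>I. r a b} + m \<le> card I"
  obtains O' where "O' \<subseteq> I" "card {a\<in>Y. \<exists>b\<in>O'. r a b} + m \<le> card O'" "\<And>u. u \<in> K \<Longrightarrow> card (O' \<inter> P u) \<le> m"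
proof -
  let ?n = "{a\<in>Y. \<exists>b\<in>I. r a b}"
  define f where "f a = (SOME b. b \<in> I \<and> r a b)" for a
  have f: "f a \<in> I \<and> r a (f a)" if "a \<in> ?n" for a
    unfolding f_def by (rule someI_ex) (use that in blast)
  have fY: "finite ?n" using fin by simp
  have injf: "inj_on f ?n"
  proof (rule inj_onI)
    fix a a' assume "a \<in> ?n" "a' \<in> ?n" "f a = f a'"
    then show "a = a'" using fn[of a a' "f a"] f[of a] f[of a'] by auto
  qed
  have "m \<le> card (I - f ` ?n)"
  proof -
    have "card (I - f ` ?n) = card I - card (f ` ?n)"
      using f fY by (intro card_Diff_subset) auto
    then show ?thesis using le card_image[OF injf] by simp
  qed
  then obtain D where D: "D \<subseteq> I - f ` ?n" "card D = m" by (meson obtain_subset_with_card_n)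
  have fD: "finite D" using D fin finite_subset by blast
  let ?Q = "{a\<in>Y. \<exists>b\<in>D. r a b}"
  have Qn: "?Q \<subseteq> ?n" using D by blast
  have fQ: "finite ?Q" using fin by simp
  define s where "s a = (SOME b. b \<in> D \<and> r a b)" for a
  have s: "s a \<in> D \<and> r a (s a)" if "a \<in> ?Q" for a
    unfolding s_def by (rule someI_ex) (use that in blast)
  have injs: "inj_on s ?Q"
  proof (rule inj_onI)
    fix a a' assume "a \<in> ?Q" "a' \<in> ?Q" "s a = s a'"
    then show "a = a'" using fn[of a a' "s a"] s[of a] s[of a'] D by auto
  qed
  define O' where "O' = D \<union> f ` ?Q"
  have OI: "O' \<subseteq> I" unfolding O'_def using D f Qn by blast
  have cO: "card O' = m + card ?Q"
  proof -
    have "card O' = card D + card (f ` ?Q)"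
      unfolding O'_def
    proof (rule card_Un_disjoint)
      show "D \<inter> f ` ?Q = {}" using D image_mono[OF Qn, of f] by blast
    qed (use fD fQ in auto)
    then show ?thesis using D card_image[OF inj_on_subset[OF injf Qn]] by simp
  qed
  have "{a\<in>Y. \<exists>b\<in>O'. r a b} \<subseteq> ?Q"
  proof
    fix a assume "a \<in> {a\<in>Y. \<exists>b\<in>O'. r a b}"
    then obtain b where b: "a \<in> Y" "b \<in> O'" "r a b" by blast
    show "a \<in> ?Q"
    proof (cases "b \<in> D")
      case False
      then obtain a' where a': "a' \<in> ?Q" "b = f a'" using b by (auto simp: O'_def)
      then have "a = a'" using fn[of a a' b] b f[of a'] Qn OI by blast
      then show ?thesis using a' by simp
    qed (use b in blast)
  qed
  then have "card {a\<in>Y. \<exists>b\<in>O'. r a b} \<le> card ?Q" using fQ by (intro card_mono)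
  then have 1: "card {a\<in>Y. \<exists>b\<in>O'. r a b} + m \<le> card O'" using cO by simp
  have 2: "card (O' \<inter> P u) \<le> m" if u: "u \<in> K" for u
  proof -
    let ?Qu = "{a\<in>?Q. f a \<in> P u}"
    have "s a \<in> D - P u" if a: "a \<in> ?Qu" for a
    proof
      show "s a \<in> D" using s a by blast
      show "s a \<notin> P u"
      proof
        assume "s a \<in> P u"
        have aQ: "a \<in> ?Q" and an: "a \<in> ?n" and aY: "a \<in> Y" and fP: "f a \<in> P u" using a Qn by blast+
        have "s a \<in> I - f ` ?n" using s[OF aQ] D by (meson subsetD)
        then have sD: "s a \<in> I" "s a \<notin> f ` ?n" by simp_all
        have "f a \<in> I \<inter> P u" "s a \<in> I \<inter> P u" using f[OF an] fP sD(1) \<open>s a \<in> P u\<close> by simp_all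
        then have "f a = s a"
          by (rule inj[OF u aY]) (simp_all only: f[OF an] s[OF aQ])
        moreover have "f a \<in> f ` ?n" by (rule imageI[OF an])
        ultimately show False using sD(2) by (simp only:)
      qed
    qed
    then have "s ` ?Qu \<subseteq> D - P u" by blast
    then have "card (s ` ?Qu) \<le> card (D - P u)" using fD by (intro card_mono) auto
    moreover have "card (s ` ?Qu) = card ?Qu"
      by (rule card_image[OF inj_on_subset[OF injs Collect_subset]])
    moreover have "card (O' \<inter> P u) \<le> card (D \<inter> P u) + card ?Qu"
    proof -
      have fQu: "finite ?Qu" by (rule finite_subset[OF Collect_subset fQ])
      have "O' \<inter> P u \<subseteq> (D \<inter> P u) \<union> f ` ?Qu" unfolding O'_def by blast
      then have "card (O' \<inter> P u) \<le> card ((D \<inter> P u) \<union> f ` ?Qu)"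
        by (rule card_mono[rotated]) (use fD fQu in simp)
      also have "\<dots> \<le> card (D \<inter> P u) + card (f ` ?Qu)" by (rule card_Un_le)
      also have "\<dots> \<le> card (D \<inter> P u) + card ?Qu" using card_image_le[OF fQu] by simp
      finally show ?thesis .
    qed
    moreover have "card D = card (D - P u) + card (D \<inter> P u)"
      using card_Diff_subset_Int[of D "P u"] card_mono[OF fD, of "D \<inter> P u"] fD by simp
    ultimately show ?thesis using D by linarith
  qed
  show ?thesis using that[OF OI 1 2] .
qed

section \<open>Partial colourings of a cover\<close>

definition nbrs :: "'a sgraph \<Rightarrow> 'a set \<Rightarrow> 'a \<Rightarrow> 'a set" where
  "nbrs G W u = {v \<in> W. {u, v} \<in> edges G}"

lemma nbrs_sym: "u \<in> W \<Longrightarrow> v \<in> nbrs G W u \<Longrightarrow> u \<in> nbrs G W v"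
  by (simp add: nbrs_def insert_commute)

locale dp_cover =
  fixes G :: "'a sgraph" and L :: "'a \<Rightarrow> 'b set" and H :: "'b sgraph" and m :: nat
  assumes simple: "simple_graph G" and fcov: "f_cover G (\<lambda>_. 7 * m) L H"
begin

abbreviation N where "N \<equiv> nbrs G"

definition nb :: "'a \<Rightarrow> 'b set \<Rightarrow> 'b set" where
  "nb u B = {a \<in> L u. \<exists>b\<in>B. {a, b} \<in> edges H}"

lemma covG: "cover G L H" using fcov by (simp add: f_cover_def)

lemma finV: "finite (verts G)" using simple by (simp add: simple_graph_def)

lemma no_loop: "{u, u} \<notin> edges G"
  using simple by (auto simp: simple_graph_def)

lemma edge_verts: "{u, v} \<in> edges G \<Longrightarrow> u \<in> verts G \<and> v \<in> verts G"
  using simple by (auto simp: simple_graph_def)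

lemma finL: "u \<in> verts G \<Longrightarrow> finite (L u)"
proof -
  assume u: "u \<in> verts G"
  have "finite (verts H)" "(\<Union>u\<in>verts G. L u) = verts H"
    using covG by (auto simp: cover_def simple_graph_def)
  then show ?thesis using u finite_subset[of "L u" "verts H"] by blast
qed

lemma cardL: "u \<in> verts G \<Longrightarrow> card (L u) = 7 * m"
  using fcov by (simp add: f_cover_def)

lemma L_disjoint: "u \<in> verts G \<Longrightarrow> v \<in> verts G \<Longrightarrow> u \<noteq> v \<Longrightarrow> L u \<inter> L v = {}"
  using covG by (auto simp: cover_def disjoint_family_on_def)

lemma match_unique:
  assumes uv: "{u, v} \<in> edges G" and a: "a \<in> L u" and b: "b \<in> L v" "b' \<in> L v"
    and e: "{a, b} \<in> edges H" "{a, b'} \<in> edges H"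
  shows "b = b'"
proof (rule ccontr)
  assume ne: "b \<noteq> b'"
  have mt: "matching (edges_between H (L u) (L v))"
  proof -
    have "\<forall>u\<in>verts G. \<forall>v\<in>verts G. {u, v} \<in> edges G \<longrightarrow> matching (edges_between H (L u) (L v))"
      using covG unfolding cover_def by (elim conjE)
    then show ?thesis using uv edge_verts[OF uv] by simp
  qed
  have in_btw: "{a, c} \<in> edges_between H (L u) (L v)" if "c \<in> L v" "{a, c} \<in> edges H" for c
    using a that by (auto simp: edges_between_def)
  have "{a, b} \<noteq> {a, b'}" using ne by (auto simp: doubleton_eq_iff)
  then have "{a, b} \<inter> {a, b'} = {}"
    using mt[unfolded matching_def, rule_format, OF in_btw[OF b(1) e(1)] in_btw[OF b(2) e(2)]] by blast
  then show False by simp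
qed

lemma nb_sub: "nb u B \<subseteq> L u" by (auto simp: nb_def)

lemma nb_mono: "B \<subseteq> B' \<Longrightarrow> nb u B \<subseteq> nb u B'" by (auto simp: nb_def)

lemma nb_Un: "nb u (B \<union> B') = nb u B \<union> nb u B'" by (auto simp: nb_def)

lemma nb_empty [simp]: "nb u {} = {}" by (simp add: nb_def)

lemma nb_disjoint_sym:
  assumes "A \<subseteq> L u" "B \<subseteq> L v" "nb v A \<inter> B = {}" shows "nb u B \<inter> A = {}"
proof (rule equals0I)
  fix a assume "a \<in> nb u B \<inter> A"
  then obtain b where b: "a \<in> A" "b \<in> B" "{a, b} \<in> edges H" by (auto simp: nb_def)
  then have "{b, a} \<in> edges H" by (simp add: insert_commute)
  then have "b \<in> nb v A" using b assms(2) by (auto simp: nb_def)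
  then show False using assms(3) b(2) by blast
qed

lemma card_nb_UN:
  assumes x: "x \<in> verts G" and U: "\<And>u. u \<in> U \<Longrightarrow> {x, u} \<in> edges G" and B: "B \<subseteq> (\<Union>u\<in>U. L u)" "finite B"
  shows "card (nb x B) \<le> card B"
proof -
  have one: "card (nb x {b}) \<le> 1" if "b \<in> B" for b
  proof -
    have "b \<in> (\<Union>u\<in>U. L u)" using B(1) that by (rule subsetD)
    then obtain u where u: "u \<in> U" "b \<in> L u" by blast
    have ux: "{u, x} \<in> edges G" using U[OF u(1)] by (simp add: insert_commute)
    have "a = a'" if "a \<in> nb x {b}" "a' \<in> nb x {b}" for a a'
      using match_unique[OF ux u(2), of a a'] that by (auto simp: nb_def insert_commute)
    then have "is_singleton (nb x {b}) \<or> nb x {b} = {}" by (metis is_singletonI')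
    then show ?thesis by (auto simp: is_singleton_def)
  qed
  have "nb x B = (\<Union>b\<in>B. nb x {b})" by (auto simp: nb_def)
  then have "card (nb x B) \<le> (\<Sum>b\<in>B. card (nb x {b}))" using card_UN_le[OF B(2)] by simp
  also have "\<dots> \<le> (\<Sum>b\<in>B. 1)" using one by (intro sum_mono)
  finally show ?thesis by simp
qed

lemma card_nb:
  assumes "{u, v} \<in> edges G" "B \<subseteq> L v" shows "card (nb u B) \<le> card B"
  using card_nb_UN[of u "{v}" B] assms edge_verts[OF assms(1)] finL finite_subset by auto

text \<open>Uncoloured vertices carry the empty set and colour sets may be smaller than
  \<open>2m\<close>, so a colouring can be grown gradually.\<close>

definition pcol :: "'a set \<Rightarrow> ('a \<Rightarrow> 'b set) \<Rightarrow> bool" where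
  "pcol W \<psi> \<longleftrightarrow> (\<forall>u\<in>W. \<psi> u \<subseteq> L u \<and> card (\<psi> u) \<le> 2 * m) \<and>
     (\<forall>u\<in>W. \<forall>v\<in>N W u. nb u (\<psi> v) \<inter> \<psi> u = {})"

definition avail :: "'a set \<Rightarrow> ('a \<Rightarrow> 'b set) \<Rightarrow> 'a \<Rightarrow> 'b set" where
  "avail W \<psi> u = L u - (\<Union>v\<in>N W u. nb u (\<psi> v))"

definition col :: "'a set \<Rightarrow> ('a \<Rightarrow> 'b set) \<Rightarrow> bool" where
  "col W \<psi> \<longleftrightarrow> pcol W \<psi> \<and> (\<forall>u\<in>W. card (\<psi> u) = 2 * m)"

lemma pcolD:
  assumes "pcol W \<psi>" "u \<in> W" shows "\<psi> u \<subseteq> L u" "card (\<psi> u) \<le> 2 * m" "\<psi> u \<subseteq> avail W \<psi> u"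
  using assms unfolding pcol_def avail_def by blast+

lemma avail_sub: "avail W \<psi> u \<subseteq> L u" by (auto simp: avail_def)

lemma avail_cong: "(\<And>v. v \<in> N W u \<Longrightarrow> \<psi> v = \<psi>' v) \<Longrightarrow> avail W \<psi> u = avail W \<psi>' u"
  by (simp add: avail_def)

lemma finN: "W \<subseteq> verts G \<Longrightarrow> finite (N W u)"
  using finV finite_subset[of W "verts G"] by (simp add: nbrs_def)

lemma N_sub: "N W u \<subseteq> W" by (auto simp: nbrs_def)

lemma N_irrefl: "u \<notin> N W u" using no_loop by (simp add: nbrs_def)

lemma card_avail:
  assumes W: "W \<subseteq> verts G" and p: "pcol W \<psi>" and u: "u \<in> W"
    and Z: "Z \<subseteq> N W u" "\<And>v. v \<in> N W u - Z \<Longrightarrow> \<psi> v = {}"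
  shows "7 * m \<le> card (avail W \<psi> u) + 2 * m * card Z"
proof -
  have fZ: "finite Z" using finN[OF W] Z(1) finite_subset by blast
  have av: "avail W \<psi> u = L u - (\<Union>v\<in>Z. nb u (\<psi> v))"
  proof -
    have "(\<Union>v\<in>N W u. nb u (\<psi> v)) = (\<Union>v\<in>Z. nb u (\<psi> v))"
    proof (intro equalityI subsetI)
      fix a assume "a \<in> (\<Union>v\<in>N W u. nb u (\<psi> v))"
      then obtain v where v: "v \<in> N W u" "a \<in> nb u (\<psi> v)" by blast
      then have "v \<in> Z" using Z(2)[of v] by (cases "v \<in> Z") auto
      then show "a \<in> (\<Union>v\<in>Z. nb u (\<psi> v))" using v by blast
    qed (use Z(1) in blast)
    then show ?thesis by (simp add: avail_def)
  qed
  have "card (\<Union>v\<in>Z. nb u (\<psi> v)) \<le> (\<Sum>v\<in>Z. card (nb u (\<psi> v)))" by (rule card_UN_le[OF fZ])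
  also have "\<dots> \<le> (\<Sum>v\<in>Z. 2 * m)"
  proof (rule sum_mono)
    fix v assume "v \<in> Z"
    then have v: "v \<in> W" "{u, v} \<in> edges G" using Z(1) by (auto simp: nbrs_def)
    show "card (nb u (\<psi> v)) \<le> 2 * m"
      using card_nb[OF v(2) pcolD(1)[OF p v(1)]] pcolD(2)[OF p v(1)] by linarith
  qed
  finally have "card (\<Union>v\<in>Z. nb u (\<psi> v)) \<le> 2 * m * card Z" by (simp add: mult.commute)
  moreover have fin: "finite (\<Union>v\<in>Z. nb u (\<psi> v))"
    using fZ finL u W nb_sub finite_subset by (meson finite_UN_I subsetD)
  have "card (L u) \<le> card (avail W \<psi> u) + card (\<Union>v\<in>Z. nb u (\<psi> v))"
    unfolding av using diff_card_le_card_Diff[OF fin, of "L u"] by linarith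
  moreover have "u \<in> verts G" using u W by blast
  ultimately show ?thesis using cardL[of u] by linarith
qed

lemma finavail: "u \<in> verts G \<Longrightarrow> finite (avail W \<psi> u)"
  by (rule finite_subset[OF avail_sub finL])

text \<open>Conflicts are symmetric, so an edge with one end in \<open>X\<close> is checked at that
  end only.\<close>

lemma pcol_update:
  assumes W: "W \<subseteq> verts G" and p: "pcol W \<psi>"
    and X: "\<And>x. x \<in> X \<Longrightarrow> x \<in> W \<Longrightarrow> C x \<subseteq> L x \<and> card (C x) \<le> 2 * m \<and>
      (\<forall>v\<in>N W x - X. nb x (\<psi> v) \<inter> C x = {}) \<and> (\<forall>v\<in>N W x \<inter> X. nb x (C v) \<inter> C x = {})"
  shows "pcol W (\<lambda>u. if u \<in> X then C u else \<psi> u)"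
  unfolding pcol_def
proof (intro conjI ballI)
  let ?f = "\<lambda>u. if u \<in> X then C u else \<psi> u"
  fix u assume u: "u \<in> W"
  show "?f u \<subseteq> L u" "card (?f u) \<le> 2 * m" using X[OF _ u] pcolD[OF p u] by auto
  fix v assume v: "v \<in> N W u"
  then have vW: "v \<in> W" and uv: "u \<in> N W v" using nbrs_sym[OF u v] N_sub by auto
  consider "u \<in> X" "v \<in> X" | "u \<in> X" "v \<notin> X" | "u \<notin> X" "v \<in> X" | "u \<notin> X" "v \<notin> X" by blast
  then show "nb u (?f v) \<inter> ?f u = {}"
  proof cases
    case 1
    then show ?thesis using X[OF 1(1) u] v by simp
  next
    case 2
    then show ?thesis using X[OF 2(1) u] v by simp
  next
    case 3
    then have "nb v (\<psi> u) \<inter> C v = {}" using X[OF 3(2) vW] uv by simp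
    moreover have "C v \<subseteq> L v" using X[OF 3(2) vW] by simp
    ultimately have "nb u (C v) \<inter> \<psi> u = {}"
      using nb_disjoint_sym[OF pcolD(1)[OF p u], of "C v" v] by simp
    then show ?thesis using 3 by simp
  next
    case 4
    then show ?thesis using p u v by (simp add: pcol_def)
  qed
qed

lemma pcol_update1:
  assumes W: "W \<subseteq> verts G" and p: "pcol W \<psi>" and x: "x \<in> W"
    and C: "C \<subseteq> avail W \<psi> x" "card C \<le> 2 * m"
  shows "pcol W (\<psi>(x := C))"
proof -
  have "pcol W (\<lambda>u. if u \<in> {x} then (\<lambda>_. C) u else \<psi> u)"
    by (rule pcol_update[OF W p]) (use C N_irrefl avail_sub in \<open>auto simp: avail_def\<close>)
  moreover have "\<psi>(x := C) = (\<lambda>u. if u \<in> {x} then (\<lambda>_. C) u else \<psi> u)" by auto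
  ultimately show ?thesis by simp
qed

lemma restrict_pcol:
  assumes W: "W \<subseteq> verts G" and c: "col (W - X) \<phi>"
  shows "pcol W (\<lambda>u. if u \<in> W - X then \<phi> u else {})"
  unfolding pcol_def
proof (intro conjI ballI)
  fix u assume u: "u \<in> W"
  have p: "pcol (W - X) \<phi>" using c by (simp add: col_def)
  show "(if u \<in> W - X then \<phi> u else {}) \<subseteq> L u" "card (if u \<in> W - X then \<phi> u else {}) \<le> 2 * m"
    using pcolD[OF p, of u] by auto
  fix v assume v: "v \<in> N W u"
  show "nb u (if v \<in> W - X then \<phi> v else {}) \<inter> (if u \<in> W - X then \<phi> u else {}) = {}"
  proof (cases "u \<in> W - X \<and> v \<in> W - X")
    case True
    then have "v \<in> N (W - X) u" using v by (simp add: nbrs_def)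
    then show ?thesis using p True unfolding pcol_def by simp
  next
    case False then show ?thesis by auto
  qed
qed

text \<open>The neighbourhood condition of a cover places every cross-edge over an edge of
  \<open>G\<close>, where \<open>pcol\<close> excludes it.\<close>

lemma cover_coloring_of_col:
  assumes "col (verts G) \<phi>"
  shows "\<exists>S. cover_coloring G L H (\<lambda>_. 2 * m) S"
proof -
  let ?S = "\<Union>u\<in>verts G. \<phi> u"
  have p: "pcol (verts G) \<phi>" using assms by (simp add: col_def)
  have int: "?S \<inter> L v = \<phi> v" if v: "v \<in> verts G" for v
  proof (intro equalityI subsetI)
    fix a assume "a \<in> ?S \<inter> L v"
    then obtain u where u: "u \<in> verts G" "a \<in> \<phi> u" "a \<in> L v" by blast
    then have "a \<in> L u" using pcolD(1)[OF p u(1)] by blast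
    then have "u = v" using L_disjoint[OF u(1) v] u(3) by blast
    then show "a \<in> \<phi> v" using u by simp
  qed (use pcolD(1)[OF p v] v in blast)
  have sub: "?S \<subseteq> verts H"
  proof -
    have "(\<Union>u\<in>verts G. L u) = verts H" using covG by (simp add: cover_def)
    then show ?thesis using pcolD(1)[OF p] by blast
  qed
  have "edges (induced_subgraph H ?S) \<inter> cross_edges G L H = {}"
  proof (rule equals0I)
    fix e assume e: "e \<in> edges (induced_subgraph H ?S) \<inter> cross_edges G L H"
    then obtain u v where uv: "u \<in> verts G" "v \<in> verts G" "u \<noteq> v" "e \<in> edges_between H (L u) (L v)"
      by (auto simp: cross_edges_def)
    then obtain x y where xy: "x \<in> L u" "y \<in> L v" "e = {x, y}" "e \<in> edges H"
      by (auto simp: edges_between_def)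
    have "e \<subseteq> ?S" using e by (simp add: induced_subgraph_def)
    then have xs: "x \<in> \<phi> u" "y \<in> \<phi> v" using int[OF uv(1)] int[OF uv(2)] xy by blast+
    have "y \<in> verts H" using sub xs(2) uv(2) by blast
    then have "y \<in> L v \<inter> nbhd H (L u)" using xy by (auto simp: nbhd_def)
    moreover have "\<forall>u\<in>verts G. \<forall>v\<in>verts G. L v \<inter> nbhd H (L u) \<noteq> {} \<longrightarrow> v \<in> closed_nbhd G u"
      using covG unfolding cover_def by (elim conjE)
    ultimately have "v \<in> closed_nbhd G u" using uv(1,2) by blast
    then have "{u, v} \<in> edges G" using uv(3) by (auto simp: closed_nbhd_def nbhd_def)
    then have "nb u (\<phi> v) \<inter> \<phi> u = {}" using p uv(1,2) by (auto simp: pcol_def nbrs_def)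
    moreover have "x \<in> nb u (\<phi> v)" using xs xy by (auto simp: nb_def)
    ultimately show False using xs by blast
  qed
  then have "quasi_independent G L H ?S" using sub by (simp add: quasi_independent_def)
  moreover have "card (?S \<inter> L v) = 2 * m" if "v \<in> verts G" for v
    unfolding int[OF that] using assms that by (simp add: col_def)
  ultimately show ?thesis unfolding cover_coloring_def by blast
qed

end

section \<open>Extending a colouring to a vertex, a star or a pair\<close>

context dp_cover begin

lemma extend_low_degree:
  assumes W: "W \<subseteq> verts G" and v: "v \<in> W" "card (N W v) \<le> 2" and c: "col (W - {v}) \<phi>"
  shows "\<exists>\<psi>. col W \<psi>"
proof -
  define \<psi>0 where "\<psi>0 u = (if u \<in> W - {v} then \<phi> u else {})" for u
  have p: "pcol W \<psi>0" unfolding \<psi>0_def by (rule restrict_pcol[OF W c])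
  have "7 * m \<le> card (avail W \<psi>0 v) + 2 * m * card (N W v)"
    by (rule card_avail[OF W p v(1) order_refl]) simp
  moreover have "2 * m * card (N W v) \<le> 2 * m * 2" using v(2) by (intro mult_left_mono) auto
  ultimately have "2 * m \<le> card (avail W \<psi>0 v)" by linarith
  then obtain C where C: "C \<subseteq> avail W \<psi>0 v" "card C = 2 * m" by (meson obtain_subset_with_card_n)
  have "pcol W (\<psi>0(v := C))" using pcol_update1[OF W p v(1) C(1)] C(2) by simp
  moreover have "card ((\<psi>0(v := C)) u) = 2 * m" if "u \<in> W" for u
    using that C c by (auto simp: \<psi>0_def col_def)
  ultimately show ?thesis unfolding col_def by blast
qed

text \<open>Only elements of \<open>S\<close> joined to \<open>A\<close> can block elements of
  \<open>A\<close>. A bound on \<open>S \<inter> nb v A\<close>, controlled at \<open>v\<close>,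
  thus bounds the loss in \<open>A\<close> at \<open>x\<close>.\<close>

lemma nb_transfer:
  assumes "S \<subseteq> L v" "A \<subseteq> L x"
  shows "nb x S \<inter> A \<subseteq> nb x (S \<inter> nb v A)"
proof
  fix a assume "a \<in> nb x S \<inter> A"
  then obtain s where s: "a \<in> A" "a \<in> L x" "s \<in> S" "{a, s} \<in> edges H" by (auto simp: nb_def)
  then have "{s, a} \<in> edges H" by (simp add: insert_commute)
  then have "s \<in> nb v A" using s assms by (auto simp: nb_def)
  then show "a \<in> nb x (S \<inter> nb v A)" using s by (auto simp: nb_def)
qed

text \<open>A vertex \<open>x\<close> of \<open>K\<close> has two coloured neighbours, so
  \<open>3m\<close> colours \<open>B x\<close> are free. If at most \<open>m\<close> elements of the
  set chosen at \<open>v\<close> are joined to \<open>B x\<close>, then \<open>2m\<close> colours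
  survive at \<open>x\<close>. The hypothesis \<open>sel\<close> makes the argument uniform in the
  size of the star; at least \<open>q\<close> colours are left at \<open>v\<close> by its neighbours
  outside \<open>K\<close>.\<close>

lemma extend_star:
  assumes W: "W \<subseteq> verts G" and v: "v \<in> W" and K: "K \<subseteq> N W v"
    and K3: "\<And>x. x \<in> K \<Longrightarrow> card (N W x) = 3" and Ki: "\<And>x. x \<in> K \<Longrightarrow> N W x \<inter> K = {}"
    and q: "q + 2 * m * card (N W v - K) \<le> 7 * m"
    and sel: "\<And>(U :: 'b set) M. finite U \<Longrightarrow> q \<le> card U \<Longrightarrow> (\<And>x. x \<in> K \<Longrightarrow> card (M x \<inter> U) \<le> 3 * m) \<Longrightarrow>
        \<exists>S\<subseteq>U. card S = 2 * m \<and> (\<forall>x\<in>K. card (S \<inter> M x) \<le> m)"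
    and c: "col (W - insert v K) \<phi>"
  shows "\<exists>\<psi>. col W \<psi>"
proof -
  define \<psi>0 where "\<psi>0 u = (if u \<in> W - insert v K then \<phi> u else {})" for u
  have p: "pcol W \<psi>0" unfolding \<psi>0_def by (rule restrict_pcol[OF W c])
  have KW: "x \<in> W" if "x \<in> K" for x using K N_sub that by blast
  have vx: "{v, x} \<in> edges G" "{x, v} \<in> edges G" if "x \<in> K" for x
    using K that by (auto simp: nbrs_def insert_commute)
  have vV: "v \<in> verts G" using v W by blast
  have vNx: "v \<in> N W x" if "x \<in> K" for x using K that nbrs_sym[OF v] by blast
  have vK: "v \<notin> K" using K N_irrefl by blast
  have fK: "finite K" using K finN[OF W] finite_subset by blast
  have "7 * m \<le> card (avail W \<psi>0 v) + 2 * m * card (N W v - K)"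
    by (rule card_avail[OF W p v]) (auto simp: \<psi>0_def)
  then have Av: "q \<le> card (avail W \<psi>0 v)" using q by linarith
  have "\<exists>B. B \<subseteq> avail W \<psi>0 x \<and> card B = 3 * m" if x: "x \<in> K" for x
  proof -
    have "7 * m \<le> card (avail W \<psi>0 x) + 2 * m * card (N W x - {v})"
      by (rule card_avail[OF W p KW[OF x]]) (auto simp: \<psi>0_def)
    moreover have "card (N W x - {v}) = 2" using K3[OF x] vNx[OF x] by simp
    ultimately have "3 * m \<le> card (avail W \<psi>0 x)" by simp
    then show ?thesis by (meson obtain_subset_with_card_n)
  qed
  then have "\<exists>B. \<forall>x\<in>K. B x \<subseteq> avail W \<psi>0 x \<and> card (B x) = 3 * m" by (intro bchoice) blast
  then obtain B where B: "\<And>x. x \<in> K \<Longrightarrow> B x \<subseteq> avail W \<psi>0 x" "\<And>x. x \<in> K \<Longrightarrow> card (B x) = 3 * m" by blast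
  have BL: "B x \<subseteq> L x" if "x \<in> K" for x using B(1)[OF that] avail_sub by (rule subset_trans)
  have "card (nb v (B x) \<inter> avail W \<psi>0 v) \<le> 3 * m" if x: "x \<in> K" for x
  proof -
    have "card (nb v (B x) \<inter> avail W \<psi>0 v) \<le> card (nb v (B x))"
      by (rule card_mono[OF finite_subset[OF nb_sub finL[OF vV]]]) simp
    also have "\<dots> \<le> card (B x)" by (rule card_nb[OF vx(1)[OF x] BL[OF x]])
    finally show ?thesis using B(2)[OF x] by simp
  qed
  then obtain S where S: "S \<subseteq> avail W \<psi>0 v" "card S = 2 * m" "\<And>x. x \<in> K \<Longrightarrow> card (S \<inter> nb v (B x)) \<le> m"
    using sel[of "avail W \<psi>0 v" "\<lambda>x. nb v (B x)"] finavail[OF vV, of W \<psi>0] Av by blast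
  have SL: "S \<subseteq> L v" using S(1) avail_sub by (rule subset_trans)
  have "\<exists>C. C \<subseteq> B x - nb x S \<and> card C = 2 * m" if x: "x \<in> K" for x
  proof -
    have fB: "finite (B x)" by (rule finite_subset[OF BL[OF x] finL]) (use KW[OF x] W in blast)
    have "card (nb x S \<inter> B x) \<le> card (nb x (S \<inter> nb v (B x)))"
    proof (rule card_mono)
      show "finite (nb x (S \<inter> nb v (B x)))"
        by (rule finite_subset[OF nb_sub finL]) (use KW[OF x] W in blast)
      show "nb x S \<inter> B x \<subseteq> nb x (S \<inter> nb v (B x))" by (rule nb_transfer[OF SL BL[OF x]])
    qed
    also have "\<dots> \<le> card (S \<inter> nb v (B x))"
      by (rule card_nb[OF vx(2)[OF x]]) (use SL in blast)
    finally have "card (nb x S \<inter> B x) \<le> m" using S(3)[OF x] by simp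
    moreover have "card (B x - nb x S) = card (B x) - card (B x \<inter> nb x S)"
      using fB by (intro card_Diff_subset_Int) simp
    ultimately have "2 * m \<le> card (B x - nb x S)" using B(2)[OF x] by (simp add: Int_commute)
    then show ?thesis by (meson obtain_subset_with_card_n)
  qed
  then have "\<exists>C. \<forall>x\<in>K. C x \<subseteq> B x - nb x S \<and> card (C x) = 2 * m" by (intro bchoice) blast
  then obtain C where C: "\<And>x. x \<in> K \<Longrightarrow> C x \<subseteq> B x - nb x S" "\<And>x. x \<in> K \<Longrightarrow> card (C x) = 2 * m" by blast
  define \<psi>1 where "\<psi>1 = \<psi>0(v := S)"
  have p1: "pcol W \<psi>1" unfolding \<psi>1_def using pcol_update1[OF W p v S(1)] S(2) by simp
  define \<psi> where "\<psi> u = (if u \<in> K then C u else \<psi>1 u)" for u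
  have "pcol W \<psi>" unfolding \<psi>_def
  proof (rule pcol_update[OF W p1], intro conjI ballI)
    fix x assume x: "x \<in> K"
    show "C x \<subseteq> L x" "card (C x) \<le> 2 * m" using C[OF x] BL[OF x] by auto
    fix u
    show "nb x (C u) \<inter> C x = {}" if "u \<in> N W x \<inter> K" using that Ki[OF x] by simp
    show "nb x (\<psi>1 u) \<inter> C x = {}" if u: "u \<in> N W x - K"
    proof (cases "u = v")
      case True
      then show ?thesis using C(1)[OF x] by (auto simp: \<psi>1_def)
    next
      case False
      then have "\<psi>1 u = \<psi>0 u" by (simp add: \<psi>1_def)
      moreover have "C x \<subseteq> avail W \<psi>0 x" using C(1)[OF x] B(1)[OF x] by blast
      ultimately show ?thesis using u by (auto simp: avail_def)
    qed
  qed
  moreover have "card (\<psi> u) = 2 * m" if "u \<in> W" for u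
    using that c C(2) S(2) by (auto simp: \<psi>_def \<psi>1_def \<psi>0_def col_def)
  ultimately show ?thesis unfolding col_def by blast
qed

text \<open>The pattern \<open>w, x, y\<close> is a path whose list sizes are \<open>3m, 5m, 3m\<close> once everything else is coloured:
  the colour set of \<open>x\<close> starts with \<open>m\<close> elements of a \<open>2m\<close>-set \<open>C\<close> that does not interfere with \<open>y\<close>, and \<open>w\<close>
  only has to avoid destroying more than half of \<open>C\<close>.\<close>

definition pair_ok :: "'a set \<Rightarrow> ('a \<Rightarrow> 'b set) \<Rightarrow> 'a \<Rightarrow> 'a \<Rightarrow> bool" where
  "pair_ok W \<psi> x y \<longleftrightarrow> (\<exists>A B. A \<subseteq> avail W \<psi> x \<and> B \<subseteq> avail W \<psi> y \<and> card A = 2 * m \<and> card B = 2 * m \<and>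
     nb y A \<inter> B = {})"

lemma pair_ok_sym:
  assumes "pair_ok W \<psi> x y" shows "pair_ok W \<psi> y x"
proof -
  obtain A B where AB: "A \<subseteq> avail W \<psi> x" "B \<subseteq> avail W \<psi> y" "card A = 2 * m" "card B = 2 * m" "nb y A \<inter> B = {}"
    using assms unfolding pair_ok_def by blast
  have "A \<subseteq> L x" "B \<subseteq> L y" by (rule subset_trans[OF AB(1) avail_sub], rule subset_trans[OF AB(2) avail_sub])
  from nb_disjoint_sym[OF this AB(5)] show ?thesis unfolding pair_ok_def using AB by blast
qed

lemma pair_demand:
  assumes W: "W \<subseteq> verts G" and p: "pcol W \<psi>" and xy: "x \<in> W" "y \<in> N W x"
    and w: "w \<in> N W x" "w \<noteq> y" "w \<notin> N W y"
    and deg: "card (N W x) = 3" "card (N W y) = 3" and e: "\<psi> x = {}" "\<psi> y = {}"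
    and T: "T \<subseteq> L w" "3 * m \<le> card T"
  obtains D where "D \<subseteq> T" "card D = m"
    "\<And>S. D \<subseteq> S \<Longrightarrow> S \<subseteq> L w \<Longrightarrow> card S = 2 * m \<Longrightarrow> pair_ok W (\<psi>(w := S)) x y"
proof -
  have yW: "y \<in> W" and wW: "w \<in> W" using xy w by (simp_all add: nbrs_def)
  have xNy: "x \<in> N W y" by (rule nbrs_sym[OF xy])
  have xV: "x \<in> verts G" and yV: "y \<in> verts G" and wV: "w \<in> verts G" using xy(1) yW wW W by (simp_all add: subsetD)
  have ad: "{x, y} \<in> edges G" "{y, x} \<in> edges G" "{x, w} \<in> edges G" "{w, x} \<in> edges G"
    using xy(2) w(1) by (simp_all add: nbrs_def insert_commute)
  \<comment> \<open>The list sizes \<open>5m\<close> and \<open>3m\<close> refer to the state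
    without \<open>w\<close>, whose set is about to be replaced.\<close>
  define \<psi>e where "\<psi>e = \<psi>(w := {})"
  have pe: "pcol W \<psi>e" unfolding \<psi>e_def by (rule pcol_update1[OF W p wW]) simp_all
  let ?A = "avail W \<psi>e x" and ?B = "avail W \<psi>e y"
  have "7 * m \<le> card ?A + 2 * m * card (N W x - {w, y})"
    by (rule card_avail[OF W pe xy(1)]) (use e in \<open>auto simp: \<psi>e_def\<close>)
  moreover have "card (N W x - {w, y}) = 1"
    using card_Diff_subset[of "{w, y}" "N W x"] deg(1) xy(2) w(1,2) by simp
  ultimately have A5: "5 * m \<le> card ?A" by simp
  have "7 * m \<le> card ?B + 2 * m * card (N W y - {x})"
    by (rule card_avail[OF W pe yW]) (use e in \<open>auto simp: \<psi>e_def\<close>)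
  moreover have "card (N W y - {x}) = 2" using deg(2) xNy by simp
  ultimately have "3 * m \<le> card ?B" by simp
  then obtain B' where B': "B' \<subseteq> ?B" "card B' = 3 * m" by (meson obtain_subset_with_card_n)
  have AL: "?A \<subseteq> L x" and BL: "B' \<subseteq> L y" by (rule avail_sub, rule subset_trans[OF B'(1) avail_sub])
  have fA: "finite ?A" by (rule finavail[OF xV])
  have fB: "finite B'" by (rule finite_subset[OF BL finL[OF yV]])
  have fnb: "finite (nb z S)" if "z \<in> verts G" for z S by (rule finite_subset[OF nb_sub finL[OF that]])
  have "card (nb x B') \<le> 3 * m" using card_nb[OF ad(1) BL] B'(2) by simp
  then have "2 * m \<le> card (?A - nb x B')"
    using diff_card_le_card_Diff[OF fnb[OF xV], of ?A B'] A5 by linarith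
  \<comment> \<open>\<open>B'\<close> blocks at most \<open>3m\<close> of the \<open>5m\<close>
    colours of \<open>x\<close>, so \<open>2m\<close> colours do not interfere with it.\<close>
  then obtain C where C: "C \<subseteq> ?A - nb x B'" "card C = 2 * m" by (meson obtain_subset_with_card_n)
  have CL: "C \<subseteq> L x" using C(1) AL by blast
  have fC: "finite C" by (rule finite_subset[OF CL finL[OF xV]])
  have "card (nb w C) \<le> 2 * m" using card_nb[OF ad(4) CL] C(2) by simp
  then have "m \<le> card (T - nb w C)"
    using diff_card_le_card_Diff[OF fnb[OF wV], of T C] T(2) by linarith
  \<comment> \<open>No element of \<open>D\<close> is joined to \<open>C\<close>, so a
    \<open>2m\<close>-set containing \<open>D\<close> blocks at most \<open>m\<close> elements of
    \<open>C\<close>.\<close>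
  then obtain D where D: "D \<subseteq> T - nb w C" "card D = m" by (meson obtain_subset_with_card_n)
  have ok: "pair_ok W (\<psi>(w := S)) x y" if S: "D \<subseteq> S" "S \<subseteq> L w" "card S = 2 * m" for S
  proof -
    have fS: "finite S" by (rule finite_subset[OF S(2) finL[OF wV]])
    have fD: "finite D" by (rule finite_subset[OF S(1) fS])
    have "nb x S \<inter> C \<subseteq> nb x (S \<inter> nb w C)" by (rule nb_transfer[OF S(2) CL])
    also have "\<dots> \<subseteq> nb x (S - D)" using D(1) by (intro nb_mono) blast
    finally have "card (nb x S \<inter> C) \<le> card (nb x (S - D))" by (rule card_mono[OF fnb[OF xV]])
    also have "\<dots> \<le> card (S - D)" by (rule card_nb[OF ad(3)]) (use S(2) in blast)
    also have "\<dots> = m" using card_Diff_subset[OF fD S(1)] S(3) D(2) by simp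
    finally have "m \<le> card (C - nb x S)"
      using card_Diff_subset_Int[of C "nb x S"] fC C(2) by (simp add: Int_commute)
    then obtain A1 where A1: "A1 \<subseteq> C - nb x S" "card A1 = m" by (meson obtain_subset_with_card_n)
    have "card (nb x S) \<le> 2 * m" using card_nb[OF ad(3) S(2)] S(3) by simp
    then have "2 * m \<le> card (?A - nb x S)"
      using diff_card_le_card_Diff[OF fnb[OF xV], of ?A S] A5 by linarith
    moreover have "A1 \<subseteq> ?A - nb x S" using A1(1) C(1) by blast
    \<comment> \<open>The half of \<open>A\<close> inside \<open>C\<close> leaves \<open>B'\<close>
      intact, and the other half blocks at most \<open>m\<close> of its \<open>3m\<close>
      colours.\<close>
    ultimately obtain A where A: "A1 \<subseteq> A" "A \<subseteq> ?A - nb x S" "card A = 2 * m"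
      using exists_subset_between[of A1 "2 * m" "?A - nb x S"] A1(2) fA by auto
    have AxL: "A \<subseteq> L x" using A(2) AL by blast
    have fA': "finite A" by (rule finite_subset[OF AxL finL[OF xV]])
    have "nb y A1 \<inter> B' = {}"
    proof (rule nb_disjoint_sym[OF BL])
      show "A1 \<subseteq> L x" using A(1) AxL by blast
      show "nb x B' \<inter> A1 = {}" using A1(1) C(1) by blast
    qed
    moreover have "nb y A = nb y A1 \<union> nb y (A - A1)" using nb_Un[of y A1 "A - A1"] A(1) by (simp add: Un_absorb1)
    ultimately have "nb y A \<inter> B' \<subseteq> nb y (A - A1)" by blast
    then have "card (nb y A \<inter> B') \<le> card (nb y (A - A1))" by (rule card_mono[OF fnb[OF yV]])
    also have "\<dots> \<le> card (A - A1)" by (rule card_nb[OF ad(2)]) (use AxL in blast)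
    also have "\<dots> = m"
      using card_Diff_subset[OF finite_subset[OF A(1) fA'] A(1)] A(3) A1(2) by simp
    finally have "2 * m \<le> card (B' - nb y A)"
      using card_Diff_subset_Int[of B' "nb y A"] fB B'(2) by (simp add: Int_commute)
    then obtain B where B: "B \<subseteq> B' - nb y A" "card B = 2 * m" by (meson obtain_subset_with_card_n)
    have "A \<subseteq> avail W (\<psi>(w := S)) x"
    proof
      fix a assume a: "a \<in> A"
      then have "a \<in> ?A" "a \<notin> nb x S" using A(2) by blast+
      then show "a \<in> avail W (\<psi>(w := S)) x" unfolding avail_def \<psi>e_def by auto
    qed
    moreover have "avail W (\<psi>(w := S)) y = ?B"
      unfolding \<psi>e_def by (rule avail_cong) (use w(3) in auto)
    ultimately show ?thesis
      unfolding pair_ok_def using A(3) B B'(1) by (intro exI[of _ A] exI[of _ B]) auto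
  qed
  show ?thesis by (rule that[OF _ D(2) ok]) (use D(1) in auto)
qed

end

section \<open>Links between vertices of degree 3\<close>

locale link_structure = dp_cover +
  fixes W X3 X4 :: "'a set" and \<phi> :: "'a \<Rightarrow> 'b set"
  assumes W: "W \<subseteq> verts G"
    and no_triangle: "\<And>x y z. x \<in> W \<Longrightarrow> y \<in> N W x \<Longrightarrow> z \<in> N W x \<Longrightarrow> z \<notin> N W y"
    and X3W: "X3 \<subseteq> W" and X4W: "X4 \<subseteq> W - X3"
    and deg3: "\<And>x. x \<in> X3 \<Longrightarrow> card (N W x) = 3"
    and deg4: "\<And>w. w \<in> X4 \<Longrightarrow> card (N W w) = 4" "\<And>w. w \<in> X4 \<Longrightarrow> card (N W w \<inter> X3) = 2"
    and partner: "\<And>x. x \<in> X3 \<Longrightarrow> card (N W x \<inter> X3) \<le> 1"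
    and single_links: "\<And>x. x \<in> X3 \<Longrightarrow> N W x \<inter> X3 = {} \<Longrightarrow> 2 \<le> card (N W x \<inter> X4)"
    and pair_links: "\<And>x y. x \<in> X3 \<Longrightarrow> y \<in> N W x \<inter> X3 \<Longrightarrow> (N W x \<union> N W y) \<inter> X4 \<noteq> {}"
    and outer: "col (W - (X3 \<union> X4)) \<phi>"
begin

definition Sg where "Sg = {x \<in> X3. N W x \<inter> X3 = {}}"

definition base :: "('a \<Rightarrow> 'b set) \<Rightarrow> bool" where
  "base \<psi> \<longleftrightarrow> pcol W \<psi> \<and> (\<forall>u\<in>W - (X3 \<union> X4). \<psi> u = \<phi> u) \<and> (\<forall>x\<in>X3. \<psi> x = {})"

text \<open>At a vertex of degree 3 the three neighbours may block \<open>6m\<close> of the \<open>7m\<close> colours, which is \<open>m\<close> too many;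
  the set \<open>S\<close> witnesses that \<open>m\<close> of their colours are redundant.\<close>

definition saved :: "('a \<Rightarrow> 'b set) \<Rightarrow> 'a \<Rightarrow> bool" where
  "saved \<psi> x \<longleftrightarrow> (\<exists>S. S \<subseteq> (\<Union>u\<in>N W x. \<psi> u) \<and> card (nb x S) + m \<le> card S)"

lemma X3V: "x \<in> X3 \<Longrightarrow> x \<in> verts G" and X4V: "w \<in> X4 \<Longrightarrow> w \<in> verts G"
  using X3W X4W W by blast+

lemma X3_in_W: "x \<in> X3 \<Longrightarrow> x \<in> W" and X4_in_W: "w \<in> X4 \<Longrightarrow> w \<in> W" and X4_not_X3: "w \<in> X4 \<Longrightarrow> w \<notin> X3"
  using X3W X4W by blast+

lemma N_verts: "u \<in> N W x \<Longrightarrow> u \<in> verts G"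
  using W by (auto simp: nbrs_def)

lemma N_edge: "u \<in> N W x \<Longrightarrow> {x, u} \<in> edges G" "u \<in> N W x \<Longrightarrow> {u, x} \<in> edges G"
  by (simp_all add: nbrs_def insert_commute)

text \<open>The witness stays inside the growing union. Hence serving one vertex never undoes what
  was achieved for another.\<close>

lemma saved_mono:
  assumes "saved \<psi> x" "\<And>u. u \<in> N W x \<Longrightarrow> \<psi> u \<subseteq> \<psi>' u" shows "saved \<psi>' x"
proof -
  obtain S where S: "S \<subseteq> (\<Union>u\<in>N W x. \<psi> u)" "card (nb x S) + m \<le> card S"
    using assms(1) unfolding saved_def by blast
  have "(\<Union>u\<in>N W x. \<psi> u) \<subseteq> (\<Union>u\<in>N W x. \<psi>' u)" using assms(2) by (intro UN_mono) auto
  then show ?thesis unfolding saved_def using S by (meson subset_trans)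
qed

lemma avail_link:
  assumes "base \<psi>" "w \<in> X4" shows "3 * m \<le> card (avail W \<psi> w)"
proof -
  have "7 * m \<le> card (avail W \<psi> w) + 2 * m * card (N W w - X3)"
    using assms by (intro card_avail[OF W]) (auto simp: base_def X4_in_W)
  moreover have "card (N W w - X3) = 2"
    using card_Diff_subset_Int[of "N W w" X3] finN[OF W] deg4[OF assms(2)] by simp
  ultimately show ?thesis by simp
qed

text \<open>The three neighbours of \<open>x\<close> offer \<open>2m\<close> colours each, and each
  of at least two links offers \<open>m\<close> more; this makes \<open>8m\<close> against the
  \<open>7m\<close> colours of \<open>x\<close>. A redundant subset with at most \<open>m\<close>
  colours per list is added to the links. The size hypothesis is a budget of \<open>m\<close> per
  served end, so a link never exceeds \<open>2m\<close>.\<close>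

lemma single_step:
  assumes b: "base \<psi>" and x: "x \<in> Sg" "x \<notin> D"
    and sz: "\<And>w. w \<in> X4 \<Longrightarrow> card (\<psi> w) \<le> m * card (N W w \<inter> D)" and D: "D \<subseteq> Sg"
  obtains \<psi>' where "base \<psi>'" "\<And>u. \<psi> u \<subseteq> \<psi>' u" "saved \<psi>' x"
    "\<And>w. w \<in> X4 \<Longrightarrow> card (\<psi>' w) \<le> m * card (N W w \<inter> insert x D)"
proof -
  have p: "pcol W \<psi>" using b by (simp add: base_def)
  have x3: "x \<in> X3" and N3: "N W x \<inter> X3 = {}" using x by (auto simp: Sg_def)
  have xW: "x \<in> W" and xV: "x \<in> verts G" using X3_in_W[OF x3] X3V[OF x3] by simp_all
  have fN: "finite (N W x)" by (rule finN[OF W])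
  define K where "K = N W x \<inter> X4"
  have "\<exists>Tu. Tu \<subseteq> avail W \<psi> u \<and> Tu \<subseteq> L u \<and> (if u \<in> X4 then card Tu = 3 * m else Tu = \<psi> u \<and> card Tu = 2 * m)"
    if u: "u \<in> N W x" for u
  proof (cases "u \<in> X4")
    case True
    then obtain Tu where "Tu \<subseteq> avail W \<psi> u" "card Tu = 3 * m"
      using avail_link[OF b True] by (meson obtain_subset_with_card_n)
    moreover have "Tu \<subseteq> L u" by (rule subset_trans[OF calculation(1) avail_sub])
    ultimately show ?thesis using True by auto
  next
    case False
    have uW: "u \<in> W" using u by (simp add: nbrs_def)
    have "u \<in> W - (X3 \<union> X4)" using False N3 u uW by blast
    then have "\<psi> u = \<phi> u" "card (\<phi> u) = 2 * m" using b outer by (auto simp: base_def col_def)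
    then show ?thesis using False pcolD[OF p uW] by auto
  qed
  then have "\<exists>T. \<forall>u\<in>N W x. T u \<subseteq> avail W \<psi> u \<and> T u \<subseteq> L u \<and>
      (if u \<in> X4 then card (T u) = 3 * m else T u = \<psi> u \<and> card (T u) = 2 * m)"
    by (intro bchoice) blast
  then obtain T where T: "\<And>u. u \<in> N W x \<Longrightarrow> T u \<subseteq> avail W \<psi> u" "\<And>u. u \<in> N W x \<Longrightarrow> T u \<subseteq> L u"
    "\<And>u. u \<in> N W x \<Longrightarrow> if u \<in> X4 then card (T u) = 3 * m else T u = \<psi> u \<and> card (T u) = 2 * m"
    by blast
  define I where "I = (\<Union>u\<in>N W x. T u)"
  have IL: "I \<subseteq> (\<Union>u\<in>N W x. L u)" unfolding I_def using T(2) by (intro UN_mono) auto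
  have fT: "finite (T u)" if "u \<in> N W x" for u
    by (rule finite_subset[OF T(2)[OF that] finL[OF N_verts[OF that]]])
  have finI: "finite I" unfolding I_def using fN fT by blast
  have cI: "8 * m \<le> card I"
  proof -
    have "card I = (\<Sum>u\<in>N W x. card (T u))"
      unfolding I_def
    proof (rule card_UN_disjoint[OF fN])
      show "\<forall>u\<in>N W x. finite (T u)" using fT by blast
      show "\<forall>u\<in>N W x. \<forall>v\<in>N W x. u \<noteq> v \<longrightarrow> T u \<inter> T v = {}"
      proof (intro ballI impI)
        fix u v assume uv: "u \<in> N W x" "v \<in> N W x" "u \<noteq> v"
        then have "L u \<inter> L v = {}" using L_disjoint N_verts by simp
        then show "T u \<inter> T v = {}" using T(2)[OF uv(1)] T(2)[OF uv(2)] by blast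
      qed
    qed
    also have "\<dots> = (\<Sum>u\<in>N W x. 2 * m + (if u \<in> X4 then m else 0))"
    proof (rule sum.cong[OF refl])
      fix u assume "u \<in> N W x"
      from T(3)[OF this] show "card (T u) = 2 * m + (if u \<in> X4 then m else 0)" by (auto split: if_splits)
    qed
    also have "\<dots> = 2 * m * card (N W x) + m * card (N W x \<inter> X4)"
      using fN by (simp add: sum.distrib sum.If_cases)
    also have "\<dots> \<ge> 2 * m * 3 + m * 2"
      using single_links[OF x3 N3] deg3[OF x3] by (intro add_mono mult_left_mono) auto
    finally show ?thesis by simp
  qed
  have "card (nb x I) \<le> 7 * m"
    using card_mono[OF finL[OF xV] nb_sub] cardL[OF xV] by simp
  then have le: "card {a\<in>L x. \<exists>b\<in>I. {a, b} \<in> edges H} + m \<le> card I"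
    using cI by (simp add: nb_def)
  obtain S where S: "S \<subseteq> I" "card {a\<in>L x. \<exists>b\<in>S. {a, b} \<in> edges H} + m \<le> card S"
    "\<And>u. u \<in> N W x \<Longrightarrow> card (S \<inter> L u) \<le> m"
  proof (rule redundant_subset[OF finI finL[OF xV] _ _ le, of "N W x" L])
    fix a a' b assume a: "a \<in> L x" "a' \<in> L x" "b \<in> I" "{a, b} \<in> edges H" "{a', b} \<in> edges H"
    have "b \<in> (\<Union>u\<in>N W x. L u)" using IL a(3) by (rule subsetD)
    then obtain u where u: "u \<in> N W x" "b \<in> L u" by blast
    show "a = a'"
      by (rule match_unique[OF N_edge(2)[OF u(1)] u(2) a(1,2)]) (use a(4,5) in \<open>simp_all add: insert_commute\<close>)
  next
    fix u a b b' assume a: "u \<in> N W x" "a \<in> L x" "b \<in> I \<inter> L u" "b' \<in> I \<inter> L u"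
      "{a, b} \<in> edges H" "{a, b'} \<in> edges H"
    show "b = b'"
      by (rule match_unique[OF N_edge(1)[OF a(1)] a(2) _ _ a(5,6)]) (use a(3,4) in simp_all)
  qed blast
  have ST: "S \<inter> L u \<subseteq> T u" if u: "u \<in> N W x" for u
  proof
    fix b assume b: "b \<in> S \<inter> L u"
    then obtain v where v: "v \<in> N W x" "b \<in> T v" using S(1) unfolding I_def by blast
    then have "b \<in> L v" using T(2) by blast
    then have "u = v" using L_disjoint[OF N_verts[OF u] N_verts[OF v(1)]] b by blast
    then show "b \<in> T u" using v by simp
  qed
  define C where "C u = \<psi> u \<union> (S \<inter> L u)" for u
  define \<psi>' where "\<psi>' u = (if u \<in> K then C u else \<psi> u)" for u
  have KN: "u \<in> N W x" "u \<in> X4" "u \<in> W" "x \<in> N W u" if "u \<in> K" for u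
    using that nbrs_sym[OF xW, of u G] by (auto simp: K_def nbrs_def)
  have cardN: "card (N W w \<inter> insert x D) = card (N W w \<inter> D) + (if w \<in> K then 1 else 0)" if w: "w \<in> X4" for w
  proof (cases "w \<in> K")
    case True
    then have "N W w \<inter> insert x D = insert x (N W w \<inter> D)" using KN(4) by blast
    then show ?thesis using True x(2) finN[OF W] by simp
  next
    case False
    have "x \<notin> N W w" using False w nbrs_sym[OF X4_in_W[OF w], of x G] by (auto simp: K_def)
    then have "N W w \<inter> insert x D = N W w \<inter> D" by blast
    then show ?thesis using False by simp
  qed
  have sz': "card (C w) \<le> m * card (N W w \<inter> insert x D)" if w: "w \<in> K" for w
  proof -
    have "card (C w) \<le> card (\<psi> w) + card (S \<inter> L w)" unfolding C_def by (rule card_Un_le)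
    also have "\<dots> \<le> m * card (N W w \<inter> D) + m" using sz[OF KN(2)[OF w]] S(3)[OF KN(1)[OF w]] by simp
    finally show ?thesis using cardN[OF KN(2)[OF w]] w by (simp add: algebra_simps)
  qed
  have Dx: "insert x D \<subseteq> X3" using D x by (auto simp: Sg_def)
  have sz2: "card (C w) \<le> 2 * m" if w: "w \<in> K" for w
  proof -
    have "card (N W w \<inter> insert x D) \<le> card (N W w \<inter> X3)"
      by (rule card_mono) (use finN[OF W] Dx in auto)
    then have "m * card (N W w \<inter> insert x D) \<le> m * 2"
      unfolding deg4(2)[OF KN(2)[OF w]] by (rule mult_le_mono2)
    then show ?thesis using sz'[OF w] by linarith
  qed
  have Cav: "C w \<subseteq> avail W \<psi> w" if w: "w \<in> K" for w
    unfolding C_def using pcolD(3)[OF p KN(3)[OF w]] ST[OF KN(1)[OF w]] T(1)[OF KN(1)[OF w]] by simp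
  have "pcol W \<psi>'" unfolding \<psi>'_def
  proof (rule pcol_update[OF W p], intro conjI ballI)
    fix w assume w: "w \<in> K"
    show "C w \<subseteq> L w" by (rule subset_trans[OF Cav[OF w] avail_sub])
    show "card (C w) \<le> 2 * m" by (rule sz2[OF w])
    fix v
    show "nb w (\<psi> v) \<inter> C w = {}" if "v \<in> N W w - K" using Cav[OF w] that by (auto simp: avail_def)
    \<comment> \<open>Two links at \<open>x\<close> are not adjacent, as there is no triangle; they
      can be enlarged simultaneously.\<close>
    show "nb w (C v) \<inter> C w = {}" if v: "v \<in> N W w \<inter> K"
      using no_triangle[OF xW KN(1)[OF w], of v] KN(1)[of v] v by simp
  qed
  then have "base \<psi>'" using b X4_not_X3 by (auto simp: base_def \<psi>'_def K_def)
  moreover have "\<psi> u \<subseteq> \<psi>' u" for u by (simp add: \<psi>'_def C_def)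
  moreover have "saved \<psi>' x"
  proof -
    have "S \<subseteq> (\<Union>u\<in>N W x. \<psi>' u)"
    proof
      fix b assume b: "b \<in> S"
      then obtain u where u: "u \<in> N W x" "b \<in> T u" using S(1) unfolding I_def by blast
      have "b \<in> \<psi>' u"
      proof (cases "u \<in> X4")
        case True
        then show ?thesis using u b T(2)[OF u(1)] by (auto simp: \<psi>'_def K_def C_def)
      next
        case False
        then show ?thesis using u T(3)[OF u(1)] by (simp add: \<psi>'_def K_def)
      qed
      then show "b \<in> (\<Union>u\<in>N W x. \<psi>' u)" using u by blast
    qed
    then show ?thesis unfolding saved_def using S(2) by (auto simp: nb_def)
  qed
  moreover have "card (\<psi>' w) \<le> m * card (N W w \<inter> insert x D)" if w: "w \<in> X4" for w
    using sz'[of w] sz[OF w] cardN[OF w] by (cases "w \<in> K") (simp_all add: \<psi>'_def)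
  ultimately show ?thesis by (rule that)
qed

lemma commit_singles:
  "\<exists>\<psi>. base \<psi> \<and> (\<forall>w\<in>X4. card (\<psi> w) \<le> m * card (N W w \<inter> Sg)) \<and> (\<forall>x\<in>Sg. saved \<psi> x)"
proof -
  have finSg: "finite Sg"
    by (rule finite_subset[OF _ finV]) (auto simp: Sg_def X3V)
  have "\<exists>\<psi>. base \<psi> \<and> (\<forall>w\<in>X4. card (\<psi> w) \<le> m * card (N W w \<inter> D)) \<and> (\<forall>x\<in>D. saved \<psi> x)"
    if "finite D" "D \<subseteq> Sg" for D
    using that
  proof (induction D rule: finite_induct)
    case empty
    let ?\<psi> = "\<lambda>u. if u \<in> W - (X3 \<union> X4) then \<phi> u else {}"
    have "base ?\<psi>" unfolding base_def using restrict_pcol[OF W outer] by simp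
    moreover have "card (?\<psi> w) \<le> m * card (N W w \<inter> {})" if "w \<in> X4" for w using that by simp
    ultimately show ?case by blast
  next
    case (insert x D)
    then obtain \<psi> where \<psi>: "base \<psi>" "\<And>w. w \<in> X4 \<Longrightarrow> card (\<psi> w) \<le> m * card (N W w \<inter> D)" "\<And>x. x \<in> D \<Longrightarrow> saved \<psi> x"
      by auto
    obtain \<psi>' where \<psi>': "base \<psi>'" "\<And>u. \<psi> u \<subseteq> \<psi>' u" "saved \<psi>' x"
      "\<And>w. w \<in> X4 \<Longrightarrow> card (\<psi>' w) \<le> m * card (N W w \<inter> insert x D)"
      using single_step[OF \<psi>(1) _ insert.hyps(2) \<psi>(2)] insert.prems by auto
    have "saved \<psi>' y" if "y \<in> D" for y by (rule saved_mono[OF \<psi>(3)[OF that] \<psi>'(2)])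
    then show ?case using \<psi>' by (intro exI[of _ \<psi>']) auto
  qed
  from this[OF finSg order_refl] show ?thesis .
qed

text \<open>Of the two ends of \<open>w\<close> in \<open>X3\<close>, those in \<open>Sg\<close>
  have used at most \<open>m\<close> colours each, and each other end demands \<open>m\<close>. All
  of this fits into \<open>2m\<close>, and the \<open>3m\<close> free colours allow the set to be
  filled up to exactly \<open>2m\<close>.\<close>

lemma link_step:
  assumes b: "base \<psi>" and w: "w \<in> X4" and sz: "card (\<psi> w) \<le> m * card (N W w \<inter> Sg)"
  obtains S where "base (\<psi>(w := S))" "\<psi> w \<subseteq> S" "card S = 2 * m"
    "\<And>x y. x \<in> N W w \<inter> X3 \<Longrightarrow> y \<in> N W x \<inter> X3 \<Longrightarrow> pair_ok W (\<psi>(w := S)) x y"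
proof -
  have p: "pcol W \<psi>" using b by (simp add: base_def)
  have wW: "w \<in> W" by (rule X4_in_W[OF w])
  let ?A = "avail W \<psi> w"
  let ?Q = "N W w \<inter> X3 - Sg"
  define dem where "dem x D \<longleftrightarrow> D \<subseteq> ?A \<and> card D = m \<and>
      (\<forall>S. D \<subseteq> S \<longrightarrow> S \<subseteq> L w \<longrightarrow> card S = 2 * m \<longrightarrow> (\<forall>y\<in>N W x \<inter> X3. pair_ok W (\<psi>(w := S)) x y))" for x D
  have "\<exists>D. dem x D" if x: "x \<in> ?Q" for x
  proof -
    have x3: "x \<in> X3" and xw: "x \<in> N W w" using x by auto
    have xW: "x \<in> W" by (rule X3_in_W[OF x3])
    have wx: "w \<in> N W x" by (rule nbrs_sym[OF wW xw])
    have "N W x \<inter> X3 \<noteq> {}" using x x3 by (auto simp: Sg_def)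
    then have "card (N W x \<inter> X3) \<noteq> 0" using finN[OF W] by simp
    then have "card (N W x \<inter> X3) = 1" using partner[OF x3] by linarith
    then obtain y where y: "N W x \<inter> X3 = {y}" using card_1_singletonE by blast
    then have yx: "y \<in> N W x" "y \<in> X3" by auto
    have wy: "w \<noteq> y" using yx X4_not_X3[OF w] by blast
    have wNy: "w \<notin> N W y" by (rule no_triangle[OF xW yx(1) wx])
    have e: "\<psi> x = {}" "\<psi> y = {}" using b x3 yx(2) by (auto simp: base_def)
    obtain D where "D \<subseteq> ?A" "card D = m"
      "\<And>S. D \<subseteq> S \<Longrightarrow> S \<subseteq> L w \<Longrightarrow> card S = 2 * m \<Longrightarrow> pair_ok W (\<psi>(w := S)) x y"
      by (rule pair_demand[OF W p xW yx(1) wx wy wNy deg3[OF x3] deg3[OF yx(2)] e avail_sub avail_link[OF b w]]) blast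
    then show ?thesis unfolding dem_def y by (intro exI[of _ D]) simp
  qed
  then have "\<exists>D. \<forall>x\<in>?Q. dem x (D x)" by (intro bchoice) simp
  then obtain D where "\<forall>x\<in>?Q. dem x (D x)" by (elim exE)
  then have dem: "dem x (D x)" if "x \<in> ?Q" for x using that by (rule bspec)
  then have D: "\<And>x. x \<in> ?Q \<Longrightarrow> D x \<subseteq> ?A" "\<And>x. x \<in> ?Q \<Longrightarrow> card (D x) = m"
    unfolding dem_def by simp_all
  have fQ: "finite ?Q" using finN[OF W] by simp
  let ?B = "\<psi> w \<union> (\<Union>x\<in>?Q. D x)"
  have "card ?B \<le> card (\<psi> w) + card (\<Union>x\<in>?Q. D x)" by (rule card_Un_le)
  also have "card (\<Union>x\<in>?Q. D x) \<le> (\<Sum>x\<in>?Q. card (D x))" by (rule card_UN_le[OF fQ])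
  also have "(\<Sum>x\<in>?Q. card (D x)) = m * card ?Q" using D(2) by simp
  finally have "card ?B \<le> m * card (N W w \<inter> Sg) + m * card ?Q" using sz by linarith
  moreover have "card (N W w \<inter> Sg) + card ?Q = 2"
  proof -
    have "card (N W w \<inter> X3) = card ((N W w \<inter> Sg) \<union> ?Q)"
      by (rule arg_cong[of _ _ card]) (auto simp: Sg_def)
    also have "\<dots> = card (N W w \<inter> Sg) + card ?Q"
      using finN[OF W] by (intro card_Un_disjoint) auto
    finally show ?thesis using deg4(2)[OF w] by simp
  qed
  ultimately have "card ?B \<le> 2 * m" by (metis add_mult_distrib2 mult.commute)
  moreover have "?B \<subseteq> ?A" using D(1) pcolD(3)[OF p wW] by (intro Un_least UN_least) auto
  ultimately obtain S where S: "?B \<subseteq> S" "S \<subseteq> ?A" "card S = 2 * m"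
    using exists_subset_between[of ?B "2 * m" ?A] avail_link[OF b w] finavail[OF X4V[OF w], of W \<psi>] by auto
  have SL: "S \<subseteq> L w" by (rule subset_trans[OF S(2) avail_sub])
  show ?thesis
  proof (rule that)
    show "base (\<psi>(w := S))"
      using pcol_update1[OF W p wW S(2)] S(3) b w X4_not_X3[OF w] by (auto simp: base_def)
    show "\<psi> w \<subseteq> S" "card S = 2 * m" using S by auto
    fix x y assume xy: "x \<in> N W w \<inter> X3" "y \<in> N W x \<inter> X3"
    then have xQ: "x \<in> ?Q" by (auto simp: Sg_def)
    have "D x \<subseteq> S" using S(1) xQ by blast
    then show "pair_ok W (\<psi>(w := S)) x y"
      using dem[OF xQ] SL S(3) xy(2) unfolding dem_def by simp
  qed
qed

text \<open>Links receive their final sets one by one. The invariant concerns pairs all of whose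
  links are finished: a new link at the pair establishes \<open>pair_ok\<close> afresh, and a link
  elsewhere changes neither list. At the start it is vacuous, since every pair has a link.\<close>

lemma complete_links:
  "\<exists>\<psi>. base \<psi> \<and> (\<forall>w\<in>X4. card (\<psi> w) = 2 * m) \<and> (\<forall>x\<in>Sg. saved \<psi> x) \<and>
     (\<forall>x\<in>X3. \<forall>y\<in>N W x \<inter> X3. pair_ok W \<psi> x y)"
proof -
  have fin4: "finite X4" by (rule finite_subset[OF _ finV]) (auto simp: X4V)
  let ?P = "\<lambda>D \<psi>. base \<psi> \<and> (\<forall>w\<in>X4 - D. card (\<psi> w) \<le> m * card (N W w \<inter> Sg)) \<and>
      (\<forall>w\<in>D. card (\<psi> w) = 2 * m) \<and> (\<forall>x\<in>Sg. saved \<psi> x) \<and>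
      (\<forall>x\<in>X3. \<forall>y\<in>N W x \<inter> X3. (N W x \<union> N W y) \<inter> X4 \<subseteq> D \<longrightarrow> pair_ok W \<psi> x y)"
  have "\<exists>\<psi>. ?P D \<psi>" if "finite D" "D \<subseteq> X4" for D
    using that
  proof (induction D rule: finite_induct)
    case empty
    obtain \<psi> where \<psi>: "base \<psi>" "\<forall>w\<in>X4. card (\<psi> w) \<le> m * card (N W w \<inter> Sg)" "\<forall>x\<in>Sg. saved \<psi> x"
      using commit_singles by blast
    have "\<not> (N W x \<union> N W y) \<inter> X4 \<subseteq> {}" if "x \<in> X3" "y \<in> N W x \<inter> X3" for x y
      using pair_links[OF that] by blast
    then have "?P {} \<psi>" using \<psi> by simp
    then show ?case by blast
  next
    case (insert w D)
    then obtain \<psi> where \<psi>: "base \<psi>" "\<And>w. w \<in> X4 - D \<Longrightarrow> card (\<psi> w) \<le> m * card (N W w \<inter> Sg)"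
      "\<And>w. w \<in> D \<Longrightarrow> card (\<psi> w) = 2 * m" "\<And>x. x \<in> Sg \<Longrightarrow> saved \<psi> x"
      "\<And>x y. x \<in> X3 \<Longrightarrow> y \<in> N W x \<inter> X3 \<Longrightarrow> (N W x \<union> N W y) \<inter> X4 \<subseteq> D \<Longrightarrow> pair_ok W \<psi> x y"
      by auto
    have w4: "w \<in> X4" and wD: "w \<in> X4 - D" using insert by auto
    obtain S where S: "base (\<psi>(w := S))" "\<psi> w \<subseteq> S" "card S = 2 * m"
      "\<And>x y. x \<in> N W w \<inter> X3 \<Longrightarrow> y \<in> N W x \<inter> X3 \<Longrightarrow> pair_ok W (\<psi>(w := S)) x y"
      using link_step[OF \<psi>(1) w4 \<psi>(2)[OF wD]] by metis
    let ?f = "\<psi>(w := S)"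
    have "saved ?f x" if "x \<in> Sg" for x by (rule saved_mono[OF \<psi>(4)[OF that]]) (use S(2) in auto)
    moreover have "pair_ok W ?f x y"
      if x: "x \<in> X3" and y: "y \<in> N W x \<inter> X3" and l: "(N W x \<union> N W y) \<inter> X4 \<subseteq> insert w D" for x y
    proof -
      have xW: "x \<in> W" by (rule X3_in_W[OF x])
      have xy: "x \<in> N W y \<inter> X3" using nbrs_sym[OF xW, of y G] x y by simp
      have yW: "y \<in> W" using y by (simp add: nbrs_def)
      consider "w \<in> N W x" | "w \<in> N W y" | "w \<notin> N W x" "w \<notin> N W y" by fast
      then show ?thesis
      proof cases
        case 1
        then have "x \<in> N W w \<inter> X3" using nbrs_sym[OF xW 1] x by simp
        then show ?thesis by (rule S(4)[OF _ y])
      next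
        case 2
        then have "y \<in> N W w \<inter> X3" using nbrs_sym[OF yW 2] y by simp
        then show ?thesis by (rule pair_ok_sym[OF S(4)[OF _ xy]])
      next
        case 3
        then have "(N W x \<union> N W y) \<inter> X4 \<subseteq> D" using l by blast
        then have "pair_ok W \<psi> x y" by (rule \<psi>(5)[OF x y])
        moreover have "avail W ?f x = avail W \<psi> x" "avail W ?f y = avail W \<psi> y"
          by (rule avail_cong; use 3 in auto)+
        ultimately show ?thesis unfolding pair_ok_def by simp
      qed
    qed
    ultimately have "?P (insert w D) ?f" using S(1,3) \<psi>(2,3) insert.hyps by auto
    then show ?case by blast
  qed
  from this[OF fin4 order_refl] show ?thesis by auto
qed

text \<open>The neighbours carry at most \<open>6m\<close> colours, and the witness \<open>S\<close>
  blocks at least \<open>m\<close> fewer colours than it has elements. So at most \<open>5m\<close>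
  of the \<open>7m\<close> colours of \<open>x\<close> are blocked.\<close>

lemma saved_avail:
  assumes b: "base \<psi>" and full: "\<And>w. w \<in> X4 \<Longrightarrow> card (\<psi> w) = 2 * m" and x: "x \<in> Sg" "saved \<psi> x"
  shows "2 * m \<le> card (avail W \<psi> x)"
proof -
  have p: "pcol W \<psi>" using b by (simp add: base_def)
  have x3: "x \<in> X3" and xV: "x \<in> verts G" using x X3V by (auto simp: Sg_def)
  let ?U = "\<Union>u\<in>N W x. \<psi> u"
  obtain S where S: "S \<subseteq> ?U" "card (nb x S) + m \<le> card S" using x(2) unfolding saved_def by blast
  have NW: "u \<in> W" if "u \<in> N W x" for u using that by (simp add: nbrs_def)
  have UL: "?U \<subseteq> (\<Union>u\<in>N W x. L u)" using pcolD(1)[OF p NW] by (intro UN_mono) auto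
  have finU: "finite ?U"
    by (rule finite_UN_I[OF finN[OF W]]) (rule finite_subset[OF pcolD(1)[OF p NW] finL[OF N_verts]])
  have fS: "finite S" by (rule finite_subset[OF S(1) finU])
  have "card ?U \<le> (\<Sum>u\<in>N W x. card (\<psi> u))" by (rule card_UN_le[OF finN[OF W]])
  also have "\<dots> \<le> (\<Sum>u\<in>N W x. 2 * m)" using pcolD(2)[OF p NW] by (intro sum_mono)
  finally have cU: "card ?U \<le> 6 * m" using deg3[OF x3] by simp
  have "nb x ?U = nb x S \<union> nb x (?U - S)" using nb_Un[of x S "?U - S"] S(1) by (simp add: Un_absorb1)
  then have "card (nb x ?U) \<le> card (nb x S) + card (nb x (?U - S))" by (simp add: card_Un_le)
  also have "card (nb x (?U - S)) \<le> card (?U - S)"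
    by (rule card_nb_UN[OF xV N_edge(1)]) (use UL finU in auto)
  also have "card (?U - S) = card ?U - card S" by (rule card_Diff_subset[OF fS S(1)])
  finally have "card (nb x ?U) \<le> 5 * m"
    using S(2) cU card_mono[OF finU S(1)] by linarith
  moreover have "avail W \<psi> x = L x - nb x ?U" unfolding avail_def by (auto simp: nb_def)
  moreover have "finite (nb x ?U)" by (rule finite_subset[OF nb_sub finL[OF xV]])
  ultimately show ?thesis
    using diff_card_le_card_Diff[of "nb x ?U" "L x"] cardL[OF xV] by simp
qed

lemma extend_links: "\<exists>\<psi>. col W \<psi>"
proof -
  obtain \<psi> where b: "base \<psi>" and full: "\<And>w. w \<in> X4 \<Longrightarrow> card (\<psi> w) = 2 * m"
    and sv: "\<And>x. x \<in> Sg \<Longrightarrow> saved \<psi> x"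
    and pr: "\<And>x y. x \<in> X3 \<Longrightarrow> y \<in> N W x \<inter> X3 \<Longrightarrow> pair_ok W \<psi> x y"
    using complete_links by blast
  have p: "pcol W \<psi>" using b by (simp add: base_def)
  define P where "P x = insert x (N W x \<inter> X3)" for x
  define ok where "ok Q f \<longleftrightarrow> (\<forall>u\<in>Q. f u \<subseteq> avail W \<psi> u \<and> card (f u) = 2 * m \<and>
    (\<forall>v\<in>N W u \<inter> X3. nb u (f v) \<inter> f u = {}))" for Q and f :: "'a \<Rightarrow> 'b set"
  have pair_nbrs: "N W x \<inter> X3 = {y}" if "x \<in> X3" "y \<in> N W x \<inter> X3" for x y
  proof -
    have "card {y} \<le> card (N W x \<inter> X3)" using that finN[OF W] by (intro card_mono) auto
    then have "{y} = N W x \<inter> X3"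
      using partner[OF that(1)] that finN[OF W] by (intro card_subset_eq) auto
    then show ?thesis by simp
  qed
  have sym3: "x \<in> N W y \<inter> X3" if "x \<in> X3" "y \<in> N W x \<inter> X3" for x y
    using nbrs_sym[OF X3_in_W[OF that(1)], of y G] that by simp
  have ex: "\<exists>f. ok (P x) f" if x: "x \<in> X3" for x
  proof (cases "N W x \<inter> X3 = {}")
    case True
    then have xS: "x \<in> Sg" using x by (simp add: Sg_def)
    obtain A where A: "A \<subseteq> avail W \<psi> x" "card A = 2 * m"
      using saved_avail[OF b full xS sv[OF xS]] by (meson obtain_subset_with_card_n)
    have "ok (P x) (\<lambda>_. A)" using A True by (simp add: ok_def P_def)
    then show ?thesis by blast
  next
    case False
    then obtain y where y: "y \<in> N W x \<inter> X3" by blast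
    have y3: "y \<in> X3" and xy: "x \<noteq> y" using y N_irrefl by auto
    obtain A B where AB: "A \<subseteq> avail W \<psi> x" "B \<subseteq> avail W \<psi> y" "card A = 2 * m" "card B = 2 * m" "nb y A \<inter> B = {}"
      using pr[OF x y] unfolding pair_ok_def by blast
    have "nb x B \<inter> A = {}"
      by (rule nb_disjoint_sym[OF subset_trans[OF AB(1) avail_sub] subset_trans[OF AB(2) avail_sub] AB(5)])
    then have "ok (P x) (\<lambda>u. if u = x then A else B)"
      using AB xy pair_nbrs[OF x y] pair_nbrs[OF y3 sym3[OF x y]] by (simp add: ok_def P_def)
    then show ?thesis by blast
  qed
  \<comment> \<open>\<open>P x\<close> is the same set for both ends of a pair, so one function is
    chosen for both and their colour sets fit together.\<close>
  define C where "C x = (SOME f. ok (P x) f) x" for x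
  have okP: "ok (P x) (SOME f. ok (P x) f)" if "x \<in> X3" for x by (rule someI_ex[OF ex[OF that]])
  have C1: "C x \<subseteq> avail W \<psi> x" "card (C x) = 2 * m" if "x \<in> X3" for x
    using okP[OF that] by (simp_all add: ok_def P_def C_def)
  have C2: "nb x (C y) \<inter> C x = {}" if x: "x \<in> X3" and y: "y \<in> N W x \<inter> X3" for x y
  proof -
    have y3: "y \<in> X3" using y by simp
    have "P y = P x" using pair_nbrs[OF x y] pair_nbrs[OF y3 sym3[OF x y]] by (auto simp: P_def)
    moreover have "nb x ((SOME f. ok (P x) f) y) \<inter> (SOME f. ok (P x) f) x = {}"
      using okP[OF x] y by (simp add: ok_def P_def)
    ultimately show ?thesis by (simp add: C_def)
  qed
  define \<psi>f where "\<psi>f u = (if u \<in> X3 then C u else \<psi> u)" for u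
  have "pcol W \<psi>f" unfolding \<psi>f_def
  proof (rule pcol_update[OF W p], intro conjI ballI)
    fix x assume x: "x \<in> X3"
    show "C x \<subseteq> L x" by (rule subset_trans[OF C1(1)[OF x] avail_sub])
    show "card (C x) \<le> 2 * m" using C1(2)[OF x] by simp
    fix v
    show "nb x (\<psi> v) \<inter> C x = {}" if "v \<in> N W x - X3" using C1(1)[OF x] that by (auto simp: avail_def)
    show "nb x (C v) \<inter> C x = {}" if "v \<in> N W x \<inter> X3" by (rule C2[OF x that])
  qed
  moreover have "card (\<psi>f u) = 2 * m" if u: "u \<in> W" for u
  proof -
    consider "u \<in> X3" | "u \<in> X4" "u \<notin> X3" | "u \<in> W - (X3 \<union> X4)" using u by blast
    then show ?thesis
    proof cases
      case 3
      then have "\<psi> u = \<phi> u" using b by (simp add: base_def)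
      then show ?thesis using 3 outer by (simp add: \<psi>f_def col_def)
    qed (simp_all add: \<psi>f_def C1 full)
  qed
  ultimately show ?thesis unfolding col_def by blast
qed

end

section \<open>Minimal uncolourable vertex sets\<close>

locale minimal_uncolorable = dp_cover +
  fixes W :: "'a set"
  assumes W: "W \<subseteq> verts G"
    and no_triangle: "\<And>x y z. x \<in> W \<Longrightarrow> y \<in> N W x \<Longrightarrow> z \<in> N W x \<Longrightarrow> z \<notin> N W y"
    and smaller: "\<And>W'. W' \<subset> W \<Longrightarrow> \<exists>\<phi>. col W' \<phi>"
    and uncolorable: "\<not> (\<exists>\<phi>. col W \<phi>)"
begin

abbreviation deg where "deg v \<equiv> card (N W v)"

definition V3 where "V3 = {v \<in> W. deg v = 3}"

text \<open>Both neighbours of degree 3 must lie in \<open>X\<close>, so removing a node from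
  \<open>X\<close> removes all its links.\<close>

definition links where "links X = {w \<in> W. deg w = 4 \<and> card (N W w \<inter> V3) = 2 \<and> N W w \<inter> V3 \<subseteq> X}"

lemma finW: "finite W" by (rule finite_subset[OF W finV])

lemma V3_W: "V3 \<subseteq> W" by (auto simp: V3_def)

lemma fin3: "finite V3" by (rule finite_subset[OF V3_W finW])

lemma deg_ge3: "v \<in> W \<Longrightarrow> 3 \<le> deg v"
proof (rule ccontr)
  assume v: "v \<in> W" "\<not> 3 \<le> deg v"
  then have "W - {v} \<subset> W" by blast
  from smaller[OF this] obtain \<phi> where "col (W - {v}) \<phi>" by (elim exE)
  then show False using extend_low_degree[OF W v(1)] v(2) uncolorable by simp
qed

lemma no_star:
  assumes v: "v \<in> W" and K: "K \<subseteq> N W v \<inter> V3"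
    and q: "q + 2 * m * card (N W v - K) \<le> 7 * m"
    and sel: "\<And>(U :: 'b set) M. finite U \<Longrightarrow> q \<le> card U \<Longrightarrow> (\<And>x. x \<in> K \<Longrightarrow> card (M x \<inter> U) \<le> 3 * m) \<Longrightarrow>
        \<exists>S\<subseteq>U. card S = 2 * m \<and> (\<forall>x\<in>K. card (S \<inter> M x) \<le> m)"
  shows False
proof -
  have "W - insert v K \<subset> W" using v by blast
  from smaller[OF this] obtain \<phi> where "col (W - insert v K) \<phi>" by (elim exE)
  moreover have "N W x \<inter> K = {}" if "x \<in> K" for x
    using no_triangle[OF v, of x] K that by blast
  moreover have "deg x = 3" if "x \<in> K" for x using K that by (auto simp: V3_def)
  ultimately have "\<exists>\<psi>. col W \<psi>"
    using K by (intro extend_star[OF W v _ _ _ q sel]) auto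
  then show False using uncolorable by contradiction
qed

text \<open>At most one neighbour outside \<open>K\<close> leaves \<open>5m\<close> colours at
  \<open>v\<close>, as \<open>select_three\<close> requires. The names \<open>x\<close>,
  \<open>y\<close>, \<open>z\<close> may repeat, so a star with two leaves at a vertex of degree 3
  is covered as well.\<close>

lemma no_small_star:
  assumes v: "v \<in> W" and K: "K \<subseteq> N W v \<inter> V3" "K = {x, y, z}" and q: "card (N W v - K) \<le> 1"
  shows False
proof (rule no_star[OF v K(1)])
  have "2 * m * card (N W v - K) \<le> 2 * m * 1" using q by (rule mult_le_mono2)
  then show "5 * m + 2 * m * card (N W v - K) \<le> 7 * m" by simp
  fix U :: "'b set" and M
  assume U: "finite U" "5 * m \<le> card U" "\<And>x. x \<in> K \<Longrightarrow> card (M x \<inter> U) \<le> 3 * m"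
  obtain S where "S \<subseteq> U" "card S = 2 * m" "card (S \<inter> M x) \<le> m" "card (S \<inter> M y) \<le> m" "card (S \<inter> M z) \<le> m"
    by (rule select_three[OF U(1,2), of "M x" "M y" "M z"]) (use U(3) K(2) in auto)
  then show "\<exists>S\<subseteq>U. card S = 2 * m \<and> (\<forall>x\<in>K. card (S \<inter> M x) \<le> m)" using K(2) by auto
qed

lemma nbrs3_of_3:
  assumes "v \<in> V3" shows "card (N W v \<inter> V3) \<le> 1"
proof (rule ccontr)
  assume "\<not> ?thesis"
  then have "2 \<le> card (N W v \<inter> V3)" by simp
  then obtain K where K: "K \<subseteq> N W v \<inter> V3" "card K = 2" by (meson obtain_subset_with_card_n)
  then obtain x y where xy: "K = {x, y, y}" by (auto simp: card_2_iff)
  have "card (N W v - K) = deg v - card K"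
    using K by (intro card_Diff_subset) (auto intro: card_ge_0_finite)
  then have "card (N W v - K) \<le> 1" using K(2) assms by (simp add: V3_def)
  then show False using no_small_star[OF _ K(1) xy] assms V3_W by blast
qed

lemma nbrs3_of_4:
  assumes "v \<in> W" "deg v = 4" shows "card (N W v \<inter> V3) \<le> 2"
proof (rule ccontr)
  assume "\<not> ?thesis"
  then have "3 \<le> card (N W v \<inter> V3)" by simp
  then obtain K where K: "K \<subseteq> N W v \<inter> V3" "card K = 3" by (meson obtain_subset_with_card_n)
  then obtain x y z where xyz: "K = {x, y, z}" by (auto simp: card_3_iff)
  have "card (N W v - K) = deg v - card K"
    using K by (intro card_Diff_subset) (auto intro: card_ge_0_finite)
  then have "card (N W v - K) \<le> 1" using K(2) assms by simp
  then show False by (rule no_small_star[OF assms(1) K(1) xyz])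
qed

text \<open>If all five neighbours had degree 3, none would be coloured outside the star and
  \<open>v\<close> would keep all \<open>7m\<close> colours, as \<open>select_five\<close>
  requires.\<close>

lemma nbrs3_of_5:
  assumes "v \<in> W" "deg v = 5" shows "card (N W v \<inter> V3) \<le> 4"
proof (rule ccontr)
  assume "\<not> ?thesis"
  moreover have "card (N W v \<inter> V3) \<le> deg v" using finN[OF W] by (intro card_mono) auto
  ultimately have c5: "card (N W v \<inter> V3) = 5" using assms(2) by linarith
  then have "N W v \<inter> V3 = N W v"
    using card_subset_eq[OF finN[OF W], of "N W v \<inter> V3"] assms(2) by simp
  then have z: "card (N W v - N W v \<inter> V3) = 0" by (metis Diff_cancel card.empty)
  show False
  proof (rule no_star[OF assms(1) order_refl])
    show "7 * m + 2 * m * card (N W v - N W v \<inter> V3) \<le> 7 * m" using z by simp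
    fix U :: "'b set" and M
    assume U: "finite U" "7 * m \<le> card U" "\<And>x. x \<in> N W v \<inter> V3 \<Longrightarrow> card (M x \<inter> U) \<le> 3 * m"
    obtain S where "S \<subseteq> U" "card S = 2 * m" "\<And>x. x \<in> N W v \<inter> V3 \<Longrightarrow> card (S \<inter> M x) \<le> m"
      by (rule select_five[OF U(1,2) c5 U(3)]) blast+
    then show "\<exists>S\<subseteq>U. card S = 2 * m \<and> (\<forall>x\<in>N W v \<inter> V3. card (S \<inter> M x) \<le> m)" by blast
  qed
qed

text \<open>Otherwise every single node of \<open>X\<close> has two links and every pair one.
  Minimality colours the vertices outside \<open>X\<close> and its links, and
  \<open>extend_links\<close> would extend this to \<open>W\<close>.\<close>

lemma links_peel:
  assumes X: "X \<subseteq> V3" "X \<noteq> {}" and cl: "\<And>x. x \<in> X \<Longrightarrow> N W x \<inter> V3 \<subseteq> X"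
  shows "(\<exists>x\<in>X. N W x \<inter> V3 = {} \<and> card (N W x \<inter> links X) \<le> 1) \<or>
    (\<exists>x\<in>X. \<exists>y\<in>N W x \<inter> V3. (N W x \<union> N W y) \<inter> links X = {})"
proof (rule ccontr)
  assume neg: "\<not> ?thesis"
  have eq: "N W x \<inter> X = N W x \<inter> V3" if "x \<in> X" for x using cl[OF that] X(1) by blast
  have "W - (X \<union> links X) \<subset> W" using X V3_W by blast
  from smaller[OF this] obtain \<phi> where \<phi>: "col (W - (X \<union> links X)) \<phi>" by (elim exE)
  interpret link_structure G L H m W X "links X" \<phi>
  proof
    show "W \<subseteq> verts G" by (rule W)
    show "z \<notin> N W y" if "x \<in> W" "y \<in> N W x" "z \<in> N W x" for x y z by (rule no_triangle[OF that])
    show "X \<subseteq> W" using X(1) V3_W by (rule subset_trans)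
    show "links X \<subseteq> W - X" using X(1) by (auto simp: links_def V3_def)
    show "deg x = 3" if "x \<in> X" for x using that X(1) by (auto simp: V3_def)
    show "deg w = 4" if "w \<in> links X" for w using that by (simp add: links_def)
    show "card (N W w \<inter> X) = 2" if w: "w \<in> links X" for w
    proof -
      have "N W w \<inter> X = N W w \<inter> V3" using w X(1) by (auto simp: links_def)
      then show ?thesis using w by (simp add: links_def)
    qed
    show "card (N W x \<inter> X) \<le> 1" if "x \<in> X" for x
      unfolding eq[OF that] by (rule nbrs3_of_3) (use that X(1) in blast)
    show "2 \<le> card (N W x \<inter> links X)" if "x \<in> X" "N W x \<inter> X = {}" for x
      using neg that eq[OF that(1)] by force
    show "(N W x \<union> N W y) \<inter> links X \<noteq> {}" if "x \<in> X" "y \<in> N W x \<inter> X" for x y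
      using neg that eq[OF that(1)] by auto
    show "col (W - (X \<union> links X)) \<phi>" by (rule \<phi>)
  qed
  show False using extend_links uncolorable by contradiction
qed

text \<open>Peeling removes either a single node together with at most one link, or a pair that has
  no link. So at most one link is lost per single node, and a pair costs nothing.\<close>

lemma card_links_le:
  assumes "X \<subseteq> V3" "\<And>x. x \<in> X \<Longrightarrow> N W x \<inter> V3 \<subseteq> X"
  shows "card (links X) \<le> card {x \<in> X. N W x \<inter> V3 = {}}"
  using assms
proof (induction "card X" arbitrary: X rule: less_induct)
  case less
  have fX: "finite X" by (rule finite_subset[OF less.prems(1) fin3])
  have fl: "finite (links Y)" for Y by (rule finite_subset[OF _ finW]) (auto simp: links_def)
  show ?case
  proof (cases "X = {}")
    case True
    have "links {} = {}" by (auto simp: links_def)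
    then show ?thesis using True by simp
  next
    case False
    have drop: "links X \<subseteq> links (X - Z) \<union> {w \<in> links X. N W w \<inter> Z \<noteq> {}}" for Z
      by (auto simp: links_def)
    have link_sym: "w \<in> N W x" if "w \<in> links X" "x \<in> N W w" for w x
      using that nbrs_sym[of w W x G] by (simp add: links_def)
    have "(\<exists>x\<in>X. N W x \<inter> V3 = {} \<and> card (N W x \<inter> links X) \<le> 1) \<or>
        (\<exists>x\<in>X. \<exists>y\<in>N W x \<inter> V3. (N W x \<union> N W y) \<inter> links X = {})"
      by (rule links_peel[OF less.prems(1) False less.prems(2)])
    then show ?thesis
    proof (elim disjE bexE conjE)
      fix x assume x: "x \<in> X" "N W x \<inter> V3 = {}" "card (N W x \<inter> links X) \<le> 1"
      have "N W y \<inter> V3 \<subseteq> X - {x}" if y: "y \<in> X - {x}" for y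
      proof -
        have "x \<notin> N W y"
          using nbrs_sym[of y W x G] x(2) y less.prems(1) V3_W by blast
        then show ?thesis using less.prems(2)[of y] y by blast
      qed
      then have IH: "card (links (X - {x})) \<le> card {z \<in> X - {x}. N W z \<inter> V3 = {}}"
        using less.prems(1) psubset_card_mono[OF fX, of "X - {x}"] x(1) by (intro less.hyps) auto
      have "links X \<subseteq> links (X - {x}) \<union> (N W x \<inter> links X)"
        using drop[of "{x}"] link_sym by blast
      then have "card (links X) \<le> card (links (X - {x}) \<union> (N W x \<inter> links X))"
        by (rule card_mono[rotated]) (use fl in simp)
      also have "\<dots> \<le> card (links (X - {x})) + card (N W x \<inter> links X)" by (rule card_Un_le)
      finally have "card (links X) \<le> card {z \<in> X - {x}. N W z \<inter> V3 = {}} + 1" using IH x(3) by linarith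
      also have "\<dots> = card (insert x {z \<in> X - {x}. N W z \<inter> V3 = {}})" using fX by simp
      also have "insert x {z \<in> X - {x}. N W z \<inter> V3 = {}} = {z \<in> X. N W z \<inter> V3 = {}}"
        using x(1,2) by auto
      finally show ?thesis .
    next
      fix x y assume x: "x \<in> X" and y: "y \<in> N W x \<inter> V3" and l: "(N W x \<union> N W y) \<inter> links X = {}"
      have xW: "x \<in> W" and x3: "x \<in> V3" using x less.prems(1) V3_W by blast+
      have yX: "y \<in> X" using less.prems(2)[OF x] y by blast
      have xy: "x \<in> N W y \<inter> V3" using nbrs_sym[OF xW, of y G] y x3 by simp
      have one: "N W a \<inter> V3 = {b}" if "a \<in> V3" "b \<in> N W a \<inter> V3" for a b
        using card_subset_eq[of "N W a \<inter> V3" "{b}"] nbrs3_of_3[OF that(1)] that(2) finN[OF W]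
          card_mono[of "N W a \<inter> V3" "{b}"] by auto
      have "N W z \<inter> V3 \<subseteq> X - {x, y}" if z: "z \<in> X - {x, y}" for z
      proof -
        have z3: "z \<in> V3" "z \<in> W" using z less.prems(1) V3_W by blast+
        have "x \<notin> N W z"
        proof
          assume "x \<in> N W z"
          then have "z \<in> N W x \<inter> V3" using nbrs_sym[OF z3(2), of x G] z3(1) by simp
          then show False using one[OF x3 y] z by simp
        qed
        moreover have "y \<notin> N W z"
        proof
          assume "y \<in> N W z"
          then have "z \<in> N W y \<inter> V3" using nbrs_sym[OF z3(2), of y G] z3(1) by simp
          moreover have "N W y \<inter> V3 = {x}" by (rule one[OF _ xy]) (use y in simp)
          ultimately show False using z by blast
        qed
        ultimately show ?thesis using less.prems(2)[of z] z by blast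
      qed
      then have IH: "card (links (X - {x, y})) \<le> card {z \<in> X - {x, y}. N W z \<inter> V3 = {}}"
        using less.prems(1) psubset_card_mono[OF fX, of "X - {x, y}"] x by (intro less.hyps) auto
      have "links X \<subseteq> links (X - {x, y})"
        using drop[of "{x, y}"] link_sym l by blast
      then have "card (links X) \<le> card (links (X - {x, y}))" by (rule card_mono[OF fl])
      also note IH
      also have "card {z \<in> X - {x, y}. N W z \<inter> V3 = {}} \<le> card {z \<in> X. N W z \<inter> V3 = {}}"
        using fX by (intro card_mono) auto
      finally show ?thesis .
    qed
  qed
qed

text \<open>Discharging with initial charge \<open>deg v - 40/11\<close>: a vertex of degree at least 4 sends 15/44 to each
  neighbour of degree 3, except that a link sends only 2/11 to each of its two. Everything is multiplied by 44.\<close>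

lemma degree_sum: "160 * card W \<le> 44 * (\<Sum>v\<in>W. deg v)"
proof -
  let ?R = "W - V3"
  define S1 where "S1 = {x \<in> V3. N W x \<inter> V3 = {}}"
  define \<Lambda> where "\<Lambda> = links V3"
  have l: "card \<Lambda> \<le> card S1" unfolding \<Lambda>_def S1_def by (rule card_links_le) auto
  have \<Lambda>R: "\<Lambda> \<subseteq> ?R" by (auto simp: \<Lambda>_def links_def V3_def)
  have fR: "finite ?R" using finW by simp
  \<comment> \<open>Equality holds for a link (\<open>160 + 30 = 176 + 14\<close>) and for degree 5
    with four neighbours of degree 3 (\<open>160 + 60 = 220\<close>). The 14 is what a link keeps
    back, 7 from each of its two ends.\<close>
  have local_ineq: "160 + 15 * card (N W v \<inter> V3) \<le> 44 * deg v + (if v \<in> \<Lambda> then 14 else 0)" if v: "v \<in> ?R" for v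
  proof -
    have vW: "v \<in> W" using v by simp
    have "deg v \<noteq> 3" using v by (simp add: V3_def)
    then have d: "4 \<le> deg v" using deg_ge3[OF vW] by linarith
    have t: "card (N W v \<inter> V3) \<le> deg v" using finN[OF W] by (intro card_mono) auto
    consider "deg v = 4" "card (N W v \<inter> V3) = 2" | "deg v = 4" "card (N W v \<inter> V3) \<le> 1" | "deg v = 5" | "6 \<le> deg v"
      using d nbrs3_of_4[OF vW] by linarith
    then show ?thesis
    proof cases
      case 1
      then have "v \<in> \<Lambda>" using vW by (simp add: \<Lambda>_def links_def)
      then show ?thesis using 1 by simp
    next
      case 3
      then show ?thesis using nbrs3_of_5[OF vW] by simp
    next
      case 4
      then show ?thesis using t by linarith
    qed simp
  qed
  have "(\<Sum>v\<in>?R. card (N W v \<inter> V3)) = (\<Sum>x\<in>V3. card (N W x - V3))"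
  proof -
    have "(\<Sum>v\<in>?R. card (N W v \<inter> V3)) = (\<Sum>v\<in>?R. card {x \<in> V3. x \<in> N W v})"
      by (intro sum.cong refl arg_cong[of _ _ card]) blast
    also have "\<dots> = (\<Sum>x\<in>V3. card {v \<in> ?R. x \<in> N W v})"
      using sum_multicount_gen[OF fR fin3, of "\<lambda>v x. x \<in> N W v" "\<lambda>x. card {v \<in> ?R. x \<in> N W v}"] by simp
    also have "\<dots> = (\<Sum>x\<in>V3. card (N W x - V3))"
    proof (intro sum.cong refl arg_cong[of _ _ card])
      fix x assume "x \<in> V3"
      then show "{v \<in> ?R. x \<in> N W v} = N W x - V3"
        using V3_W by (auto simp: nbrs_def insert_commute)
    qed
    finally show ?thesis .
  qed
  \<comment> \<open>A vertex of degree 3 has at most one neighbour of its kind, so it receives from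
    three vertices if it is single and from at least two otherwise.\<close>
  also have "(\<Sum>x\<in>V3. card (N W x - V3)) \<ge> (\<Sum>x\<in>V3. 2 + (if x \<in> S1 then 1 else 0))"
  proof (rule sum_mono)
    fix x assume x: "x \<in> V3"
    have "card (N W x - V3) = 3 - card (N W x \<inter> V3)"
      using card_Diff_subset_Int[of "N W x" V3] finN[OF W] x by (simp add: V3_def)
    then show "2 + (if x \<in> S1 then 1 else 0) \<le> card (N W x - V3)"
      using nbrs3_of_3[OF x] by (auto simp: S1_def)
  qed
  also have "(\<Sum>x\<in>V3. 2 + (if x \<in> S1 then 1 else 0)) = 2 * card V3 + card S1"
  proof -
    have "V3 \<inter> S1 = S1" by (auto simp: S1_def)
    then have "(\<Sum>x\<in>V3. if x \<in> S1 then 1 else 0) = card S1" using fin3 by (simp add: sum.If_cases)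
    then show ?thesis by (simp only: sum.distrib) simp
  qed
  finally have t: "2 * card V3 + card S1 \<le> (\<Sum>v\<in>?R. card (N W v \<inter> V3))" .
  have "(\<Sum>v\<in>?R. 160 + 15 * card (N W v \<inter> V3)) \<le> (\<Sum>v\<in>?R. 44 * deg v + (if v \<in> \<Lambda> then 14 else 0))"
    using local_ineq by (rule sum_mono)
  moreover have "(\<Sum>v\<in>?R. 160 + 15 * card (N W v \<inter> V3)) = 160 * card ?R + 15 * (\<Sum>v\<in>?R. card (N W v \<inter> V3))"
    by (simp add: sum.distrib sum_distrib_left)
  moreover have "(\<Sum>v\<in>?R. 44 * deg v + (if v \<in> \<Lambda> then 14 else 0)) = 44 * (\<Sum>v\<in>?R. deg v) + 14 * card \<Lambda>"
  proof -
    have "?R \<inter> \<Lambda> = \<Lambda>" using \<Lambda>R by blast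
    then have "(\<Sum>v\<in>?R. if v \<in> \<Lambda> then 14 else 0) = 14 * card \<Lambda>" using fR by (simp add: sum.If_cases)
    then show ?thesis by (simp only: sum.distrib sum_distrib_left)
  qed
  moreover have "(\<Sum>v\<in>W. deg v) = (\<Sum>v\<in>?R. deg v) + 3 * card V3"
  proof -
    have "(\<Sum>v\<in>V3. deg v) = 3 * card V3" by (simp add: V3_def)
    then show ?thesis using sum.subset_diff[OF V3_W finW, of deg] by simp
  qed
  moreover have "card W = card ?R + card V3"
    using card_Diff_subset[OF fin3 V3_W] card_mono[OF finW V3_W] by simp
  moreover have "card S1 \<le> card V3" by (rule card_mono[OF fin3]) (auto simp: S1_def)
  \<comment> \<open>A vertex of degree 3 lacks \<open>160 - 132 = 28\<close>, covered by two
    transfers of 15. The third transfer at a single vertex, again 15, pays the 14 kept back by one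
    link, and there are at most as many links as single vertices.\<close>
  ultimately show ?thesis using t l by linarith
qed

end

section \<open>Confronting the two bounds on the number of edges\<close>

lemma induced_nbrs_card:
  assumes "simple_graph G" "v \<in> W"
  shows "card {e \<in> edges (induced_subgraph G W). v \<in> e} = card (nbrs G W v)"
proof -
  have "{e \<in> edges (induced_subgraph G W). v \<in> e} = (\<lambda>x. {v, x}) ` nbrs G W v"
  proof (intro equalityI subsetI)
    fix e assume "e \<in> {e \<in> edges (induced_subgraph G W). v \<in> e}"
    then have e: "e \<in> edges G" "e \<subseteq> W" "v \<in> e" by (auto simp: induced_subgraph_def)
    then have "card e = 2" using assms(1) by (simp add: simple_graph_def)
    then obtain a b where ab: "e = {a, b}" by (auto simp: card_2_iff)
    then have "e = {v, a} \<or> e = {v, b}" using e(3) by auto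
    then show "e \<in> (\<lambda>x. {v, x}) ` nbrs G W v" using e by (auto simp: nbrs_def)
  qed (use assms(2) in \<open>auto simp: nbrs_def induced_subgraph_def\<close>)
  moreover have "inj_on (\<lambda>x. {v, x}) (nbrs G W v)" by (auto simp: inj_on_def doubleton_eq_iff)
  ultimately show ?thesis by (simp add: card_image)
qed

lemma (in dp_cover) col_subgraphs:
  assumes d: "plane_drawing G p \<gamma>" and c3: "cycles G 3 = {}"
    and c4: "\<not> (\<exists>C\<in>cycles G 4. \<exists>C'\<in>cycles G 4. normally_adjacent C C')"
    and W: "W \<subseteq> verts G"
  shows "\<exists>\<phi>. col W \<phi>"
proof -
  have "finite W" by (rule finite_subset[OF W finV])
  then show ?thesis using W
  proof (induction W rule: finite_psubset_induct)
    case (psubset W)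
    show ?case
    proof (rule ccontr)
      assume bad: "\<not> ?thesis"
      interpret minimal_uncolorable G L H m W
      proof
        show "W \<subseteq> verts G" by (rule psubset.prems)
        show "z \<notin> N W y" if "x \<in> W" "y \<in> N W x" "z \<in> N W x" for x y z
        proof
          assume "z \<in> N W y"
          then have "{x, y} \<in> edges G" "{y, z} \<in> edges G" "{z, x} \<in> edges G"
            using that by (simp_all add: nbrs_def insert_commute)
          then show False using triangle_in_cycles[OF simple] c3 by blast
        qed
        show "\<exists>\<phi>. col W' \<phi>" if "W' \<subset> W" for W'
          using psubset.IH[OF that] psubset.prems that by auto
        show "\<not> (\<exists>\<phi>. col W \<phi>)" by (rule bad)
      qed
      let ?I = "induced_subgraph G W"
      have vI: "verts ?I = W" by (simp add: induced_subgraph_def)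
      have "W \<noteq> {}"
      proof
        assume "W = {}"
        then have "col W \<phi>" for \<phi> by (simp add: col_def pcol_def)
        then show False using bad by blast
      qed
      moreover interpret plane: plane_graph ?I p \<gamma>
        by unfold_locales (rule induced_simple[OF simple psubset.prems], rule restrict_drawing[OF d psubset.prems])
      have degI: "card {e \<in> edges ?I. v \<in> e} = deg v" if "v \<in> W" for v
        by (rule induced_nbrs_card[OF simple that])
      ultimately have "11 * card (edges ?I) + 40 \<le> 20 * card W"
        using plane.card_E_bound induced_cycles[OF psubset.prems, of 3] induced_cycles[OF psubset.prems, of 4]
          c3 c4 deg_ge3 vI by (simp add: subset_iff)
      moreover have "2 * card (edges ?I) = (\<Sum>v\<in>W. deg v)"
        using plane.handshake degI vI by simp
      \<comment> \<open>Since the degree sum is \<open>2 e\<close>, discharging gives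
        \<open>160 n \<le> 88 e\<close>, that is \<open>20 n \<le> 11 e\<close>, against
        \<open>11 e + 40 \<le> 20 n\<close>.\<close>
      ultimately show False using degree_sum by linarith
    qed
  qed
qed

theorem mainTheorem1:
  fixes G :: "'a sgraph" and m :: nat
  assumes "simple_graph G"
    and "planar G"
    and "cycles G 3 = {}"
    and "\<not> (\<exists>C\<in>cycles G 4. \<exists>C'\<in>cycles G 4. normally_adjacent C C')"
    and "m > 0"
  shows "dp_colorable TYPE('b) G (7 * m) (2 * m)"
  unfolding dp_colorable_def fg_dp_colorable_def
proof (intro allI impI)
  fix L :: "'a \<Rightarrow> 'b set" and H
  assume "f_cover G (\<lambda>_. 7 * m) L H"
  then interpret dp_cover G L H m using assms(1) by unfold_locales
  obtain p \<gamma> where "plane_drawing G p \<gamma>" using assms(2) by (auto simp: planar_def)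
  from col_subgraphs[OF this assms(3,4) order_refl]
  obtain \<phi> where "col (verts G) \<phi>" by blast
  then show "\<exists>S. cover_coloring G L H (\<lambda>_. 2 * m) S" by (rule cover_coloring_of_col)
qed

end
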